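(* Let $n\ge1$. Let $\overline{\mathcal F^l}$ denote the operator norm closure of $\mathcal F^l$ in $\mathcal L(F_1^2)$, which is a $C^*$ algebra. Then $$\mathcal T=\overline{\mathcal F^l}=C^*\big(\{T_f:\ f\in\mathrm{BMO}\text{ and }T_f\text{ bounded}\}\big).$$
   Context: Let $V$ be Lebesgue measure on $\mathbb{C}^n$, $z\cdot\overline w=\sum_j z_j\overline{w_j}$, $d\mu_t(z)=\frac1{(\pi t)^n}e^{-|z|^2/t}dV(z)$. Let $L_1^2=L^2(\mathbb{C}^n,\mu_1)$ and let $F_1^2=L_1^2\cap\mathrm{Hol}(\mathbb{C}^n)$ be the Fock space, a reproducing kernel Hilbert space with kernel $K_z(w)=e^{w\cdot\overline z}$ and normalized kernel $k_z=e^{-|z|^2/2}K_z$. $\mathcal L(F_1^2)$ is the algebra of bounded operators on $F_1^2$; for $M\subset\mathcal L(F_1^2)$, $C^*(M)$ is the $C^*$ algebra generated by $M$. $P:L_1^2\to F_1^2$ is the orthogonal projection. Toeplitz operators: for measurable $f:\mathbb{C}^n\to\mathbb{C}$ with $fK_z\in L_1^2$ for all $z\in\mathbb{C}^n$ (standing assumption on symbols), $T_fh=P(fh)$ on the dense domain $\{h\in F_1^2: fh\in L_1^2\}$. "$T_f$ bounded" means that it is bounded on this domain; it is then identified with its bounded extension to $F_1^2$. The Toeplitz algebra is $\mathcal T=C^*(\{T_f: f\in L^\infty(\mathbb{C}^n)\})$. BMO: for $z\in\mathbb{C}^n$ let $\tau_z(w)=z-w$, and let $\widetilde f^{(t)}(z)=\int_{\mathbb{C}^n}f\circ\tau_z\,d\mu_t$.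 A function $f\in L^1_{\mathrm{loc}}(\mathbb{C}^n)$ is in $\mathrm{BMO}$ if $\sup_{z\in\mathbb{C}^n}\int_{\mathbb{C}^n}|f\circ\tau_z-\widetilde f^{(t)}(z)|\,d\mu_t<\infty$; this notion is independent of the choice of $t>0$ (e.g. take $t=1$). The algebra $\mathcal F^l$: set $c_0=0$, $c_{j+1}=\frac{1}{4(1-c_j)}$ for $j\in\mathbb{N}_0=\{0,1,2,\dots\}$ (an increasing sequence with $c_j<\frac12$). For measurable $f$ let $\|f\|_{\mathcal D_{c_j}}=\operatorname{ess\,sup}_{z}|f(z)e^{-c_j|z|^2}|$, let $\mathcal D_{c_j}$ be the Banach space of measurable $f$ with $\|f\|_{\mathcal D_{c_j}}<\infty$, let $\mathcal H_{c_j}=\mathcal D_{c_j}\cap\mathrm{Hol}(\mathbb{C}^n)$ with the same norm, and $\mathcal H=\bigcup_{j}\mathcal H_{c_j}\subset F_1^2$. For $z\in\mathbb{C}^n$ the Weyl operator $W_z$ on $F_1^2$ is the unitary $W_zf(w)=k_z(w)f(w-z)$, and for an operator $A$ on $F_1^2$ put $A_z=W_z^*AW_z$. Then $\mathcal F^l$ is the set of bounded $\mathbb{C}$-linear operators $A:F_1^2\to F_1^2$ with $A(\mathcal H)\subset\mathcal H$ such that for each $j_1\in\mathbb{N}_0$ there exist $j_2\ge j_1$ and $d>0$, independent of $z$, with $\|A_zf\|_{\mathcal D_{c_{j_2}}}\le d\|f\|_{\mathcal D_{c_{j_1}}}$ for all $f\in\mathcal H_{c_{j_1}}$ and all $z\in\mathbb{C}^n$.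 *)

theory Defs
  imports "HOL-Analysis.Analysis" "HOL-Probability.Essential_Supremum"
begin

section \<open>Gaussian measures, square integrable functions, entire functions\<close>

text \<open>\<^term>\<open>lebesgue\<close> on \<open>complex^'n\<close> is Lebesgue measure on real \<open>2n\<close>-space, \<open>n = CARD('n)\<close>,
  and \<^term>\<open>norm\<close> is the Euclidean norm.\<close>

definition gauss :: "real \<Rightarrow> (complex^'n::finite) measure" where
  "gauss t = density lebesgue (\<lambda>z. ennreal (exp (- (norm z)\<^sup>2 / t) / (pi * t) ^ CARD('n)))"

definition L2_fun :: "(complex^'n::finite \<Rightarrow> complex) set" where
  "L2_fun = {g \<in> borel_measurable lebesgue. integrable (gauss 1) (\<lambda>w. (cmod (g w))\<^sup>2)}"

definition entire :: "(complex^'n::finite \<Rightarrow> complex) \<Rightarrow> bool" where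
  "entire f \<longleftrightarrow> (\<forall>z. \<exists>D. (f has_derivative D) (at z) \<and> (\<forall>c v. D (c *s v) = c * D v))"

definition hdot :: "complex^'n::finite \<Rightarrow> complex^'n \<Rightarrow> complex" where
  "hdot z w = (\<Sum>j\<in>UNIV. z $ j * cnj (w $ j))"

definition ker :: "complex^'n::finite \<Rightarrow> complex^'n \<Rightarrow> complex" where
  "ker z w = exp (hdot w z)"

definition nker :: "complex^'n::finite \<Rightarrow> complex^'n \<Rightarrow> complex" where
  "nker z w = of_real (exp (- (norm z)\<^sup>2 / 2)) * ker z w"

lemma sets_gauss [simp]: "sets (gauss t) = sets lebesgue"
  by (simp add: gauss_def)

lemma space_gauss [simp]: "space (gauss t) = UNIV"
  by (simp add: gauss_def)

lemma borel_measurable_gauss [simp]: "borel_measurable (gauss t) = borel_measurable lebesgue"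
  by (rule measurable_cong_sets) auto

lemma gauss_weight_measurable:
  "(\<lambda>z::complex^'n::finite. exp (- (norm z)\<^sup>2 / t) / (pi * t) ^ CARD('n)) \<in> borel_measurable borel"
  by measurable

lemma gauss_weight_measurable':
  "(\<lambda>z::complex^'n::finite. exp (- (norm z)\<^sup>2 / t) / (pi * t) ^ CARD('n)) \<in> borel_measurable lebesgue"
  using gauss_weight_measurable by (intro measurable_completion) simp

lemma L2_funD:
  assumes "f \<in> L2_fun"
  shows "f \<in> borel_measurable lebesgue" "integrable (gauss 1) (\<lambda>w. (cmod (f w))\<^sup>2)"
  using assms by (auto simp: L2_fun_def)

lemma L2_fun_add:
  assumes "f \<in> L2_fun" "g \<in> L2_fun"
  shows "(\<lambda>z. f z + g z) \<in> L2_fun"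
proof -
  note [measurable] = L2_funD(1)[OF assms(1)] L2_funD(1)[OF assms(2)]
  have *: "(cmod (f w + g w))\<^sup>2 \<le> 2 * (cmod (f w))\<^sup>2 + 2 * (cmod (g w))\<^sup>2" for w
  proof -
    have "(cmod (f w + g w))\<^sup>2 \<le> (cmod (f w) + cmod (g w))\<^sup>2"
      by (simp add: norm_triangle_ineq power_mono)
    also have "\<dots> \<le> 2 * (cmod (f w))\<^sup>2 + 2 * (cmod (g w))\<^sup>2"
      using sum_squares_bound[of "cmod (f w)" "cmod (g w)"] by (simp add: power2_sum)
    finally show ?thesis .
  qed
  have "integrable (gauss 1) (\<lambda>w. (cmod (f w + g w))\<^sup>2)"
    by (rule Bochner_Integration.integrable_bound
          [where f = "\<lambda>w. 2 * (cmod (f w))\<^sup>2 + 2 * (cmod (g w))\<^sup>2"])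
       (use L2_funD(2)[OF assms(1)] L2_funD(2)[OF assms(2)] * in auto)
  then show ?thesis by (auto simp: L2_fun_def)
qed

lemma L2_fun_scale:
  assumes "f \<in> L2_fun"
  shows "(\<lambda>z. c * f z) \<in> L2_fun"
proof -
  note [measurable] = L2_funD(1)[OF assms]
  show ?thesis
    using L2_funD(2)[OF assms] by (auto simp: L2_fun_def norm_mult power_mult_distrib)
qed

lemma L2_fun_inner_integrable:
  assumes "f \<in> L2_fun" "g \<in> L2_fun"
  shows "integrable (gauss 1) (\<lambda>w. f w * cnj (g w))"
proof (rule Bochner_Integration.integrable_bound
          [where f = "\<lambda>w. (cmod (f w))\<^sup>2 + (cmod (g w))\<^sup>2"])
  note [measurable] = L2_funD(1)[OF assms(1)] L2_funD(1)[OF assms(2)]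
  have "(\<lambda>w. cnj (g w)) \<in> borel_measurable lebesgue"
    using borel_measurable_continuous_on[OF continuous_on_cnj[OF continuous_on_id]] L2_funD(1)[OF assms(2)] by blast
  then show "(\<lambda>w. f w * cnj (g w)) \<in> borel_measurable (gauss 1)"
    by simp
  have "cmod (f w) * cmod (g w) \<le> (cmod (f w))\<^sup>2 + (cmod (g w))\<^sup>2" for w
    using sum_squares_bound[of "cmod (f w)" "cmod (g w)"]
      mult_nonneg_nonneg[of "cmod (f w)" "cmod (g w)"] norm_ge_zero[of "f w"] norm_ge_zero[of "g w"]
    by linarith
  then show "AE w in gauss 1. norm (f w * cnj (g w)) \<le> norm ((cmod (f w))\<^sup>2 + (cmod (g w))\<^sup>2)"
    by (simp add: norm_mult)
qed (use L2_funD(2)[OF assms(1)] L2_funD(2)[OF assms(2)] in auto)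

lemma entire_add: "entire f \<Longrightarrow> entire g \<Longrightarrow> entire (\<lambda>z. f z + g z)"
  unfolding entire_def
proof
  fix z assume "\<forall>z. \<exists>D. (f has_derivative D) (at z) \<and> (\<forall>c v. D (c *s v) = c * D v)"
    "\<forall>z. \<exists>D. (g has_derivative D) (at z) \<and> (\<forall>c v. D (c *s v) = c * D v)"
  then obtain D E where "(f has_derivative D) (at z)" "\<forall>c v. D (c *s v) = c * D v"
     "(g has_derivative E) (at z)" "\<forall>c v. E (c *s v) = c * E v" by blast
  then show "\<exists>D. ((\<lambda>z. f z + g z) has_derivative D) (at z) \<and> (\<forall>c v. D (c *s v) = c * D v)"
    by (intro exI[of _ "\<lambda>v. D v + E v"]) (auto intro!: derivative_eq_intros simp: algebra_simps)
qed

lemma entire_mult: "entire f \<Longrightarrow> entire g \<Longrightarrow> entire (\<lambda>z. f z * g z)"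
  unfolding entire_def
proof
  fix z assume "\<forall>z. \<exists>D. (f has_derivative D) (at z) \<and> (\<forall>c v. D (c *s v) = c * D v)"
    "\<forall>z. \<exists>D. (g has_derivative D) (at z) \<and> (\<forall>c v. D (c *s v) = c * D v)"
  then obtain D E where "(f has_derivative D) (at z)" "\<forall>c v. D (c *s v) = c * D v"
     "(g has_derivative E) (at z)" "\<forall>c v. E (c *s v) = c * E v" by blast
  then show "\<exists>D. ((\<lambda>z. f z * g z) has_derivative D) (at z) \<and> (\<forall>c v. D (c *s v) = c * D v)"
    by (intro exI[of _ "\<lambda>v. f z * E v + D v * g z"]) (auto intro!: derivative_eq_intros simp: algebra_simps)
qed

lemma entire_const: "entire (\<lambda>_. c)"
  unfolding entire_def by (intro allI exI[of _ "\<lambda>_. 0"]) auto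

lemma entire_shift: 
  assumes "entire f"
  shows "entire (\<lambda>w. f (w - z))"
  unfolding entire_def
proof
  fix w
  obtain D where D: "(f has_derivative D) (at (w - z))" "\<forall>c v. D (c *s v) = c * D v"
    using assms unfolding entire_def by blast
  have "((\<lambda>w. w - z) has_derivative (\<lambda>v. v)) (at w)"
    by (auto intro!: derivative_eq_intros)
  from has_derivative_compose[OF this D(1)] D(2)
  show "\<exists>D. ((\<lambda>w. f (w - z)) has_derivative D) (at w) \<and> (\<forall>c v. D (c *s v) = c * D v)"
    by blast
qed

lemma hdot_scale: "hdot (c *s v) z = c * hdot v z"
  by (simp add: hdot_def sum_distrib_left mult.assoc)

lemma entire_ker: "entire (ker z)"
  unfolding entire_def
proof
  fix w :: "complex^'a"
  have "((\<lambda>w. hdot w z) has_derivative (\<lambda>v. hdot v z)) (at w)"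
    unfolding hdot_def by (auto intro!: derivative_eq_intros bounded_linear.has_derivative[OF bounded_linear_vec_nth])
  then have "((\<lambda>w. exp (hdot w z)) has_derivative (\<lambda>v. exp (hdot w z) * hdot v z)) (at w)"
    using has_derivative_compose[OF _ DERIV_exp[unfolded has_field_derivative_def]] by blast
  then show "\<exists>D. (ker z has_derivative D) (at w) \<and> (\<forall>c v. D (c *s v) = c * D v)"
    by (intro exI[of _ "\<lambda>v. exp (hdot w z) * hdot v z"])
       (simp add: ker_def[abs_def] hdot_scale mult_ac)
qed

lemma entire_nker: "entire (nker z)"
  using entire_mult[OF entire_const entire_ker, of "of_real (exp (- (norm z)\<^sup>2 / 2))" z]
  by (simp add: nker_def[abs_def])

lemma entire_continuous: "entire f \<Longrightarrow> continuous_on UNIV f"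
  unfolding entire_def by (meson continuous_at_imp_continuous_on has_derivative_continuous)

lemma entire_measurable: "entire f \<Longrightarrow> f \<in> borel_measurable borel"
  by (simp add: entire_continuous borel_measurable_continuous_onI)

section \<open>The Fock space\<close>

typedef ('n::finite) fock = "{f :: complex^'n \<Rightarrow> complex. entire f \<and> f \<in> L2_fun}"
  morphisms fock_fun Abs_fock
  by (rule exI[of _ "\<lambda>_. 0"]) (auto simp: entire_const L2_fun_def)

setup_lifting type_definition_fock

lift_definition fock_scaleC :: "complex \<Rightarrow> 'n::finite fock \<Rightarrow> 'n fock" is "\<lambda>c f z. c * f z"
  by (auto intro: entire_mult entire_const L2_fun_scale)

definition fock_cinner :: "'n::finite fock \<Rightarrow> 'n fock \<Rightarrow> complex" where
  "fock_cinner f g = (\<integral>w. fock_fun f w * cnj (fock_fun g w) \<partial>gauss 1)"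

lemma entire_AE_zero:
  assumes "entire f" and "AE w in lebesgue. f w = 0"
  shows "f = (\<lambda>_. 0)"
proof (rule ccontr)
  assume "f \<noteq> (\<lambda>_. 0)"
  then obtain a where a: "f a \<noteq> 0" by auto
  let ?U = "{w. f w \<noteq> 0}"
  have "open ?U"
    using entire_continuous[OF assms(1)] by (intro open_Collect_neq) auto
  moreover have "?U \<in> null_sets lebesgue"
  proof (subst AE_iff_null_sets)
    show "?U \<in> sets lebesgue"
      using \<open>open ?U\<close> by (intro sets_completionI_sets) simp
  qed (use assms(2) in simp)
  ultimately show False
    using a open_not_negligible[of ?U] by (auto simp: negligible_iff_null_sets)
qed

instantiation fock :: (finite) real_vector
begin

lift_definition zero_fock :: "'a fock" is "\<lambda>_. 0"
  by (auto simp: entire_const L2_fun_def)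

lift_definition plus_fock :: "'a fock \<Rightarrow> 'a fock \<Rightarrow> 'a fock" is "\<lambda>f g z. f z + g z"
  by (auto intro: entire_add L2_fun_add)

lift_definition uminus_fock :: "'a fock \<Rightarrow> 'a fock" is "\<lambda>f z. - f z"
  using entire_mult[OF entire_const[of "-1"]] L2_fun_scale[of _ "-1"] by auto

definition minus_fock :: "'a fock \<Rightarrow> 'a fock \<Rightarrow> 'a fock" where
  "minus_fock f g = f + (- g)"

definition scaleR_fock :: "real \<Rightarrow> 'a fock \<Rightarrow> 'a fock" where
  "scaleR_fock r f = fock_scaleC (of_real r) f"

instance
proof
  fix f g h :: "'a fock" and r s :: real
  show "f + g + h = f + (g + h)" "f + g = g + f" "0 + f = f" "- f + f = 0"
    by (transfer; simp add: algebra_simps)+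
  show "f - g = f + - g" by (simp add: minus_fock_def)
  show "r *\<^sub>R (f + g) = r *\<^sub>R f + r *\<^sub>R g" "(r + s) *\<^sub>R f = r *\<^sub>R f + s *\<^sub>R f"
    "r *\<^sub>R s *\<^sub>R f = (r * s) *\<^sub>R f" "1 *\<^sub>R f = f"
    unfolding scaleR_fock_def by (transfer; simp add: algebra_simps)+
qed

end

instantiation fock :: (finite) real_inner
begin

definition inner_fock :: "'a fock \<Rightarrow> 'a fock \<Rightarrow> real" where
  "inner_fock f g = Re (fock_cinner f g)"

definition norm_fock :: "'a fock \<Rightarrow> real" where
  "norm_fock f = sqrt (inner f f)"

definition sgn_fock :: "'a fock \<Rightarrow> 'a fock" where
  "sgn_fock f = f /\<^sub>R norm f"

definition dist_fock :: "'a fock \<Rightarrow> 'a fock \<Rightarrow> real" where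
  "dist_fock f g = norm (f - g)"

definition uniformity_fock :: "('a fock \<times> 'a fock) filter" where
  "uniformity_fock = (INF e\<in>{0<..}. principal {(f, g). dist f g < e})"

definition open_fock :: "'a fock set \<Rightarrow> bool" where
  "open_fock U = (\<forall>f\<in>U. \<forall>\<^sub>F (f', g) in uniformity. f' = f \<longrightarrow> g \<in> U)"

instance
proof
  fix f g h :: "'a fock" and r s :: real
  have L2: "fock_fun f \<in> L2_fun" for f :: "'a fock"
    using fock_fun[of f] by simp
  show "dist f g = norm (f - g)" by (simp add: dist_fock_def)
  show "sgn f = f /\<^sub>R norm f" by (simp add: sgn_fock_def)
  show "(uniformity :: ('a fock \<times> 'a fock) filter) = (INF e\<in>{0<..}. principal {(f, g). dist f g < e})"
    by (simp add: uniformity_fock_def)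
  show "open U = (\<forall>f\<in>U. \<forall>\<^sub>F (f', g) in uniformity. f' = f \<longrightarrow> g \<in> U)" for U :: "'a fock set"
    by (simp add: open_fock_def)
  show "norm f = sqrt (inner f f)" by (simp add: norm_fock_def)
  have "fock_cinner g f = cnj (fock_cinner f g)"
    using Bochner_Integration.integral_cnj[of "gauss 1" "\<lambda>w. fock_fun f w * cnj (fock_fun g w)"]
    by (simp add: fock_cinner_def mult.commute)
  then show "inner f g = inner g f" by (simp add: inner_fock_def)
  have "fock_cinner (f + g) h = fock_cinner f h + fock_cinner g h"
    unfolding fock_cinner_def plus_fock.rep_eq distrib_right
    by (rule Bochner_Integration.integral_add) (auto intro: L2_fun_inner_integrable L2)
  then show "inner (f + g) h = inner f h + inner g h" by (simp add: inner_fock_def)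
  have "fock_cinner (r *\<^sub>R f) g = of_real r * fock_cinner f g"
    unfolding fock_cinner_def scaleR_fock_def fock_scaleC.rep_eq mult.assoc
    by simp
  then show "inner (r *\<^sub>R f) g = r * inner f g" by (simp add: inner_fock_def)
  have eq: "inner f f = (\<integral>w. (cmod (fock_fun f w))\<^sup>2 \<partial>gauss 1)"
    unfolding inner_fock_def fock_cinner_def complex_norm_square[symmetric]
    by (simp only: integral_complex_of_real Re_complex_of_real)
  show "0 \<le> inner f f" unfolding eq by simp
  show "inner f f = 0 \<longleftrightarrow> f = 0"
  proof
    assume "inner f f = 0"
    then have "AE w in gauss 1. (cmod (fock_fun f w))\<^sup>2 = 0"
      unfolding eq by (subst (asm) integral_nonneg_eq_0_iff_AE) (use L2_funD(2)[OF L2] in auto)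
    moreover have "(\<lambda>z::complex^'a. ennreal (exp (- (norm z)\<^sup>2 / 1) / (pi * 1) ^ CARD('a)))
        \<in> borel_measurable lebesgue"
      by (rule measurable_compose[OF gauss_weight_measurable' measurable_ennreal])
    ultimately have "AE w in lebesgue. fock_fun f w = 0"
      unfolding gauss_def by (subst (asm) AE_density) auto
    then have "fock_fun f = (\<lambda>_. 0)"
      using fock_fun[of f] by (intro entire_AE_zero) auto
    then show "f = 0" by transfer simp
  next
    assume "f = 0"
    then show "inner f f = 0" unfolding eq by (simp add: zero_fock.rep_eq)
  qed
qed

end

section \<open>Bounded operators and \<open>C\<^sup>*\<close> algebras\<close>

text \<open>The type of bounded real-linear maps supplies operator norm, norm topology (hence
  \<^term>\<open>closure\<close>) and composition; \<open>bdd_ops\<close> is the algebra of bounded complex-linear operators.\<close>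

type_synonym 'n fock_op = "'n fock \<Rightarrow>\<^sub>L 'n fock"

definition bdd_ops :: "('n::finite) fock_op set" where
  "bdd_ops = {A. \<forall>c f. blinfun_apply A (fock_scaleC c f) = fock_scaleC c (blinfun_apply A f)}"

lemma norm_fock_scaleC: "norm (fock_scaleC c f) = cmod c * norm f"
proof -
  have "fock_cinner (fock_scaleC c f) (fock_scaleC c f) = of_real ((cmod c)\<^sup>2) * fock_cinner f f"
    unfolding fock_cinner_def fock_scaleC.rep_eq
    by (subst integral_mult_right_zero[symmetric], rule Bochner_Integration.integral_cong)
       (use complex_norm_square[of c] in \<open>simp_all add: mult_ac\<close>)
  then show ?thesis
    by (simp add: norm_fock_def inner_fock_def real_sqrt_mult)
qed

lemma bounded_linear_fock_scaleC: "bounded_linear (fock_scaleC c)"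
proof (rule bounded_linear_intro[where K = "cmod c"])
  fix f g :: "'a fock" and r :: real
  show "fock_scaleC c (f + g) = fock_scaleC c f + fock_scaleC c g"
    by transfer (simp add: algebra_simps)
  show "fock_scaleC c (r *\<^sub>R f) = r *\<^sub>R fock_scaleC c f"
    unfolding scaleR_fock_def by transfer (simp add: algebra_simps)
qed (simp add: norm_fock_scaleC)

definition op_scaleC :: "complex \<Rightarrow> ('n::finite) fock_op \<Rightarrow> 'n fock_op" where
  "op_scaleC c A = Blinfun (fock_scaleC c) o\<^sub>L A"

lemma op_scaleC_apply [simp]: "blinfun_apply (op_scaleC c A) f = fock_scaleC c (blinfun_apply A f)"
  by (simp add: op_scaleC_def bounded_linear_Blinfun_apply[OF bounded_linear_fock_scaleC])

definition op_adj :: "('n::finite) fock_op \<Rightarrow> 'n fock_op" where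
  "op_adj A = (THE B. \<forall>f g. fock_cinner (blinfun_apply A f) g = fock_cinner f (blinfun_apply B g))"

definition cstar_subalgebra :: "('n::finite) fock_op set \<Rightarrow> bool" where
  "cstar_subalgebra S \<longleftrightarrow> S \<subseteq> bdd_ops \<and> 0 \<in> S \<and> closed S \<and>
     (\<forall>A\<in>S. \<forall>B\<in>S. A + B \<in> S \<and> A o\<^sub>L B \<in> S) \<and>
     (\<forall>A\<in>S. (\<forall>c. op_scaleC c A \<in> S) \<and> op_adj A \<in> S)"

definition cstar_generated :: "('n::finite) fock_op set \<Rightarrow> 'n fock_op set" where
  "cstar_generated M = \<Inter> {S. cstar_subalgebra S \<and> M \<subseteq> S}"

section \<open>Toeplitz operators\<close>

text \<open>Orthogonal projection onto the Fock space; meaningful for \<open>g \<in> L2_fun\<close>.\<close>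

definition fock_proj :: "(complex^'n::finite \<Rightarrow> complex) \<Rightarrow> 'n fock" where
  "fock_proj g = (THE p. \<forall>h. (\<integral>w. (g w - fock_fun p w) * cnj (fock_fun h w) \<partial>gauss 1) = 0)"

definition toeplitz_symbol :: "(complex^'n::finite \<Rightarrow> complex) \<Rightarrow> bool" where
  "toeplitz_symbol f \<longleftrightarrow> f \<in> borel_measurable lebesgue \<and> (\<forall>z. (\<lambda>w. f w * ker z w) \<in> L2_fun)"

definition toeplitz_dom :: "(complex^'n::finite \<Rightarrow> complex) \<Rightarrow> 'n fock set" where
  "toeplitz_dom f = {h. (\<lambda>w. f w * fock_fun h w) \<in> L2_fun}"

definition toeplitz_fun :: "(complex^'n::finite \<Rightarrow> complex) \<Rightarrow> 'n fock \<Rightarrow> 'n fock" where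
  "toeplitz_fun f h = fock_proj (\<lambda>w. f w * fock_fun h w)"

definition toeplitz_bounded :: "(complex^'n::finite \<Rightarrow> complex) \<Rightarrow> bool" where
  "toeplitz_bounded f \<longleftrightarrow> (\<exists>C. \<forall>h\<in>toeplitz_dom f. norm (toeplitz_fun f h) \<le> C * norm h)"

text \<open>The bounded extension, unique because the domain is dense.\<close>

definition toeplitz :: "(complex^'n::finite \<Rightarrow> complex) \<Rightarrow> 'n fock_op" where
  "toeplitz f = (THE A. A \<in> bdd_ops \<and> (\<forall>h\<in>toeplitz_dom f. blinfun_apply A h = toeplitz_fun f h))"

definition Linfty :: "(complex^'n::finite \<Rightarrow> complex) set" where
  "Linfty = {f \<in> borel_measurable lebesgue. esssup lebesgue (\<lambda>z. ennreal (cmod (f z))) < \<infinity>}"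

definition toeplitz_algebra :: "('n::finite) fock_op set" where
  "toeplitz_algebra = cstar_generated {toeplitz f | f. f \<in> Linfty}"

definition heat :: "real \<Rightarrow> (complex^'n::finite \<Rightarrow> complex) \<Rightarrow> complex^'n \<Rightarrow> complex" where
  "heat t f z = (\<integral>w. f (z - w) \<partial>gauss t)"

text \<open>The notion does not depend on the Gaussian parameter; it is taken to be 1.\<close>

definition BMO :: "(complex^'n::finite \<Rightarrow> complex) set" where
  "BMO = {f \<in> borel_measurable lebesgue.
     (\<forall>K. compact K \<longrightarrow> set_integrable lebesgue K f) \<and>
     (\<forall>z. integrable (gauss 1) (\<lambda>w. f (z - w))) \<and>
     (SUP z. \<integral>\<^sup>+w. ennreal (cmod (f (z - w) - heat 1 f z)) \<partial>gauss 1) < \<infinity>}"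

section \<open>The algebra \<open>\<F>\<^sup>l\<close>\<close>

fun cseq :: "nat \<Rightarrow> real" where
  "cseq 0 = 0"
| "cseq (Suc j) = 1 / (4 * (1 - cseq j))"

definition Dnorm :: "real \<Rightarrow> (complex^'n::finite \<Rightarrow> complex) \<Rightarrow> ennreal" where
  "Dnorm c f = esssup lebesgue (\<lambda>z. ennreal (cmod (f z * of_real (exp (- c * (norm z)\<^sup>2)))))"

definition Dspace :: "real \<Rightarrow> (complex^'n::finite \<Rightarrow> complex) set" where
  "Dspace c = {f \<in> borel_measurable lebesgue. Dnorm c f < \<infinity>}"

text \<open>Entire functions in \<open>Dspace c\<close> are square integrable for \<open>c < 1/2\<close>, so these are all of them
  when \<open>c = cseq j\<close>.\<close>

definition Hspace :: "real \<Rightarrow> ('n::finite) fock set" where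
  "Hspace c = {h. fock_fun h \<in> Dspace c}"

definition Hunion :: "('n::finite) fock set" where
  "Hunion = (\<Union>j. Hspace (cseq j))"

lemma weyl_weight:
  "(cmod (nker z w))\<^sup>2 * exp (- (norm w)\<^sup>2) = exp (- (norm (w - z))\<^sup>2)"
proof -
  have "Re (hdot w z) = inner w z"
    by (simp add: hdot_def inner_vec_def inner_complex_def)
  then have "cmod (nker z w) = exp (- (norm z)\<^sup>2 / 2 + inner w z)"
    by (simp add: nker_def ker_def norm_mult flip: exp_add)
  then have "(cmod (nker z w))\<^sup>2 = exp (- (norm z)\<^sup>2 + 2 * inner w z)"
    by (simp add: power2_eq_square flip: exp_add)
  then show ?thesis
    by (simp add: power2_norm_eq_inner inner_diff inner_commute flip: exp_add)
qed

lemma weyl_L2: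
  fixes f :: "complex^'n::finite \<Rightarrow> complex"
  assumes "entire f" "f \<in> L2_fun"
  shows "(\<lambda>w. nker z w * f (w - z)) \<in> L2_fun" (is ?A)
    and "(\<integral>w. (cmod (nker z w * f (w - z)))\<^sup>2 \<partial>gauss 1) = (\<integral>w. (cmod (f w))\<^sup>2 \<partial>gauss 1)" (is ?B)
proof -
  let ?p = "\<lambda>w::complex^'n. exp (- (norm w)\<^sup>2 / 1) / (pi * 1) ^ CARD('n)"
  let ?g = "\<lambda>w. ?p w *\<^sub>R (cmod (f w))\<^sup>2"
  let ?Wf = "\<lambda>w. nker z w * f (w - z)"
  note [measurable] = entire_measurable[OF assms(1)] entire_measurable[OF entire_nker[of z]]
  have g: "?g \<in> borel_measurable borel" by measurable
  have leb: "h \<in> borel_measurable lebesgue" if "h \<in> borel_measurable borel"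
    for h :: "complex^'n \<Rightarrow> 'b::topological_space"
    using that by (intro measurable_completion) simp
  have shift: "?p w *\<^sub>R (cmod (?Wf w))\<^sup>2 = ?g (- z + w)" for w
    using weyl_weight[of z w] by (simp add: norm_mult power_mult_distrib field_simps)
  have int: "integrable (gauss 1) h \<longleftrightarrow> integrable lborel (\<lambda>w. ?p w *\<^sub>R h w)"
    and eq: "integral\<^sup>L (gauss 1) h = integral\<^sup>L lborel (\<lambda>w. ?p w *\<^sub>R h w)"
    if [measurable]: "h \<in> borel_measurable borel" for h :: "complex^'n \<Rightarrow> real"
  proof -
    have m: "(\<lambda>w. ?p w *\<^sub>R h w) \<in> borel_measurable lborel" by measurable
    show "integrable (gauss 1) h \<longleftrightarrow> integrable lborel (\<lambda>w. ?p w *\<^sub>R h w)"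
      unfolding gauss_def integrable_completion[OF m, symmetric]
      by (rule integrable_density) (auto intro: leb gauss_weight_measurable'[of 1, simplified])
    show "integral\<^sup>L (gauss 1) h = integral\<^sup>L lborel (\<lambda>w. ?p w *\<^sub>R h w)"
      unfolding gauss_def integral_completion[OF m, symmetric]
      by (rule integral_density) (auto intro: leb gauss_weight_measurable'[of 1, simplified])
  qed
  have m1: "(\<lambda>w. (cmod (?Wf w))\<^sup>2) \<in> borel_measurable borel" by measurable
  have m2: "(\<lambda>w. (cmod (f w))\<^sup>2) \<in> borel_measurable borel" by measurable
  have m3: "(+) (- z) \<in> measurable lborel borel" by simp
  have "integrable (gauss 1) (\<lambda>w. (cmod (?Wf w))\<^sup>2) \<longleftrightarrow> integrable lborel (\<lambda>w. ?g (- z + w))"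
    unfolding int[OF m1] shift ..
  also have "\<dots> \<longleftrightarrow> integrable lborel ?g"
    using integrable_distr_eq[OF m3 g] by (simp only: lborel_distr_plus)
  also have "\<dots>" using L2_funD(2)[OF assms(2)] unfolding int[OF m2] .
  finally have "integrable (gauss 1) (\<lambda>w. (cmod (?Wf w))\<^sup>2)" .
  moreover have "?Wf \<in> borel_measurable borel" by measurable
  ultimately show ?A by (auto simp: L2_fun_def intro: leb)
  have "(\<integral>w. (cmod (?Wf w))\<^sup>2 \<partial>gauss 1) = (\<integral>w. ?g (- z + w) \<partial>lborel)"
    unfolding eq[OF m1] shift ..
  also have "\<dots> = (\<integral>w. ?g w \<partial>lborel)"
    using integral_distr[OF m3 g] by (simp only: lborel_distr_plus)
  also have "\<dots> = (\<integral>w. (cmod (f w))\<^sup>2 \<partial>gauss 1)" unfolding eq[OF m2] ..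
  finally show ?B .
qed

lift_definition weyl_fun :: "complex^'n::finite \<Rightarrow> 'n fock \<Rightarrow> 'n fock"
  is "\<lambda>z f w. nker z w * f (w - z)"
  by (auto intro!: weyl_L2(1) entire_mult entire_nker entire_shift)

lemma norm_fock_eq: "norm f = sqrt (\<integral>w. (cmod (fock_fun f w))\<^sup>2 \<partial>gauss 1)"
  unfolding norm_fock_def inner_fock_def fock_cinner_def complex_norm_square[symmetric]
  by (simp only: integral_complex_of_real Re_complex_of_real)

lift_definition weyl :: "complex^'n::finite \<Rightarrow> 'n fock_op" is weyl_fun
proof (rule bounded_linear_intro[where K = 1])
  fix z :: "complex^'n" and f g :: "'n fock" and r :: real
  show "weyl_fun z (f + g) = weyl_fun z f + weyl_fun z g"
    by transfer (simp add: algebra_simps)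
  show "weyl_fun z (r *\<^sub>R f) = r *\<^sub>R weyl_fun z f"
    unfolding scaleR_fock_def by transfer (simp add: algebra_simps)
  show "norm (weyl_fun z f) \<le> norm f * 1"
    unfolding norm_fock_eq weyl_fun.rep_eq using weyl_L2(2)[of "fock_fun f" z] fock_fun[of f] by simp
qed

definition weyl_conj :: "complex^'n::finite \<Rightarrow> 'n fock_op \<Rightarrow> 'n fock_op" where
  "weyl_conj z A = op_adj (weyl z) o\<^sub>L A o\<^sub>L weyl z"

definition Fl :: "('n::finite) fock_op set" where
  "Fl = {A \<in> bdd_ops. blinfun_apply A ` Hunion \<subseteq> Hunion \<and>
     (\<forall>j1. \<exists>j2\<ge>j1. \<exists>d>0. \<forall>h\<in>Hspace (cseq j1). \<forall>z.
        Dnorm (cseq j2) (fock_fun (blinfun_apply (weyl_conj z A) h))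
          \<le> ennreal d * Dnorm (cseq j1) (fock_fun h))}"

end

theory Submission
  imports Defs "HOL-Complex_Analysis.Cauchy_Integral_Formula" "HOL-Probability.Distributions"
    "HOL-Real_Asymp.Real_Asymp"
begin

text \<open>
  Everything is read off the matrix \<open>\<langle>A k\<^sub>z, k\<^sub>w\<rangle>\<close> of an operator with respect to the normalized kernels.
  Since \<open>c\<^sub>j = j / (2 (j + 1))\<close> tends to \<open>1/2\<close>, membership in \<open>\<F>\<^sup>l\<close> is equivalent to a Gaussian off-diagonal
  bound \<open>d exp (- \<gamma> |w - z|\<^sup>2)\<close> for some \<open>d\<close> and \<open>\<gamma> > 0\<close>, and such operators visibly form a \<open>*\<close>-algebra.

  If \<open>f\<close> is in BMO and \<open>T\<^sub>f\<close> is bounded, then the Berezin transform \<open>\<langle>T\<^sub>f k\<^sub>z, k\<^sub>z\<rangle>\<close> of \<open>f\<close> is bounded, hence so is that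
  of \<open>|f|\<close>; the identity \<open>|u - z|\<^sup>2 + |u - w|\<^sup>2 = |z - w|\<^sup>2 / 2 + 2 |u - (z + w)/2|\<^sup>2\<close> then bounds the matrix of
  \<open>T\<^sub>f\<close> by a multiple of \<open>exp (- |z - w|\<^sup>2 / 4)\<close>.

  Conversely, resolving the identity twice writes \<open>A\<close> in \<open>\<F>\<^sup>l\<close> as an integral over \<open>\<xi>\<close> of \<open>W\<^sub>\<xi> T\<^bsub>\<phi>\<^esub>\<close> with
  \<open>\<phi>\<close> depending on \<open>\<xi>\<close> and \<open>|\<phi>| \<le> d exp (- \<gamma> |\<xi>|\<^sup>2)\<close>. Replacing \<open>k\<^sub>\<xi>\<close> by \<open>k\<^bsub>s \<xi>\<^esub>\<close> for a simple function \<open>s\<close> close to the identity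
  turns the integral into a finite sum, at a cost controlled in operator norm by Schur's test. As \<open>W\<^sub>\<xi>\<close> is
  itself a Toeplitz operator with bounded symbol, \<open>A\<close> is a norm limit of elements of the Toeplitz algebra.
\<close>

section \<open>Lebesgue integration on Euclidean space\<close>

text \<open>Two choices shape the development. First, everything stays scalar: operators come from
  bounded sesquilinear forms, and integrals of operators are read only through
  \<open>fock_cinner\<close>. This rests on Riesz representation, hence on completeness of the Fock
  space, which also gives content to the definite descriptions \<open>fock_proj\<close>,
  \<open>op_adj\<close> and \<open>toeplitz\<close>. Second, matrix entries are estimated through
  \<open>nev f z\<close>, that is f(z) exp(-|z|^2/2): growth of rate c becomes decay of rate 1/2 -
  c, and the norm becomes an L2 norm for plain Lebesgue measure. Testing an element of
  \<open>Fl\<close> on the constant function 1 alone, over all Weyl conjugates, already gives the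
  whole matrix, because W_z 1 = k_z. In the other direction, composing Gaussian bounds loses part of
  the exponent but never all of it, and some c_j lies above every rate below 1/2. The passage from
  an integral to a finite sum works because W_z k_\<eta> and W_\<eta> k_z differ only by a
  unimodular phase: for fixed \<eta> the dependence on z can be moved into a bounded symbol.\<close>

lemma nn_integral_gaussian:
  assumes "t > 0"
  shows "(\<integral>\<^sup>+(x::'a::euclidean_space). ennreal (exp (- (norm x)\<^sup>2 / t)) \<partial>lborel)
    = ennreal (sqrt (pi * t) ^ DIM('a))"
proof -
  have one: "(\<integral>\<^sup>+(x::real). ennreal (exp (- x\<^sup>2 / t)) \<partial>lborel) = ennreal (sqrt (pi * t))"
  proof -
    have s: "sqrt (t/2) > 0" "(sqrt (t/2))\<^sup>2 = t/2" using assms by auto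
    have eq: "exp (- x\<^sup>2 / t) = sqrt (pi * t) * normal_density 0 (sqrt (t/2)) x" for x
      using assms by (simp add: normal_density_def s(2))
    have "(\<integral>\<^sup>+x. ennreal (normal_density 0 (sqrt (t/2)) x) \<partial>lborel) = 1"
      using nn_integral_eq_integral[OF integrable_normal_density[OF s(1), of 0]]
        integral_normal_density[OF s(1), of 0] by simp
    then show ?thesis
      unfolding eq using assms by (simp add: ennreal_mult nn_integral_cmult)
  qed
  have "ennreal (exp (- (norm x)\<^sup>2 / t)) = (\<Prod>b\<in>Basis. ennreal (exp (- (x \<bullet> b)\<^sup>2 / t)))" for x :: 'a
  proof -
    have "(norm x)\<^sup>2 = (\<Sum>b\<in>Basis. (x \<bullet> b)\<^sup>2)"
      by (simp add: norm_eq_sqrt_inner euclidean_inner[of x x] power2_eq_square sum_nonneg)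
    then show ?thesis
      by (simp add: prod_ennreal sum_divide_distrib flip: exp_sum sum_negf)
  qed
  then have "(\<integral>\<^sup>+(x::'a). ennreal (exp (- (norm x)\<^sup>2 / t)) \<partial>lborel)
     = (\<integral>\<^sup>+(x::'a). (\<Prod>b\<in>Basis. ennreal (exp (- (x \<bullet> b)\<^sup>2 / t))) \<partial>lborel)"
    by simp
  also have "\<dots> = (\<Prod>b\<in>(Basis::'a set). (\<integral>\<^sup>+x. ennreal (exp (- x\<^sup>2 / t)) \<partial>lborel))"
    by (rule nn_integral_lborel_prod) auto
  finally show ?thesis unfolding one using assms by (simp add: ennreal_power)
qed

lemma nn_integral_lborel_shift:
  fixes f :: "'a::euclidean_space \<Rightarrow> ennreal"
  assumes [measurable]: "f \<in> borel_measurable borel"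
  shows "(\<integral>\<^sup>+x. f (c + x) \<partial>lborel) = (\<integral>\<^sup>+x. f x \<partial>lborel)"
proof -
  have "(\<integral>\<^sup>+x. f x \<partial>lborel) = (\<integral>\<^sup>+x. f x \<partial>distr lborel borel ((+) c))"
    by (simp add: lborel_distr_plus)
  then show ?thesis by (simp add: nn_integral_distr)
qed

text \<open>Fubini with the unit ball as test set takes the place of determinants: the product of
  the measures of the preimage and of the ball is a double integral in which translation invariance
  can be used in either variable, and the ball is unchanged under -T.\<close>

lemma lborel_distr_linear_isometry:
  fixes T :: "'a::euclidean_space \<Rightarrow> 'a"
  assumes "linear T" and iso: "\<And>x. norm (T x) = norm x"
  shows "distr lborel borel T = lborel"
proof -
  interpret linear T by fact
  have [measurable]: "T \<in> borel_measurable borel"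
    using linear_continuous_on[OF \<open>linear T\<close>[unfolded linear_conv_bounded_linear]]
    by (intro borel_measurable_continuous_onI)
  have "inj T"
    unfolding linear_injective_0[OF \<open>linear T\<close>] using iso by (metis norm_eq_zero)
  then have surj: "surj T" using linear_injective_imp_surjective[OF \<open>linear T\<close>] by simp
  let ?B = "ball (0::'a) 1"
  have [measurable]: "?B \<in> sets borel" by simp
  show ?thesis
  proof (rule measure_eqI)
    fix A assume "A \<in> sets (distr lborel borel T)"
    then have A[measurable]: "A \<in> sets borel" by simp
    have "emeasure lborel (T -` A) * emeasure lborel ?B
      = (\<integral>\<^sup>+x. indicator A (T x) * (\<integral>\<^sup>+y. indicator ?B y \<partial>lborel) \<partial>lborel)"
    proof -
      have "T -` A \<in> sets lborel" using measurable_sets[of T borel borel A] by simp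
      then have "emeasure lborel (T -` A) = (\<integral>\<^sup>+x. indicator A (T x) \<partial>lborel)"
        by (simp flip: nn_integral_indicator add: indicator_def vimage_def)
      then show ?thesis by (simp add: nn_integral_multc)
    qed
    also have "\<dots> = (\<integral>\<^sup>+x. indicator A (T x) * (\<integral>\<^sup>+y. indicator ?B (- T x + y) \<partial>lborel) \<partial>lborel)"
      by (subst nn_integral_lborel_shift) (auto intro!: borel_measurable_indicator)
    also have "\<dots> = (\<integral>\<^sup>+x. (\<integral>\<^sup>+y. indicator A (T x) * indicator ?B (- T x + y) \<partial>lborel) \<partial>lborel)"
      by (subst nn_integral_cmult) auto
    also have "\<dots> = (\<integral>\<^sup>+y. (\<integral>\<^sup>+x. indicator A (T x) * indicator ?B (- T x + y) \<partial>lborel) \<partial>lborel)"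
      by (rule lborel_pair.Fubini'[symmetric]) measurable
    also have "\<dots> = (\<integral>\<^sup>+y. (\<integral>\<^sup>+x. indicator A (T x + y) * indicator ?B (- T x) \<partial>lborel) \<partial>lborel)"
    proof (rule nn_integral_cong)
      fix y
      \<comment> \<open>Surjectivity realizes the translation by y as T x0, so it is absorbed by
        translating x by x0.\<close>
      obtain x0 where x0: "T x0 = y" using surj by (metis surjD)
      show "(\<integral>\<^sup>+x. indicator A (T x) * indicator ?B (- T x + y) \<partial>lborel) =
        (\<integral>\<^sup>+x. indicator A (T x + y) * indicator ?B (- T x) \<partial>lborel)"
        using nn_integral_lborel_shift[of "\<lambda>x. indicator A (T x) * indicator ?B (- T x + y)" x0]
        by (simp add: add x0 add.commute)
    qed
    also have "\<dots> = (\<integral>\<^sup>+x. (\<integral>\<^sup>+y. indicator A (T x + y) * indicator ?B (- T x) \<partial>lborel) \<partial>lborel)"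
      by (rule lborel_pair.Fubini') measurable
    also have "\<dots> = (\<integral>\<^sup>+x. (\<integral>\<^sup>+y. indicator A y \<partial>lborel) * indicator ?B (- T x) \<partial>lborel)"
      by (subst nn_integral_multc) (auto simp: nn_integral_lborel_shift)
    also have "\<dots> = (\<integral>\<^sup>+x. emeasure lborel A * indicator ?B x \<partial>lborel)"
    proof -
      have "indicator ?B (- T x) = (indicator ?B x :: ennreal)" for x
        using iso by (auto simp: indicator_def)
      then show ?thesis by simp
    qed
    also have "\<dots> = emeasure lborel A * emeasure lborel ?B" by (simp add: nn_integral_cmult)
    finally have "emeasure lborel ?B * emeasure lborel (T -` A) = emeasure lborel ?B * emeasure lborel A"
      by (simp add: mult.commute)
    moreover have "emeasure lborel ?B \<noteq> \<infinity>" "emeasure lborel ?B \<noteq> 0"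
      using emeasure_bounded_finite[of ?B] open_not_negligible[of ?B]
      by (auto simp: negligible_iff_emeasure0)
    ultimately have "emeasure lborel (T -` A) = emeasure lborel A"
      by (metis ennreal_mult_cancel_left infinity_ennreal_def)
    then show "emeasure (distr lborel borel T) A = emeasure lborel A"
      by (subst emeasure_distr) auto
  qed simp
qed

lemma nn_integral_Cauchy_Schwarz_le:
  assumes "f \<in> borel_measurable M" "g \<in> borel_measurable M"
    and "(\<integral>\<^sup>+x. (f x)\<^sup>2 \<partial>M) \<le> ennreal (a\<^sup>2)" "(\<integral>\<^sup>+x. (g x)\<^sup>2 \<partial>M) \<le> ennreal (b\<^sup>2)" "a \<ge> 0" "b \<ge> 0"
  shows "(\<integral>\<^sup>+x. f x * g x \<partial>M) \<le> ennreal (a * b)"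
proof -
  have "(\<integral>\<^sup>+x. f x * g x \<partial>M)\<^sup>2 \<le> (\<integral>\<^sup>+x. (f x)\<^sup>2 \<partial>M) * (\<integral>\<^sup>+x. (g x)\<^sup>2 \<partial>M)"
    by (rule Cauchy_Schwarz_nn_integral[OF assms(1,2)])
  also have "\<dots> \<le> ennreal (a\<^sup>2) * ennreal (b\<^sup>2)"
    by (rule mult_mono) (use assms in auto)
  also have "\<dots> = (ennreal (a * b))\<^sup>2"
    using assms(5,6) by (simp add: ennreal_power power_mult_distrib flip: ennreal_mult)
  finally show ?thesis
    by (cases "\<integral>\<^sup>+x. f x * g x \<partial>M")
       (use assms(5,6) in \<open>auto simp: ennreal_power power2_le_iff_abs_le ennreal_top_eq_mult_iff top_power_ennreal
         abs_le_square_iff[symmetric] top_unique\<close>)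
qed

text \<open>Schur's test for a convolution kernel: for fixed v, Cauchy-Schwarz in z and translation
  invariance give the factor a b, uniformly in v; integrating over v brings in only the L1 norm of
  \<Phi>.\<close>

lemma Schur_nn_integral:
  fixes f g \<Phi> :: "'a::euclidean_space \<Rightarrow> ennreal"
  assumes [measurable]: "f \<in> borel_measurable borel" "g \<in> borel_measurable borel" "\<Phi> \<in> borel_measurable borel"
    and f: "(\<integral>\<^sup>+x. (f x)\<^sup>2 \<partial>lborel) \<le> ennreal (a\<^sup>2)" and g: "(\<integral>\<^sup>+x. (g x)\<^sup>2 \<partial>lborel) \<le> ennreal (b\<^sup>2)"
    and "a \<ge> 0" "b \<ge> 0"
  shows "(\<integral>\<^sup>+z. f z * (\<integral>\<^sup>+v. \<Phi> v * g (z + v) \<partial>lborel) \<partial>lborel) \<le> (\<integral>\<^sup>+v. \<Phi> v \<partial>lborel) * ennreal (a * b)"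
proof -
  have inner: "(\<integral>\<^sup>+z. f z * g (z + v) \<partial>lborel) \<le> ennreal (a * b)" for v
  proof (rule nn_integral_Cauchy_Schwarz_le[OF _ _ f _ assms(6,7)])
    show "(\<integral>\<^sup>+z. (g (z + v))\<^sup>2 \<partial>lborel) \<le> ennreal (b\<^sup>2)"
      using g nn_integral_lborel_shift[of "\<lambda>z. (g z)\<^sup>2" v] by (simp add: add.commute)
  qed measurable
  have "(\<integral>\<^sup>+z. f z * (\<integral>\<^sup>+v. \<Phi> v * g (z + v) \<partial>lborel) \<partial>lborel)
    = (\<integral>\<^sup>+z. (\<integral>\<^sup>+v. f z * (\<Phi> v * g (z + v)) \<partial>lborel) \<partial>lborel)"
    by (subst nn_integral_cmult) auto
  also have "\<dots> = (\<integral>\<^sup>+v. (\<integral>\<^sup>+z. f z * (\<Phi> v * g (z + v)) \<partial>lborel) \<partial>lborel)"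
    by (rule lborel_pair.Fubini'[symmetric]) measurable
  also have "\<dots> = (\<integral>\<^sup>+v. \<Phi> v * (\<integral>\<^sup>+z. f z * g (z + v) \<partial>lborel) \<partial>lborel)"
    by (subst nn_integral_cmult[symmetric]) (auto simp: mult_ac)
  also have "\<dots> \<le> (\<integral>\<^sup>+v. \<Phi> v * ennreal (a * b) \<partial>lborel)"
    by (intro nn_integral_mono mult_left_mono inner) auto
  finally show ?thesis by (simp add: nn_integral_multc)
qed

section \<open>Gaussian measures and the mean value property\<close>

lemma continuous_on_hdot [continuous_intros]:
  "continuous_on S f \<Longrightarrow> continuous_on S g \<Longrightarrow> continuous_on S (\<lambda>x. hdot (f x) (g x))"
  unfolding hdot_def by (intro continuous_intros)

lemma measurable_hdot [measurable]:
  assumes "f \<in> borel_measurable M" "g \<in> borel_measurable M"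
  shows "(\<lambda>x. hdot (f x) (g x)) \<in> borel_measurable M"
  by (rule borel_measurable_continuous_Pair[OF assms]) (intro continuous_intros)

lemma continuous_on_vec_scale [continuous_intros]:
  fixes f :: "'a::topological_space \<Rightarrow> complex"
  shows "continuous_on S f \<Longrightarrow> continuous_on S g \<Longrightarrow> continuous_on S (\<lambda>x. f x *s (g x :: complex^'n))"
  unfolding vector_scalar_mult_def by (intro continuous_intros)

lemma measurable_vec_scale [measurable]:
  fixes g :: "'a \<Rightarrow> complex^'n::finite"
  assumes "f \<in> borel_measurable M" "g \<in> borel_measurable M"
  shows "(\<lambda>x. f x *s g x) \<in> borel_measurable M"
  by (rule borel_measurable_continuous_Pair[OF assms]) (intro continuous_intros)

lemma hdot_add_left: "hdot (a + b) z = hdot a z + hdot b z"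
  and hdot_add_right: "hdot z (a + b) = hdot z a + hdot z b"
  and hdot_diff_left: "hdot (a - b) z = hdot a z - hdot b z"
  and hdot_diff_right: "hdot z (a - b) = hdot z a - hdot z b"
  and hdot_minus_right [simp]: "hdot z (- a) = - hdot z a"
  and hdot_zero_left [simp]: "hdot 0 z = 0"
  and hdot_zero_right [simp]: "hdot z 0 = 0"
  by (simp_all add: hdot_def algebra_simps sum.distrib sum_subtractf sum_negf)

lemmas hdot_simps = hdot_add_left hdot_add_right hdot_diff_left hdot_diff_right

lemma cnj_hdot: "cnj (hdot z w) = hdot w z"
  by (simp add: hdot_def mult.commute)

lemma Re_hdot: "Re (hdot w z) = inner w z"
  by (simp add: hdot_def inner_vec_def inner_complex_def)

lemma hdot_self: "hdot z z = of_real ((norm z)\<^sup>2)"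
proof -
  have "hdot z z = (\<Sum>j\<in>UNIV. of_real ((cmod (z $ j))\<^sup>2))"
    unfolding hdot_def by (intro sum.cong) (simp_all only: complex_norm_square)
  then show ?thesis by (simp add: power2_norm_eq_inner inner_vec_def flip: of_real_sum)
qed

lemma norm_vec_scale: "norm (c *s (z :: complex^'n::finite)) = cmod c * norm z"
  by (simp add: norm_vec_def norm_mult L2_set_left_distrib L2_set_right_distrib)

text \<open>Multiplying z by a suitable unimodular c makes the form real, and then it is the real
  inner product.\<close>

lemma cmod_hdot_le: "cmod (hdot z w) \<le> norm z * norm w"
proof (cases "hdot z w = 0")
  case False
  define c where "c = cnj (hdot z w) / cmod (hdot z w)"
  have c: "cmod c = 1" using False by (simp add: c_def norm_divide)
  have "of_real (cmod (hdot z w)) = c * hdot z w"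
    using False by (simp add: c_def complex_norm_square[symmetric] power2_eq_square mult.commute)
  also have "\<dots> = hdot (c *s z) w" by (simp add: hdot_scale)
  finally have "cmod (hdot z w) = Re (hdot (c *s z) w)" by (metis Re_complex_of_real)
  also have "\<dots> \<le> norm (c *s z) * norm w" unfolding Re_hdot by (rule norm_cauchy_schwarz)
  finally show ?thesis by (simp add: norm_vec_scale c)
qed simp

lemma borel_measurable_lebesgueI:
  fixes h :: "complex^'n::finite \<Rightarrow> 'b::topological_space"
  shows "h \<in> borel_measurable borel \<Longrightarrow> h \<in> borel_measurable lebesgue"
  by (intro measurable_completion) simp

abbreviation gdens :: "real \<Rightarrow> complex^'n::finite \<Rightarrow> real" where
  "gdens t z \<equiv> exp (- (norm z)\<^sup>2 / t) / (pi * t) ^ CARD('n)"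

lemma nn_integral_gauss:
  fixes h :: "complex^'n::finite \<Rightarrow> ennreal"
  assumes "h \<in> borel_measurable lebesgue"
  shows "(\<integral>\<^sup>+z. h z \<partial>gauss t) = (\<integral>\<^sup>+z. ennreal (gdens t z) * h z \<partial>lebesgue)"
  unfolding gauss_def
  by (subst nn_integral_density)
     (use assms measurable_compose[OF gauss_weight_measurable' measurable_ennreal] in auto)

text \<open>\<open>gauss\<close> is a density over the completed measure, whereas Fubini and changes
  of variables are carried out for \<open>lborel\<close>; Borel integrands pass from one to the
  other.\<close>

lemma
  fixes h :: "complex^'n::finite \<Rightarrow> 'b::{banach, second_countable_topology}"
  assumes "h \<in> borel_measurable borel" "t > 0"
  shows integrable_gauss: "integrable (gauss t) h \<longleftrightarrow> integrable lborel (\<lambda>z. gdens t z *\<^sub>R h z)"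
    and integral_gauss: "integral\<^sup>L (gauss t) h = integral\<^sup>L lborel (\<lambda>z. gdens t z *\<^sub>R h z)"
proof -
  note [measurable] = assms(1)
  have m: "(\<lambda>w. gdens t w *\<^sub>R h w) \<in> borel_measurable lborel" by measurable
  show "integrable (gauss t) h \<longleftrightarrow> integrable lborel (\<lambda>w. gdens t w *\<^sub>R h w)"
    unfolding gauss_def integrable_completion[OF m, symmetric]
    by (rule integrable_density)
       (use assms gauss_weight_measurable' in \<open>auto intro: borel_measurable_lebesgueI\<close>)
  show "integral\<^sup>L (gauss t) h = integral\<^sup>L lborel (\<lambda>w. gdens t w *\<^sub>R h w)"
    unfolding gauss_def integral_completion[OF m, symmetric]
    by (rule integral_density)
       (use assms gauss_weight_measurable' in \<open>auto intro: borel_measurable_lebesgueI\<close>)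
qed

lemma prob_space_gauss:
  assumes "t > 0"
  shows "prob_space (gauss t :: (complex^'n::finite) measure)"
proof
  have "sqrt (pi * t) ^ DIM(complex^'n) = (pi * t) ^ CARD('n)"
    using assms by (simp add: mult.commute[of _ 2] power_mult)
  then have g: "(\<integral>\<^sup>+(z::complex^'n). ennreal (exp (- (norm z)\<^sup>2 / t)) \<partial>lborel) = ennreal ((pi * t) ^ CARD('n))"
    by (simp only: nn_integral_gaussian[OF assms])
  have "emeasure (gauss t :: (complex^'n) measure) UNIV = (\<integral>\<^sup>+z. 1 \<partial>(gauss t :: (complex^'n) measure))"
    by simp
  also have "\<dots> = (\<integral>\<^sup>+(z::complex^'n). ennreal (1 / (pi * t) ^ CARD('n)) * ennreal (exp (- (norm z)\<^sup>2 / t)) \<partial>lborel)"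
    using assms by (subst nn_integral_gauss) (auto simp: nn_integral_completion simp flip: ennreal_mult)
  also have "\<dots> = ennreal (1 / (pi * t) ^ CARD('n)) * ennreal ((pi * t) ^ CARD('n))"
    unfolding g[symmetric] by (rule nn_integral_cmult) measurable
  also have "\<dots> = 1" using assms by (simp flip: ennreal_mult)
  finally show "emeasure (gauss t :: (complex^'n) measure) (space (gauss t)) = 1" by simp
qed

lemma integrable_gdens:
  assumes "t > 0" shows "integrable lborel (gdens t :: complex^'n::finite \<Rightarrow> real)"
proof -
  interpret prob_space "gauss t :: (complex^'n) measure" by (rule prob_space_gauss[OF assms])
  show ?thesis using integrable_gauss[of "\<lambda>_::complex^'n. 1::real" t] assms by simp
qed

lemma integrable_gaussian:
  assumes "c > 0" shows "integrable lborel (\<lambda>z::complex^'n::finite. exp (- c * (norm z)\<^sup>2))"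
proof -
  have "integrable lborel (\<lambda>z::complex^'n. (pi * (1/c)) ^ CARD('n) * gdens (1/c) z)"
    using assms by (intro integrable_mult_right integrable_gdens) simp
  then show ?thesis using assms by (simp add: mult.commute)
qed

lemma integral_lborel_rotate:
  fixes h :: "complex^'n::finite \<Rightarrow> 'b::{banach, second_countable_topology}"
  assumes "h \<in> borel_measurable borel" "cmod c = 1"
  shows "(\<integral>z. h (c *s z) \<partial>lborel) = (\<integral>z. h z \<partial>lborel)"
    and "integrable lborel (\<lambda>z. h (c *s z)) \<longleftrightarrow> integrable lborel h"
proof -
  have "linear ((*s) c :: complex^'n \<Rightarrow> _)"
    by (rule linearI) (simp_all add: vec_eq_iff algebra_simps)
  then have d: "distr lborel borel ((*s) c) = (lborel :: (complex^'n) measure)"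
    by (rule lborel_distr_linear_isometry) (simp add: norm_vec_scale assms)
  have m: "(*s) c \<in> measurable lborel (borel :: (complex^'n) measure)" by simp
  show "(\<integral>z. h (c *s z) \<partial>lborel) = (\<integral>z. h z \<partial>lborel)"
    using integral_distr[OF m assms(1)] by (simp only: d)
  show "integrable lborel (\<lambda>z. h (c *s z)) \<longleftrightarrow> integrable lborel h"
    using integrable_distr_eq[OF m assms(1)] by (simp only: d)
qed

lemma integral_lborel_shift:
  fixes h :: "'a::euclidean_space \<Rightarrow> 'b::{banach, second_countable_topology}"
  assumes "h \<in> borel_measurable borel"
  shows "(\<integral>z. h (c + z) \<partial>lborel) = (\<integral>z. h z \<partial>lborel)"
    and "integrable lborel (\<lambda>z. h (c + z)) \<longleftrightarrow> integrable lborel h"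
proof -
  have m: "(+) c \<in> measurable lborel (borel :: 'a measure)" by simp
  show "(\<integral>z. h (c + z) \<partial>lborel) = (\<integral>z. h z \<partial>lborel)"
    using integral_distr[OF m assms] by (simp only: lborel_distr_plus)
  show "integrable lborel (\<lambda>z. h (c + z)) \<longleftrightarrow> integrable lborel h"
    using integrable_distr_eq[OF m assms] by (simp only: lborel_distr_plus)
qed

text \<open>Complex linearity of the derivative makes f holomorphic on the complex line through w,
  where Cauchy's formula at the centre applies.\<close>

lemma entire_circle_mean:
  assumes "entire f"
  shows "((\<lambda>x::real. f (exp (2 * of_real pi * \<i> * of_real x) *s w)) has_integral f 0) {0..1}"
proof -
  have "(\<lambda>t. f (t *s w)) field_differentiable at t" for t
  proof -
    obtain D where D: "(f has_derivative D) (at (t *s w))" "\<forall>c v. D (c *s v) = c * D v"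
      using assms unfolding entire_def by blast
    have "bounded_linear (\<lambda>t. t *s w)"
      unfolding linear_conv_bounded_linear[symmetric]
      by (rule linearI) (simp_all add: vec_eq_iff algebra_simps)
    then have "((\<lambda>t. t *s w) has_derivative (\<lambda>t. t *s w)) (at t)"
      by (rule bounded_linear_imp_has_derivative)
    from has_derivative_compose[OF this D(1)] D(2)
    have "((\<lambda>t. f (t *s w)) has_derivative (\<lambda>c. D w * c)) (at t)" by (simp add: mult.commute)
    then show ?thesis unfolding field_differentiable_def has_field_derivative_def by blast
  qed
  then have "(\<lambda>t. f (t *s w)) holomorphic_on cball 0 1"
    by (simp add: holomorphic_on_def field_differentiable_at_within)
  from Cauchy_integral_circlepath_simple[OF this, of 0]
  have "((\<lambda>u. f (u *s w) / (u - 0)) has_contour_integral 2 * complex_of_real pi * \<i> * f (0 *s w)) (circlepath 0 1)"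
    by simp
  then have "((\<lambda>x. f (exp (2 * of_real pi * \<i> * of_real x) *s w) * (2 * complex_of_real pi * \<i>)) has_integral
     2 * complex_of_real pi * \<i> * f 0) {0..1}"
    unfolding has_contour_integral_def vector_smult_lzero
    by (rule has_integral_eq[rotated]) (simp add: vector_derivative_circlepath01, simp add: circlepath)
  from has_integral_mult_left[OF this, of "1 / (2 * complex_of_real pi * \<i>)"] show ?thesis
    by simp
qed

text \<open>Averaging over the circle action suffices in every dimension: the Gaussian is invariant
  under unimodular scalars, and the mean of f over each orbit is f(0). Integrability is the only
  growth condition.\<close>

lemma entire_gauss_mean:
  fixes f :: "complex^'n::finite \<Rightarrow> complex"
  assumes "entire f" "integrable (gauss t) f" "t > 0"
  shows "integral\<^sup>L (gauss t) f = f 0"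
proof -
  interpret prob_space "gauss t :: (complex^'n) measure" by (rule prob_space_gauss[OF assms(3)])
  note [measurable] = entire_measurable[OF assms(1)]
  define e where "e x = exp (2 * of_real pi * \<i> * of_real x :: complex)" for x :: real
  have [measurable]: "e \<in> borel_measurable borel" 
    unfolding e_def by (intro borel_measurable_continuous_onI continuous_intros)
  have ce: "cmod (e x) = 1" for x by (simp add: e_def norm_exp_eq_Re)
  \<comment> \<open>The integral of \<open>?h\<close> over x and w is computed in both orders: x
    first gives the circle mean, w first gives the original integral for every x in the unit
    interval, by rotation.\<close>
  let ?h = "\<lambda>x w. indicat_real {0..1} x *\<^sub>R gdens t w *\<^sub>R f (e x *s w)"
  have rot: "gdens t w *\<^sub>R f (e x *s w) = gdens t (e x *s w) *\<^sub>R f (e x *s w)" for x w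
    by (simp add: norm_vec_scale ce)
  have fin: "integrable lborel (\<lambda>w. gdens t w *\<^sub>R f w)"
    using assms integrable_gauss[of f t] by simp
  have circ: "(\<integral>x. ?h x w \<partial>lborel) = gdens t w *\<^sub>R f 0" for w
  proof -
    have "continuous_on {0..1} (\<lambda>x. f (e x *s w))"
      by (rule continuous_on_compose2[OF entire_continuous[OF assms(1)]])
         (auto simp: e_def intro!: continuous_intros)
    then have si: "set_integrable lborel {0..1} (\<lambda>x. f (e x *s w))"
      by (rule borel_integrable_atLeastAtMost')
    have "(LINT x:{0..1}|lborel. f (e x *s w)) = f 0"
      unfolding set_borel_integral_eq_integral(2)[OF si]
      using entire_circle_mean[OF assms(1), of w] by (simp add: integral_unique e_def)
    moreover have "?h x w = gdens t w *\<^sub>R (indicat_real {0..1} x *\<^sub>R f (e x *s w))" for x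
      by simp
    ultimately show ?thesis unfolding set_lebesgue_integral_def by (simp only: integral_scaleR_right)
  qed
  have "integrable (lborel \<Otimes>\<^sub>M lborel) (\<lambda>(x, w). ?h x w)"
  proof (rule lborel_pair.Fubini_integrable)
    show "(\<lambda>(x, w). ?h x w) \<in> borel_measurable (lborel \<Otimes>\<^sub>M lborel)" by measurable
    have n: "norm (?h x w) = indicat_real {0..1} x * norm (gdens t (e x *s w) *\<^sub>R f (e x *s w))" for x w
      unfolding rot by (simp add: abs_mult)
    have "(\<integral>w. norm (?h x w) \<partial>lborel) = indicat_real {0..1} x * (\<integral>w. norm (gdens t w *\<^sub>R f w) \<partial>lborel)" for x
      unfolding n integral_mult_right_zero
      by (subst integral_lborel_rotate(1)[of "\<lambda>w. norm (gdens t w *\<^sub>R f w)" "e x"]) (use ce in auto)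
    then show "integrable lborel (\<lambda>x. \<integral>w. norm (case (x, w) of (x, w) \<Rightarrow> ?h x w) \<partial>lborel)"
      by (simp only: prod.case) (intro integrable_mult_left, simp)
    show "AE x in lborel. integrable lborel (\<lambda>w. case (x, w) of (x, w) \<Rightarrow> ?h x w)"
      using integral_lborel_rotate(2)[of "\<lambda>w. gdens t w *\<^sub>R f w" "e _"] fin ce
      unfolding prod.case rot by (intro AE_I2 integrable_scaleR_right) auto
  qed
  from lborel_pair.Fubini_integral[OF this]
  have "(\<integral>(w::complex^'n). gdens t w *\<^sub>R f 0 \<partial>lborel) = (\<integral>x. (\<integral>w. ?h x w \<partial>lborel) \<partial>lborel)"
    by (simp only: circ)
  also have "\<dots> = (\<integral>(x::real). indicat_real {0..1} x *\<^sub>R (\<integral>w. gdens t w *\<^sub>R f w \<partial>lborel) \<partial>lborel)"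
  proof (rule Bochner_Integration.integral_cong[OF refl])
    fix x
    show "(\<integral>w. ?h x w \<partial>lborel) = indicat_real {0..1} x *\<^sub>R (\<integral>w. gdens t w *\<^sub>R f w \<partial>lborel)"
      unfolding rot integral_scaleR_right
      by (subst integral_lborel_rotate(1)[of "\<lambda>w. gdens t w *\<^sub>R f w" "e x"]) (use ce in auto)
  qed
  also have "\<dots> = integral\<^sup>L (gauss t) f" using assms integral_gauss[of f t] by simp
  finally have "integral\<^sup>L (gauss t) (\<lambda>_::complex^'n. f 0) = integral\<^sup>L (gauss t) f"
    using integral_gauss[of "\<lambda>_::complex^'n. f 0" t] assms(3) by simp
  then show ?thesis using prob_space by simp
qed

section \<open>Reproducing kernel and coherent states\<close>

lemma measurable_cnj [measurable]:
  assumes "f \<in> borel_measurable M" shows "(\<lambda>x. cnj (f x)) \<in> borel_measurable M"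
  by (rule borel_measurable_continuous_on[OF _ assms]) (intro continuous_intros)

lemma nker_L2: "nker z \<in> L2_fun"
proof -
  interpret prob_space "gauss 1 :: (complex^'a) measure" by (rule prob_space_gauss) simp
  have "(\<lambda>_::complex^'a. 1) \<in> L2_fun" by (simp add: L2_fun_def)
  from weyl_L2(1)[OF entire_const this, of z] show ?thesis by simp
qed

lemma ker_L2: "ker z \<in> L2_fun"
proof -
  have "ker z = (\<lambda>w. of_real (exp ((norm z)\<^sup>2 / 2)) * nker z w)"
    by (rule ext) (simp add: nker_def mult.assoc[symmetric] flip: of_real_mult exp_add)
  then show ?thesis using L2_fun_scale[OF nker_L2] by simp
qed

text \<open>Recentring the Gaussian at z completes the square, and the conjugate kernel becomes the
  entire factor \<open>exp (- hdot u z)\<close>.\<close>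

lemma gauss1_weight:
  "gdens 1 (z + u) *\<^sub>R (f (z + u) * cnj (ker z (z + u)))
    = gdens 1 u *\<^sub>R (f (z + u) * exp (- hdot u z))" for f :: "complex^'n::finite \<Rightarrow> complex"
proof -
  have "- complex_of_real ((norm (z + u))\<^sup>2) + hdot z (z + u) = - complex_of_real ((norm u)\<^sup>2) - hdot u z"
    unfolding hdot_self[symmetric] by (simp add: hdot_simps)
  then have "exp (- complex_of_real ((norm (z + u))\<^sup>2)) * exp (hdot z (z + u))
     = exp (- complex_of_real ((norm u)\<^sup>2)) * exp (- hdot u z)"
    by (simp flip: exp_add)
  then show ?thesis
    by (simp add: scaleR_conv_of_real ker_def exp_cnj cnj_hdot exp_of_real[symmetric])
qed

lemma entire_exp_hdot: "entire (\<lambda>u. exp (- hdot u z))"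
  using entire_ker[of "- z"] by (simp add: ker_def[abs_def])

lemma reproducing:
  fixes f :: "complex^'n::finite \<Rightarrow> complex"
  assumes "entire f" "f \<in> L2_fun"
  shows "f z = (\<integral>w. f w * cnj (ker z w) \<partial>gauss 1)"
proof -
  note [measurable] = entire_measurable[OF assms(1)] entire_measurable[OF entire_ker[of z]]
  \<comment> \<open>The value of \<open>h\<close> at 0 is f z, so the mean value property for
    \<open>h\<close> is the reproducing formula after a translation by z.\<close>
  define h where "h u = f (z + u) * exp (- hdot u z)" for u
  have h: "entire h"
    unfolding h_def using entire_shift[OF assms(1), of "-z"]
    by (intro entire_mult entire_exp_hdot) (simp add: add.commute)
  note [measurable] = entire_measurable[OF h]
  let ?g = "\<lambda>w. gdens 1 w *\<^sub>R (f w * cnj (ker z w))"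
  have g: "?g \<in> borel_measurable borel" by measurable
  have "integrable lborel ?g"
    using L2_fun_inner_integrable[OF assms(2) ker_L2[of z]] by (subst (asm) integrable_gauss) auto
  then have "integrable (gauss 1) h"
    using integral_lborel_shift(2)[OF g, of z] unfolding gauss1_weight h_def[symmetric]
    by (subst integrable_gauss) auto
  from entire_gauss_mean[OF h this]
  have "f z = integral\<^sup>L (gauss 1) h" by (simp add: h_def)
  also have "\<dots> = integral\<^sup>L lborel ?g"
    using integral_lborel_shift(1)[OF g, of z] unfolding gauss1_weight h_def[symmetric]
    by (subst integral_gauss) auto
  also have "\<dots> = (\<integral>w. f w * cnj (ker z w) \<partial>gauss 1)"
    by (subst integral_gauss) auto
  finally show ?thesis .
qed

section \<open>Coherent states and normalized evaluation\<close>

lift_definition nkerf :: "complex^'n::finite \<Rightarrow> 'n fock" is nker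
  by (simp add: entire_nker nker_L2)

text \<open>The square root of the Gaussian weight is absorbed, so inner products become Lebesgue
  integrals up to pi^n; by \<open>nev_eq_cinner\<close> this is also the coefficient of f at the
  unit vector k_z.\<close>

definition nev :: "'n::finite fock \<Rightarrow> complex^'n \<Rightarrow> complex" where
  "nev f z = of_real (exp (- (norm z)\<^sup>2 / 2)) * fock_fun f z"

lemma entire_fock_fun: "entire (fock_fun f)" and fock_fun_L2: "fock_fun f \<in> L2_fun"
  using fock_fun[of f] by auto

lemma fock_fun_measurable [measurable]: "fock_fun f \<in> borel_measurable borel"
  by (rule entire_measurable[OF entire_fock_fun])

lemma continuous_on_nev: "continuous_on UNIV (nev f)"
  unfolding nev_def using entire_continuous[OF entire_fock_fun] by (intro continuous_intros) auto

lemma nev_measurable [measurable]: "nev f \<in> borel_measurable borel"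
  by (intro borel_measurable_continuous_onI continuous_on_nev)

lemma fock_fun_nev: "fock_fun f z = of_real (exp ((norm z)\<^sup>2 / 2)) * nev f z"
  by (simp add: nev_def mult.assoc[symmetric] flip: of_real_mult exp_add)

lemma fock_cinner_commute: "fock_cinner g f = cnj (fock_cinner f g)"
  using Bochner_Integration.integral_cnj[of "gauss 1" "\<lambda>w. fock_fun f w * cnj (fock_fun g w)"]
  by (simp add: fock_cinner_def mult.commute)

lemma fock_cinner_add_left: "fock_cinner (f + g) h = fock_cinner f h + fock_cinner g h"
  unfolding fock_cinner_def plus_fock.rep_eq distrib_right
  by (rule Bochner_Integration.integral_add) (auto intro: L2_fun_inner_integrable fock_fun_L2)

lemma fock_cinner_add_right: "fock_cinner h (f + g) = fock_cinner h f + fock_cinner h g"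
  by (metis fock_cinner_commute fock_cinner_add_left complex_cnj_add)

lemma fock_cinner_scale_left: "fock_cinner (fock_scaleC c f) g = c * fock_cinner f g"
  unfolding fock_cinner_def fock_scaleC.rep_eq mult.assoc by simp

lemma fock_cinner_scale_right: "fock_cinner g (fock_scaleC c f) = cnj c * fock_cinner g f"
  by (metis fock_cinner_commute fock_cinner_scale_left complex_cnj_mult)

lemma uminus_fock_scaleC: "- f = fock_scaleC (-1) f"
  by transfer simp

lemma fock_cinner_diff_left: "fock_cinner (f - g) h = fock_cinner f h - fock_cinner g h"
  by (simp add: minus_fock_def uminus_fock_scaleC fock_cinner_add_left fock_cinner_scale_left)

lemma fock_cinner_diff_right: "fock_cinner h (f - g) = fock_cinner h f - fock_cinner h g"
  by (metis fock_cinner_commute fock_cinner_diff_left complex_cnj_diff)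

lemma fock_cinner_zero [simp]: "fock_cinner 0 g = 0" "fock_cinner g 0 = 0"
  by (simp_all add: fock_cinner_def zero_fock.rep_eq)

lemma fock_scaleC_scaleC [simp]: "fock_scaleC a (fock_scaleC b f) = fock_scaleC (a * b) f"
  by transfer (simp add: mult.assoc)

lemma fock_scaleC_one [simp]: "fock_scaleC 1 f = f"
  by transfer simp

lemma fock_scaleC_add: "fock_scaleC a (f + g) = fock_scaleC a f + fock_scaleC a g"
  by transfer (simp add: algebra_simps)

lemma fock_cinner_self: "fock_cinner f f = of_real ((norm f)\<^sup>2)"
proof -
  have "Im (fock_cinner f f) = 0" using fock_cinner_commute[of f f] by (simp add: complex_eq_iff)
  moreover have "Re (fock_cinner f f) = (norm f)\<^sup>2" by (simp add: power2_norm_eq_inner inner_fock_def)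
  ultimately show ?thesis by (simp add: complex_eq_iff)
qed

lemma Im_fock_cinner: "Im (fock_cinner f g) = inner f (fock_scaleC \<i> g)"
  by (simp add: inner_fock_def fock_cinner_scale_right)

lemma fock_cinner_eqI: "(\<And>h. fock_cinner f h = fock_cinner g h) \<Longrightarrow> f = g"
  using inner_eq_zero_iff[of "f - g"] by (simp add: inner_fock_def fock_cinner_diff_left)

lemma cmod_fock_cinner_le: "cmod (fock_cinner f g) \<le> norm f * norm g"
proof (cases "fock_cinner f g = 0")
  case False
  define c where "c = cnj (fock_cinner f g) / cmod (fock_cinner f g)"
  have c: "cmod c = 1" using False by (simp add: c_def norm_divide)
  have "of_real (cmod (fock_cinner f g)) = fock_cinner (fock_scaleC c f) g"
    using False by (simp add: fock_cinner_scale_left c_def complex_norm_square[symmetric] power2_eq_square mult.commute)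
  then have "cmod (fock_cinner f g) = inner (fock_scaleC c f) g" unfolding inner_fock_def by (metis Re_complex_of_real)
  also have "\<dots> \<le> norm (fock_scaleC c f) * norm g" by (rule norm_cauchy_schwarz)
  finally show ?thesis by (simp add: norm_fock_scaleC c)
qed simp

lemma gdens_nev:
  "gdens 1 w *\<^sub>R (fock_fun f w * cnj (fock_fun g w)) = (1 / pi ^ CARD('n)) *\<^sub>R (nev f w * cnj (nev g w))"
  for w :: "complex^'n::finite"
  by (simp add: nev_def scaleR_conv_of_real field_simps flip: of_real_mult exp_add)

lemma integrable_nev: "integrable lborel (\<lambda>z. nev f z * cnj (nev g z))"
proof -
  have "integrable (gauss 1) (\<lambda>w. fock_fun f w * cnj (fock_fun g w))"
    by (intro L2_fun_inner_integrable fock_fun_L2)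
  then have "integrable lborel (\<lambda>w. (1 / pi ^ CARD('a)) *\<^sub>R (nev f w * cnj (nev g w)))"
    unfolding gdens_nev[symmetric] by (subst (asm) integrable_gauss) auto
  from integrable_scaleR_right[OF this, of "pi ^ CARD('a)"] show ?thesis by simp
qed

text \<open>Together with \<open>nev_eq_cinner\<close> this is the resolution of the identity by
  coherent states: pi^-n times the integral of the projections onto k_z is the identity, in the weak
  sense.\<close>

lemma fock_cinner_nev:
  "fock_cinner f g = (\<integral>z. nev f z * cnj (nev g z) \<partial>lborel) / of_real (pi ^ CARD('n))"
  for f g :: "'n::finite fock"
proof -
  have "fock_cinner f g = (\<integral>w. (1 / pi ^ CARD('n)) *\<^sub>R (nev f w * cnj (nev g w)) \<partial>lborel)"
    unfolding fock_cinner_def gdens_nev[symmetric] by (subst integral_gauss) auto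
  then show ?thesis by (simp add: scaleR_conv_of_real)
qed

lemma integrable_nev_square: "integrable lborel (\<lambda>z. (cmod (nev f z))\<^sup>2)"
proof -
  have "(\<lambda>z. complex_of_real ((cmod (nev f z))\<^sup>2)) = (\<lambda>z. nev f z * cnj (nev f z))"
    by (rule ext) (simp only: complex_norm_square)
  then have "integrable lborel (\<lambda>z. complex_of_real ((cmod (nev f z))\<^sup>2))"
    using integrable_nev[of f f] by (simp only:)
  then show ?thesis by (simp only: complex_of_real_integrable_eq)
qed

lemma integral_nev_square: "(\<integral>z. (cmod (nev f z))\<^sup>2 \<partial>lborel) = pi ^ CARD('n) * (norm f)\<^sup>2"
  for f :: "'n::finite fock"
proof -
  have "(\<integral>z. nev f z * cnj (nev f z) \<partial>lborel) = of_real (\<integral>z. (cmod (nev f z))\<^sup>2 \<partial>lborel)"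
    unfolding complex_norm_square[symmetric] by (rule integral_complex_of_real)
  then have "complex_of_real ((norm f)\<^sup>2) = of_real ((\<integral>z. (cmod (nev f z))\<^sup>2 \<partial>lborel) / pi ^ CARD('n))"
    using fock_cinner_nev[of f f] unfolding fock_cinner_self by simp
  then show ?thesis unfolding of_real_eq_iff by (simp add: field_simps)
qed

lemma nn_integral_nev_square:
  "(\<integral>\<^sup>+z. (ennreal (cmod (nev f z)))\<^sup>2 \<partial>lborel) = ennreal ((sqrt (pi ^ CARD('n)) * norm f)\<^sup>2)"
  for f :: "'n::finite fock"
  using nn_integral_eq_integral[OF integrable_nev_square[of f]] integral_nev_square[of f]
  by (simp add: ennreal_power power_mult_distrib)

lemma nev_eq_cinner: "nev f z = fock_cinner f (nkerf z)"
proof -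
  have "fock_cinner f (nkerf z) = (\<integral>w. of_real (exp (- (norm z)\<^sup>2 / 2)) * (fock_fun f w * cnj (ker z w)) \<partial>gauss 1)"
    unfolding fock_cinner_def nkerf.rep_eq nker_def
    by (intro Bochner_Integration.integral_cong) (auto simp: mult_ac)
  also have "\<dots> = of_real (exp (- (norm z)\<^sup>2 / 2)) * fock_fun f z"
    using reproducing[OF entire_fock_fun fock_fun_L2, of f z] by simp
  finally show ?thesis by (simp add: nev_def)
qed

lemma nev_nkerf: "nev (nkerf z) w = exp (of_real (- ((norm z)\<^sup>2 + (norm w)\<^sup>2) / 2) + hdot w z)"
proof -
  have eq: "complex_of_real (- (norm w)\<^sup>2 / 2) + complex_of_real (- (norm z)\<^sup>2 / 2)
      = complex_of_real (- ((norm z)\<^sup>2 + (norm w)\<^sup>2) / 2)"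
    unfolding of_real_add[symmetric] by (simp add: field_simps)
  show ?thesis
    unfolding eq[symmetric] nev_def nkerf.rep_eq nker_def ker_def exp_add exp_of_real by (simp only: mult.assoc)
qed

lemma cmod_nev_nkerf: "cmod (nev (nkerf z) w) = exp (- (norm (z - w))\<^sup>2 / 2)"
  by (simp add: nev_nkerf norm_exp_eq_Re Re_hdot)
    (simp add: power2_norm_eq_inner inner_diff inner_commute field_simps)

lemma norm_nkerf [simp]: "norm (nkerf z) = 1"
proof -
  have "complex_of_real ((norm (nkerf z))\<^sup>2) = nev (nkerf z) z"
    by (simp only: nev_eq_cinner fock_cinner_self)
  also have "\<dots> = 1" by (simp add: nev_nkerf hdot_self)
  finally show ?thesis by (simp add: power2_eq_1_iff flip: of_real_power) (smt (verit) norm_ge_zero)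
qed

lemma cmod_nev_le: "cmod (nev f z) \<le> norm f"
  using cmod_fock_cinner_le[of f "nkerf z"] by (simp add: nev_eq_cinner)

text \<open>The square of an entire function is entire, so the mean value property bounds its
  modulus. The Gaussian parameter 1/2 is chosen so that, once the growth from the normalization is
  cancelled, exactly exp (- |u|^2) is left; (2 / pi)^n is the normalizing constant of that Gaussian
  measure.\<close>

lemma nev_square_submean:
  fixes f :: "'n::finite fock"
  shows "ennreal ((cmod (nev f z))\<^sup>2) \<le>
    ennreal ((2 / pi) ^ CARD('n)) * (\<integral>\<^sup>+v. ennreal ((cmod (nev f v))\<^sup>2 * exp (- (norm (v - z))\<^sup>2)) \<partial>lborel)"
proof -
  \<comment> \<open>The factor \<open>exp (- hdot u z)\<close> removes the cross term of |z + u|^2,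
    so that the remaining weight is a Gaussian in u alone.\<close>
  define h where "h u = (fock_fun f (z + u) * exp (- hdot u z))\<^sup>2" for u
  have h: "entire h"
    unfolding h_def power2_eq_square using entire_shift[OF entire_fock_fun[of f], of "-z"]
    by (intro entire_mult entire_exp_hdot) (simp_all add: add.commute)
  note [measurable] = entire_measurable[OF h]
  let ?g = "\<lambda>u. (2 / pi) ^ CARD('n) * exp ((norm z)\<^sup>2) * ((cmod (nev f (z + u)))\<^sup>2 * exp (- (norm u)\<^sup>2))"
  have eq: "norm (gdens (1/2) u *\<^sub>R h u) = ?g u" for u
  proof -
    have "(norm (z + u))\<^sup>2 + - 2 * (norm u)\<^sup>2 - 2 * inner u z = (norm z)\<^sup>2 - (norm u)\<^sup>2"
      by (simp add: power2_norm_eq_inner inner_add inner_commute algebra_simps)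
    then have "exp ((norm (z + u))\<^sup>2) * (exp (- 2 * (norm u)\<^sup>2) * exp (- 2 * inner u z))
       = exp ((norm z)\<^sup>2) * exp (- (norm u)\<^sup>2)"
      by (simp flip: exp_add)
    then show ?thesis
      by (simp add: h_def fock_fun_nev norm_mult norm_power power_mult_distrib norm_exp_eq_Re Re_hdot
        flip: exp_double) (simp add: field_simps power_divide)
  qed
  have int_nev: "integrable lborel (\<lambda>u. (cmod (nev f (z + u)))\<^sup>2)"
    using integral_lborel_shift(2)[of "\<lambda>u. (cmod (nev f u))\<^sup>2" z] integrable_nev_square by simp
  have "integrable lborel ?g"
    by (intro integrable_mult_right Bochner_Integration.integrable_bound[OF int_nev]) (auto intro!: mult_left_le)
  then have "integrable lborel (\<lambda>u. gdens (1/2) u *\<^sub>R h u)"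
    unfolding eq[symmetric] by (rule integrable_norm_cancel) measurable
  then have int: "integrable (gauss (1/2)) h" by (subst integrable_gauss) auto
  have "h 0 = (\<integral>u. gdens (1/2) u *\<^sub>R h u \<partial>lborel)"
    using entire_gauss_mean[OF h int] integral_gauss[of h "1/2"] by simp
  then have "ennreal (cmod (h 0)) \<le> (\<integral>\<^sup>+u. ennreal (?g u) \<partial>lborel)"
    unfolding eq[symmetric] using integral_norm_bound_ennreal[OF \<open>integrable lborel (\<lambda>u. gdens (1/2) u *\<^sub>R h u)\<close>] by simp
  also have "\<dots> = ennreal ((2 / pi) ^ CARD('n) * exp ((norm z)\<^sup>2)) *
     (\<integral>\<^sup>+u. ennreal ((cmod (nev f (z + u)))\<^sup>2 * exp (- (norm u)\<^sup>2)) \<partial>lborel)"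
    by (subst ennreal_mult) (auto intro!: nn_integral_cmult)
  also have "(\<integral>\<^sup>+u. ennreal ((cmod (nev f (z + u)))\<^sup>2 * exp (- (norm u)\<^sup>2)) \<partial>lborel)
     = (\<integral>\<^sup>+v. ennreal ((cmod (nev f v))\<^sup>2 * exp (- (norm (v - z))\<^sup>2)) \<partial>lborel)"
    using nn_integral_lborel_shift[of "\<lambda>v. ennreal ((cmod (nev f v))\<^sup>2 * exp (- (norm (v - z))\<^sup>2))" z] by simp
  finally have "ennreal (exp (- (norm z)\<^sup>2)) * ennreal (cmod (h 0)) \<le> ennreal (exp (- (norm z)\<^sup>2)) *
     (ennreal ((2 / pi) ^ CARD('n) * exp ((norm z)\<^sup>2)) *
      (\<integral>\<^sup>+v. ennreal ((cmod (nev f v))\<^sup>2 * exp (- (norm (v - z))\<^sup>2)) \<partial>lborel))"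
    by (rule mult_left_mono) simp
  also have "\<dots> = ennreal ((2 / pi) ^ CARD('n)) *
      (\<integral>\<^sup>+v. ennreal ((cmod (nev f v))\<^sup>2 * exp (- (norm (v - z))\<^sup>2)) \<partial>lborel)"
    by (simp add: mult.assoc[symmetric] exp_minus field_simps flip: ennreal_mult)
  also have "ennreal (exp (- (norm z)\<^sup>2)) * ennreal (cmod (h 0)) = ennreal ((cmod (nev f z))\<^sup>2)"
    by (simp add: h_def nev_def norm_mult norm_power power_mult_distrib flip: ennreal_mult exp_double)
  finally show ?thesis .
qed

section \<open>Completeness of the Fock space and the Riesz representation\<close>

lemma measurable_ident_gauss: "(\<lambda>w. w) \<in> borel_measurable (gauss t)"
  by (simp add: borel_measurable_lebesgueI)

lemma L2_Cauchy_Schwarz: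
  assumes "f \<in> L2_fun" "g \<in> L2_fun"
  shows "cmod (\<integral>w. f w * cnj (g w) \<partial>gauss 1)
    \<le> sqrt (\<integral>w. (cmod (f w))\<^sup>2 \<partial>gauss 1) * sqrt (\<integral>w. (cmod (g w))\<^sup>2 \<partial>gauss 1)"
proof -
  note [measurable] = L2_funD(1)[OF assms(1)] L2_funD(1)[OF assms(2)]
  let ?I = "\<lambda>h. \<integral>w. (cmod (h w))\<^sup>2 \<partial>gauss 1"
  have I: "(\<integral>\<^sup>+w. (ennreal (cmod (h w)))\<^sup>2 \<partial>gauss 1) = ennreal (?I h)" if "h \<in> L2_fun" for h :: "(complex, 'a) vec \<Rightarrow> complex"
    using nn_integral_eq_integral[OF L2_funD(2)[OF that]] by (simp add: ennreal_power)
  let ?J = "\<integral>w. cmod (f w * cnj (g w)) \<partial>gauss 1"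
  have J: "ennreal ?J = (\<integral>\<^sup>+w. ennreal (cmod (f w)) * ennreal (cmod (g w)) \<partial>gauss 1)"
    using nn_integral_eq_integral[OF integrable_norm[OF L2_fun_inner_integrable[OF assms]]]
    by (simp add: norm_mult ennreal_mult)
  have "(ennreal ?J)\<^sup>2 \<le> ennreal (?I f) * ennreal (?I g)"
    unfolding J I[OF assms(1), symmetric] I[OF assms(2), symmetric]
    by (rule Cauchy_Schwarz_nn_integral) auto
  then have "?J\<^sup>2 \<le> ?I f * ?I g" by (simp add: ennreal_power flip: ennreal_mult)
  then have "?J \<le> sqrt (?I f) * sqrt (?I g)"
    unfolding real_sqrt_mult[symmetric] by (rule real_le_rsqrt)
  then show ?thesis using integral_norm_bound[of "gauss 1" "\<lambda>w. f w * cnj (g w)"] by linarith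
qed

lemma norm_exp_remainder: "cmod (exp a - 1 - a) \<le> exp (cmod a) * (cmod a)\<^sup>2"
proof -
  have "cmod (exp a - 1 - a) \<le> exp \<bar>Re a\<bar> * (cmod a)\<^sup>2"
    using Taylor_exp[of a 1] by (simp add: diff_diff_eq numeral_2_eq_2)
  also have "\<dots> \<le> exp (cmod a) * (cmod a)\<^sup>2"
    by (intro mult_right_mono) (auto simp: abs_Re_le_cmod)
  finally show ?thesis .
qed

text \<open>Exponentials of this form dominate the kernels and their difference quotients, hence the
  integrands of \<open>entire_Bargmann_integral\<close>.\<close>

lemma L2_fun_exp_norm: "(\<lambda>w. complex_of_real (exp (c * norm w))) \<in> (L2_fun :: (complex^'n::finite \<Rightarrow> _) set)"
proof -
  have b: "exp (- (norm w)\<^sup>2) * (exp (c * norm w))\<^sup>2 \<le> exp (2 * c\<^sup>2) * exp (- (1/2) * (norm w)\<^sup>2)" for w :: "complex^'n"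
  proof -
    have "0 \<le> (norm w - 2 * c)\<^sup>2" by simp
    also have "\<dots> = (norm w)\<^sup>2 - 4 * (c * norm w) + 4 * c\<^sup>2"
      by (simp add: power2_diff power_mult_distrib)
    finally have "- (norm w)\<^sup>2 + 2 * (c * norm w) \<le> 2 * c\<^sup>2 + - (1/2) * (norm w)\<^sup>2"
      by simp
    then show ?thesis by (simp flip: exp_add exp_double)
  qed
  have "integrable lborel (\<lambda>w::complex^'n. exp (- (norm w)\<^sup>2) * (exp (c * norm w))\<^sup>2)"
    by (rule Bochner_Integration.integrable_bound[OF integrable_mult_right[OF integrable_gaussian[of "1/2"], of "exp (2 * c\<^sup>2)"]])
       (use b in auto)
  then have "integrable (gauss 1) (\<lambda>w::complex^'n. (exp (c * norm w))\<^sup>2)"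
    by (subst integrable_gauss) auto
  then show ?thesis by (auto simp: L2_fun_def intro: borel_measurable_lebesgueI)
qed

text \<open>Differentiation under the integral sign for an arbitrary square integrable g. It serves
  to recognize a limit of Fock functions as entire through its reproducing formula.\<close>

lemma entire_Bargmann_integral:
  fixes g :: "complex^'n::finite \<Rightarrow> complex"
  assumes "g \<in> L2_fun"
  shows "entire (\<lambda>z. \<integral>w. g w * exp (hdot z w) \<partial>gauss 1)"
proof -
  note [measurable] = L2_funD(1)[OF assms, folded borel_measurable_gauss[of 1]] measurable_ident_gauss
  \<comment> \<open>One family of integrable majorants: a factor |w| or |w|^2 from differentiation
    is paid for by increasing c.\<close>
  define E where "E c w = cmod (g w) * exp (c * norm w)" for c w
  have E: "integrable (gauss 1) (E c)" for c
    using integrable_norm[OF L2_fun_inner_integrable[OF assms L2_fun_exp_norm[of c]]]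
    by (simp add: E_def[abs_def] norm_mult)
  have exp_le: "cmod (exp (hdot z w)) \<le> exp (norm z * norm w)" for z w :: "complex^'n"
    using cmod_hdot_le[of z w] abs_Re_le_cmod[of "hdot z w"] by (simp add: norm_exp_eq_Re)
  have pow_le: "x\<^sup>2 \<le> 2 * exp x" "x \<le> exp x" if "x \<ge> 0" for x :: real
    using exp_lower_Taylor_quadratic[OF that] that exp_ge_add_one_self[of x] by (simp add: field_simps, linarith)
  have int0: "integrable (gauss 1) (\<lambda>w. g w * exp (hdot z w))" for z
  proof (rule Bochner_Integration.integrable_bound[OF E[of "norm z"]])
    show "AE w in gauss 1. norm (g w * exp (hdot z w)) \<le> norm (E (norm z) w)"
      using exp_le[of z] by (auto simp: E_def norm_mult intro!: mult_left_mono)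
  qed measurable
  have b1: "norm (g w * exp (hdot z w) * hdot v w) \<le> norm v * E (norm z + 1) w" for z v w
  proof -
    have "norm (g w * exp (hdot z w) * hdot v w) \<le> (cmod (g w) * exp (norm z * norm w)) * (norm v * exp (norm w))"
      unfolding norm_mult
      by (intro mult_mono exp_le order.refl order.trans[OF cmod_hdot_le] mult_left_mono pow_le) auto
    then show ?thesis by (simp add: E_def algebra_simps exp_add)
  qed
  have int1: "integrable (gauss 1) (\<lambda>w. g w * exp (hdot z w) * hdot v w)" for z v
  proof (rule Bochner_Integration.integrable_bound[OF integrable_mult_right[OF E[of "norm z + 1"], of "norm v"]])
    show "AE w in gauss 1. norm (g w * exp (hdot z w) * hdot v w) \<le> norm (norm v * E (norm z + 1) w)"
      using b1[of _ z v] by (auto intro: order.trans[OF _ abs_ge_self])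
  qed measurable
  define G where "G z = (\<integral>w. g w * exp (hdot z w) \<partial>gauss 1)" for z
  define D where "D z v = (\<integral>w. g w * exp (hdot z w) * hdot v w \<partial>gauss 1)" for z v
  have D_add: "D z (u + v) = D z u + D z v" for z u v
    unfolding D_def hdot_add_left distrib_left by (rule Bochner_Integration.integral_add[OF int1 int1])
  have D_scale: "D z (c *s v) = c * D z v" for z c v
    unfolding D_def hdot_scale by (subst integral_mult_right_zero[symmetric]) (simp add: mult_ac)
  have D_scaleR: "D z (r *\<^sub>R v) = r *\<^sub>R D z v" for z r v
  proof -
    have "r *\<^sub>R v = of_real r *s v" by (simp add: vec_eq_iff) (simp add: scaleR_conv_of_real)
    then show ?thesis by (simp add: D_scale scaleR_conv_of_real)
  qed
  have D_bound: "norm (D z v) \<le> norm v * integral\<^sup>L (gauss 1) (E (norm z + 1))" for z v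
  proof -
    have "norm (D z v) \<le> (\<integral>w. norm v * E (norm z + 1) w \<partial>gauss 1)"
      unfolding D_def by (intro Bochner_Integration.integral_norm_bound_integral int1 integrable_mult_right E b1)
    then show ?thesis by simp
  qed
  have "(G has_derivative D z) (at z)" for z
    unfolding has_derivative_at
  proof
    show "bounded_linear (D z)"
      by (rule bounded_linear_intro[OF D_add D_scaleR D_bound])
    \<comment> \<open>For |v| <= 1 the exponential remainder costs one factor exp |w| and |w|^2
      costs another, whence |z| + 2; the 2 in front comes from x^2 <= 2 exp x.\<close>
    let ?K = "2 * integral\<^sup>L (gauss 1) (E (norm z + 2))"
    have rem: "norm (G (z + v) - G z - D z v) \<le> (norm v)\<^sup>2 * ?K" if "norm v \<le> 1" for v
    proof -
      have split: "g w * exp (hdot z w) * (exp (hdot v w) - 1 - hdot v w)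
        = g w * exp (hdot (z + v) w) - g w * exp (hdot z w) - g w * exp (hdot z w) * hdot v w" for w
        by (simp add: hdot_add_left exp_add algebra_simps)
      have "G (z + v) - G z - D z v = (\<integral>w. g w * exp (hdot z w) * (exp (hdot v w) - 1 - hdot v w) \<partial>gauss 1)"
        unfolding split G_def D_def
        by (simp only: Bochner_Integration.integral_diff[OF Bochner_Integration.integrable_diff[OF int0 int0] int1]
          Bochner_Integration.integral_diff[OF int0 int0])
      also have "norm \<dots> \<le> (\<integral>w. (norm v)\<^sup>2 * 2 * E (norm z + 2) w \<partial>gauss 1)"
      proof (intro Bochner_Integration.integral_norm_bound_integral integrable_mult_right E)
        show "integrable (gauss 1) (\<lambda>w. g w * exp (hdot z w) * (exp (hdot v w) - 1 - hdot v w))"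
          unfolding split by (intro Bochner_Integration.integrable_diff int0 int1)
        fix w
        have "norm (exp (hdot v w) - 1 - hdot v w) \<le> exp (cmod (hdot v w)) * (cmod (hdot v w))\<^sup>2"
          by (rule norm_exp_remainder)
        also have "\<dots> \<le> exp (norm w) * (norm v * norm w)\<^sup>2"
        proof (intro mult_mono power_mono cmod_hdot_le)
          have "cmod (hdot v w) \<le> 1 * norm w"
            by (intro order.trans[OF cmod_hdot_le] mult_right_mono that) auto
          then show "exp (cmod (hdot v w)) \<le> exp (norm w)" by simp
        qed auto
        also have "\<dots> \<le> exp (norm w) * ((norm v)\<^sup>2 * (2 * exp (norm w)))"
          unfolding power_mult_distrib by (intro mult_left_mono pow_le) auto
        finally have r: "norm (exp (hdot v w) - 1 - hdot v w) \<le> exp (norm w) * ((norm v)\<^sup>2 * (2 * exp (norm w)))" .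
        have e2: "exp ((norm z + 2) * norm w) = exp (norm z * norm w) * exp (norm w) * exp (norm w)"
          by (simp add: distrib_right flip: exp_add)
        have "norm (g w * exp (hdot z w) * (exp (hdot v w) - 1 - hdot v w))
          \<le> (cmod (g w) * exp (norm z * norm w)) * (exp (norm w) * ((norm v)\<^sup>2 * (2 * exp (norm w))))"
          unfolding norm_mult[of _ "_ - _"]
          by (intro mult_mono r order.trans[OF norm_mult_ineq] exp_le) auto
        then show "norm (g w * exp (hdot z w) * (exp (hdot v w) - 1 - hdot v w)) \<le> (norm v)\<^sup>2 * 2 * E (norm z + 2) w"
          unfolding E_def e2 by (simp only: mult_ac)
      qed
      finally show ?thesis by simp
    qed
    show "(\<lambda>h. norm (G (z + h) - G z - D z h) / norm h) \<midarrow>0\<rightarrow> 0"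
    proof (rule Lim_null_comparison)
      show "\<forall>\<^sub>F h in at 0. norm (norm (G (z + h) - G z - D z h) / norm h) \<le> norm h * ?K"
        unfolding eventually_at
      proof (intro exI[of _ 1] conjI ballI impI)
        fix h :: "complex^'n" assume h: "h \<noteq> 0 \<and> dist h 0 < 1"
        then have "norm (G (z + h) - G z - D z h) / norm h \<le> (norm h)\<^sup>2 * ?K / norm h"
          by (intro divide_right_mono rem) auto
        then show "norm (norm (G (z + h) - G z - D z h) / norm h) \<le> norm h * ?K"
          using h by (simp add: power2_eq_square)
      qed simp
      show "(\<lambda>h. norm h * ?K) \<midarrow>0\<rightarrow> 0" by (auto intro!: tendsto_eq_intros)
    qed
  qed
  then show ?thesis unfolding entire_def G_def[symmetric] using D_scale by blast
qed

lemma cmod_fock_fun_le: "cmod (fock_fun f z) \<le> exp ((norm z)\<^sup>2 / 2) * norm f"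
  using cmod_nev_le[of f z] by (simp add: fock_fun_nev norm_mult)

lemma minus_fock_fun: "fock_fun (f - g) z = fock_fun f z - fock_fun g z"
  by (simp only: minus_fock_def plus_fock.rep_eq uminus_fock.rep_eq) simp

text \<open>Evaluations are bounded, so a Cauchy sequence converges pointwise; Fatou gives square
  integrability of the limit and convergence in norm. The limit inherits the reproducing formula,
  and that makes it entire.\<close>

instance fock :: (finite) banach
proof
  fix X :: "nat \<Rightarrow> 'a fock"
  assume "Cauchy X"
  have ker_exp: "cnj (ker z w) = exp (hdot z w)" for z w :: "complex^'a"
    by (simp add: ker_def exp_cnj cnj_hdot)
  have "Cauchy (\<lambda>m. fock_fun (X m) z)" for z
  proof (rule metric_CauchyI)
    fix e :: real assume "e > 0"
    then obtain M where M: "\<And>m k. m \<ge> M \<Longrightarrow> k \<ge> M \<Longrightarrow> dist (X m) (X k) < e / exp ((norm z)\<^sup>2 / 2)"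
      using \<open>Cauchy X\<close>[unfolded Cauchy_def, rule_format, OF divide_pos_pos[OF \<open>e > 0\<close> exp_gt_zero[of "(norm z)\<^sup>2 / 2"]]]
      by blast
    show "\<exists>M. \<forall>m\<ge>M. \<forall>k\<ge>M. dist (fock_fun (X m) z) (fock_fun (X k) z) < e"
    proof (intro exI[of _ M] allI impI)
      fix m k assume "m \<ge> M" "k \<ge> M"
      from M[OF this] have "exp ((norm z)\<^sup>2 / 2) * norm (X m - X k) < e"
        by (simp add: dist_norm field_simps)
      then show "dist (fock_fun (X m) z) (fock_fun (X k) z) < e"
        using cmod_fock_fun_le[of "X m - X k" z] by (simp add: dist_norm minus_fock_fun)
    qed
  qed
  then have "convergent (\<lambda>m. fock_fun (X m) z)" for z by (intro Cauchy_convergent)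
  then obtain f where f: "\<And>z. (\<lambda>m. fock_fun (X m) z) \<longlonglongrightarrow> f z"
    unfolding convergent_def by metis
  have mf: "f \<in> borel_measurable borel"
    by (rule borel_measurable_LIMSEQ_metric[of "\<lambda>m. fock_fun (X m)"]) (use f in auto)
  note [measurable] = borel_measurable_lebesgueI[OF mf] borel_measurable_lebesgueI[OF fock_fun_measurable]
    measurable_ident_gauss
  have norm_nn: "(\<integral>\<^sup>+w. ennreal ((cmod (fock_fun g w))\<^sup>2) \<partial>gauss 1) = ennreal ((norm g)\<^sup>2)" for g :: "'a fock"
    using nn_integral_eq_integral[OF L2_funD(2)[OF fock_fun_L2[of g]]] by (simp add: norm_fock_eq)
  \<comment> \<open>Fatou in k with m fixed turns the Cauchy estimate into an estimate against the
    pointwise limit.\<close>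
  have fatou: "\<exists>M. \<forall>m\<ge>M. (\<integral>\<^sup>+w. ennreal ((cmod (f w - fock_fun (X m) w))\<^sup>2) \<partial>gauss 1) \<le> ennreal (e\<^sup>2)" if e: "e > 0" for e
  proof -
    obtain M where M: "\<And>m k. m \<ge> M \<Longrightarrow> k \<ge> M \<Longrightarrow> norm (X m - X k) < e"
      using \<open>Cauchy X\<close>[unfolded Cauchy_iff, rule_format, OF e] by blast
    have "(\<integral>\<^sup>+w. ennreal ((cmod (f w - fock_fun (X m) w))\<^sup>2) \<partial>gauss 1) \<le> ennreal (e\<^sup>2)" if "m \<ge> M" for m
    proof -
      have lim: "(\<lambda>k. ennreal ((cmod (fock_fun (X k - X m) w))\<^sup>2)) \<longlonglongrightarrow> ennreal ((cmod (f w - fock_fun (X m) w))\<^sup>2)" for w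
        unfolding minus_fock_fun by (intro tendsto_intros f)
      have "(\<integral>\<^sup>+w. ennreal ((cmod (f w - fock_fun (X m) w))\<^sup>2) \<partial>gauss 1)
        = (\<integral>\<^sup>+w. liminf (\<lambda>k. ennreal ((cmod (fock_fun (X k - X m) w))\<^sup>2)) \<partial>gauss 1)"
        by (simp only: lim_imp_Liminf[OF sequentially_bot lim])
      also have "\<dots> \<le> liminf (\<lambda>k. \<integral>\<^sup>+w. ennreal ((cmod (fock_fun (X k - X m) w))\<^sup>2) \<partial>gauss 1)"
        by (rule nn_integral_liminf) measurable
      also have "\<dots> \<le> liminf (\<lambda>k. ennreal (e\<^sup>2))"
      proof (rule Liminf_mono)
        show "\<forall>\<^sub>F k in sequentially. (\<integral>\<^sup>+w. ennreal ((cmod (fock_fun (X k - X m) w))\<^sup>2) \<partial>gauss 1) \<le> ennreal (e\<^sup>2)"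
          using eventually_ge_at_top[of M]
        proof eventually_elim
          case (elim k)
          show ?case unfolding norm_nn using M[OF elim that] by (intro ennreal_leI power_mono) auto
        qed
      qed
      finally show ?thesis by (simp add: Liminf_const)
    qed
    then show ?thesis by blast
  qed
  have diff_L2: "(\<lambda>w. f w - fock_fun (X m) w) \<in> L2_fun \<and> (\<integral>w. (cmod (f w - fock_fun (X m) w))\<^sup>2 \<partial>gauss 1) \<le> e\<^sup>2"
    if "(\<integral>\<^sup>+w. ennreal ((cmod (f w - fock_fun (X m) w))\<^sup>2) \<partial>gauss 1) \<le> ennreal (e\<^sup>2)" for m e
  proof
    have "integrable (gauss 1) (\<lambda>w. (cmod (f w - fock_fun (X m) w))\<^sup>2)"
      by (rule integrableI_bounded) (use order.strict_trans1[OF that ennreal_less_top] in auto)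
    then show "(\<lambda>w. f w - fock_fun (X m) w) \<in> L2_fun" by (simp add: L2_fun_def)
    from nn_integral_eq_integral[OF \<open>integrable _ _\<close>] that
    show "(\<integral>w. (cmod (f w - fock_fun (X m) w))\<^sup>2 \<partial>gauss 1) \<le> e\<^sup>2"
      by simp
  qed
  have fL2: "f \<in> L2_fun"
  proof -
    obtain M where "\<forall>m\<ge>M. (\<integral>\<^sup>+w. ennreal ((cmod (f w - fock_fun (X m) w))\<^sup>2) \<partial>gauss 1) \<le> ennreal (1\<^sup>2)"
      using fatou[OF zero_less_one] by blast
    then have "(\<lambda>w. f w - fock_fun (X M) w) \<in> L2_fun" using diff_L2[of M 1] by blast
    from L2_fun_add[OF this fock_fun_L2[of "X M"]] show ?thesis by simp
  qed
  have "f = (\<lambda>z. \<integral>w. f w * exp (hdot z w) \<partial>gauss 1)"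
  proof
    fix z :: "complex^'a"
    let ?k = "sqrt (\<integral>w. (cmod (ker z w))\<^sup>2 \<partial>gauss 1)"
    have "(\<lambda>m. fock_fun (X m) z) \<longlonglongrightarrow> (\<integral>w. f w * cnj (ker z w) \<partial>gauss 1)"
    proof (rule metric_LIMSEQ_I)
      fix e :: real assume e: "e > 0"
      \<comment> \<open>The 1 added to \<open>?k\<close> makes the denominator positive at once and
        the final inequality strict.\<close>
      define d where "d = e / (?k + 1)"
      have k: "?k \<ge> 0" by simp
      then have k1: "?k + 1 > 0" by (rule add_nonneg_pos) simp
      then have d: "d > 0" unfolding d_def using e by (intro divide_pos_pos)
      have "d * ?k < d * (?k + 1)" using d by simp
      also have "\<dots> = e" using k1 by (simp only: d_def times_divide_eq_left nonzero_mult_div_cancel_right[OF less_imp_neq[OF k1, symmetric]])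
      finally have dk: "d * ?k < e" .
      obtain M where M: "\<And>m. m \<ge> M \<Longrightarrow> (\<integral>\<^sup>+w. ennreal ((cmod (f w - fock_fun (X m) w))\<^sup>2) \<partial>gauss 1) \<le> ennreal (d\<^sup>2)"
        using fatou[OF d] by blast
      show "\<exists>M. \<forall>m\<ge>M. dist (fock_fun (X m) z) (\<integral>w. f w * cnj (ker z w) \<partial>gauss 1) < e"
      proof (intro exI[of _ M] allI impI)
        fix m assume "m \<ge> M"
        note L = diff_L2[OF M[OF this]]
        have "(\<integral>w. f w * cnj (ker z w) \<partial>gauss 1) - fock_fun (X m) z
          = (\<integral>w. (f w - fock_fun (X m) w) * cnj (ker z w) \<partial>gauss 1)"
          unfolding reproducing[OF entire_fock_fun fock_fun_L2, of "X m" z] left_diff_distrib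
          by (rule Bochner_Integration.integral_diff[symmetric])
             (intro L2_fun_inner_integrable fL2 fock_fun_L2 ker_L2)+
        also have "cmod \<dots> \<le> sqrt (\<integral>w. (cmod (f w - fock_fun (X m) w))\<^sup>2 \<partial>gauss 1) * ?k"
          by (rule L2_Cauchy_Schwarz) (use L ker_L2 in auto)
        also have "\<dots> \<le> d * ?k"
          using L d by (intro mult_right_mono real_le_lsqrt) auto
        finally show "dist (fock_fun (X m) z) (\<integral>w. f w * cnj (ker z w) \<partial>gauss 1) < e"
          using dk by (simp add: dist_norm norm_minus_commute)
      qed
    qed
    from LIMSEQ_unique[OF f this] show "f z = (\<integral>w. f w * exp (hdot z w) \<partial>gauss 1)"
      by (simp add: ker_exp)
  qed
  then have "entire f" using entire_Bargmann_integral[OF fL2] by simp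
  then have F: "fock_fun (Abs_fock f) = f" using fL2 by (intro Abs_fock_inverse) simp
  have "X \<longlonglongrightarrow> Abs_fock f"
  proof (rule metric_LIMSEQ_I)
    fix e :: real assume e: "e > 0"
    then obtain M where M: "\<And>m. m \<ge> M \<Longrightarrow> (\<integral>\<^sup>+w. ennreal ((cmod (f w - fock_fun (X m) w))\<^sup>2) \<partial>gauss 1) \<le> ennreal ((e/2)\<^sup>2)"
      using fatou[OF half_gt_zero] by blast
    show "\<exists>M. \<forall>m\<ge>M. dist (X m) (Abs_fock f) < e"
    proof (intro exI[of _ M] allI impI)
      fix m assume "m \<ge> M"
      have "norm (Abs_fock f - X m) \<le> e/2"
        unfolding norm_fock_eq minus_fock_fun F
        using diff_L2[OF M[OF \<open>m \<ge> M\<close>]] e by (intro real_le_lsqrt) auto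
      then show "dist (X m) (Abs_fock f) < e" using e by (simp add: dist_norm norm_minus_commute)
    qed
  qed
  then show "convergent X" by (auto simp: convergent_def)
qed

text \<open>The representing vector p is the minimizer of |x|^2 - 2 \<phi> x, which equals |x - p|^2
  - |p|^2. The parallelogram law makes minimizing sequences Cauchy, and completeness produces
  p.\<close>

lemma Riesz_representation:
  fixes \<phi> :: "'a::{real_inner, complete_space} \<Rightarrow> real"
  assumes "bounded_linear \<phi>"
  obtains p where "\<And>x. \<phi> x = inner p x"
proof -
  interpret bounded_linear \<phi> by fact
  obtain K where K: "\<And>x. norm (\<phi> x) \<le> norm x * K" using bounded by blast
  define J where "J x = (norm x)\<^sup>2 - 2 * \<phi> x" for x
  have J_ge: "J x \<ge> - K\<^sup>2" for x
  proof -
    have "0 \<le> (norm x - K)\<^sup>2" by simp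
    then show ?thesis using K[of x] by (simp add: J_def power2_diff abs_le_iff)
  qed
  then have bdd: "bdd_below (range J)" by (intro bdd_belowI[of _ "- K\<^sup>2"]) auto
  define m where "m = (INF x. J x)"
  have m_le: "m \<le> J x" for x
    unfolding m_def by (rule cINF_lower[OF bdd]) simp
  have "\<exists>x. J x < m + 1 / real (Suc n)" for n
    using cINF_less_iff[of UNIV J "m + 1 / real (Suc n)", OF _ bdd] unfolding m_def by simp
  then obtain x where x: "\<And>n. J (x n) < m + 1 / real (Suc n)" by metis
  have par: "(norm (u - v))\<^sup>2 = 2 * (J u + J v - 2 * J ((u + v) /\<^sub>R 2))" for u v
    by (simp add: J_def power2_norm_eq_inner scaleR add inner_simps inner_commute algebra_simps)
  have "Cauchy x"
  proof (rule metric_CauchyI)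
    fix e :: real assume "e > 0"
    then obtain N where N: "inverse (real (Suc N)) < e\<^sup>2 / 4" using reals_Archimedean[of "e\<^sup>2 / 4"] by auto
    show "\<exists>M. \<forall>m\<ge>M. \<forall>n\<ge>M. dist (x m) (x n) < e"
    proof (intro exI[of _ N] allI impI)
      fix k l assume "k \<ge> N" "l \<ge> N"
      then have "1 / real (Suc k) \<le> inverse (real (Suc N))" "1 / real (Suc l) \<le> inverse (real (Suc N))"
        by (auto simp: field_simps)
      then have "J (x k) < m + e\<^sup>2 / 4" "J (x l) < m + e\<^sup>2 / 4"
        using x[of k] x[of l] N by auto
      then have "(norm (x k - x l))\<^sup>2 < e\<^sup>2"
        unfolding par using m_le[of "(x k + x l) /\<^sub>R 2"] by simp
      then show "dist (x k) (x l) < e"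
        using \<open>e > 0\<close> by (simp add: dist_norm power_less_imp_less_base)
    qed
  qed
  then obtain p where p: "x \<longlonglongrightarrow> p" using Cauchy_convergent_iff convergent_def by blast
  have "(\<lambda>n. J (x n)) \<longlonglongrightarrow> J p"
    unfolding J_def by (intro tendsto_intros tendsto p)
  moreover have "(\<lambda>n. m + 1 / real (Suc n)) \<longlonglongrightarrow> m + 0"
    by (intro tendsto_intros LIMSEQ_Suc[OF lim_1_over_n])
  ultimately have "J p \<le> m + 0" by (rule LIMSEQ_le) (use x less_imp_le in blast)
  then have min: "J p \<le> J y" for y using m_le[of y] by linarith
  have "\<phi> y = inner p y" for y
  proof -
    \<comment> \<open>\<open>a\<close> is half the derivative of \<open>J\<close> at p in direction
      y; minimality makes the quadratic polynomial in \<open>q\<close> nonnegative for all t, which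
      forces \<open>a\<close> to vanish.\<close>
    define a where "a = inner p y - \<phi> y"
    have q: "0 \<le> t\<^sup>2 * (norm y)\<^sup>2 + 2 * t * a" for t
    proof -
      have "(norm (p + t *\<^sub>R y))\<^sup>2 = (norm p)\<^sup>2 + 2 * t * inner p y + t\<^sup>2 * (norm y)\<^sup>2"
        unfolding power2_norm_eq_inner by (simp add: inner_simps inner_commute power2_eq_square)
      then show ?thesis
        using min[of "p + t *\<^sub>R y"] by (simp add: J_def a_def add scaleR algebra_simps)
    qed
    have "a = 0"
    proof (rule ccontr)
      assume "a \<noteq> 0"
      \<comment> \<open>Adding 1 covers y = 0; at t = - a / s the polynomial is at most - a^2 / s,
        which is negative.\<close>
      define s where "s = (norm y)\<^sup>2 + 1"
      have s: "s > 0" "(norm y)\<^sup>2 \<le> s" by (auto simp: s_def add_nonneg_pos)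
      have "(a / s)\<^sup>2 * (norm y)\<^sup>2 \<le> (a / s)\<^sup>2 * s" by (intro mult_left_mono s) auto
      then have "0 \<le> (a / s)\<^sup>2 * s - 2 * (a / s) * a" using q[of "- a / s"] by simp
      also have "\<dots> = - (a\<^sup>2 / s)" using s by (simp add: field_simps power2_eq_square)
      finally show False using \<open>a \<noteq> 0\<close> s by (simp add: divide_le_0_iff)
    qed
    then show ?thesis by (simp add: a_def)
  qed
  then show ?thesis by (rule that)
qed

section \<open>Adjoints and Weyl operators\<close>

lemma scaleR_fock: "r *\<^sub>R f = fock_scaleC (of_real r) f"
  by (simp add: scaleR_fock_def)

text \<open>The real Riesz theorem is applied to the real part; evaluating at g and at
  \<open>fock_scaleC \<i> g\<close> recovers the imaginary part, since \<phi> and the second slot of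
  \<open>fock_cinner\<close> are both conjugate linear.\<close>

lemma fock_Riesz:
  fixes \<phi> :: "'n::finite fock \<Rightarrow> complex"
  assumes add: "\<And>f g. \<phi> (f + g) = \<phi> f + \<phi> g" and scale: "\<And>c f. \<phi> (fock_scaleC c f) = cnj c * \<phi> f"
    and bound: "\<And>f. cmod (\<phi> f) \<le> C * norm f"
  shows "\<exists>p. \<forall>g. fock_cinner p g = \<phi> g"
proof -
  have "bounded_linear (\<lambda>g. Re (\<phi> g))"
  proof (rule bounded_linear_intro[where K = C])
    show "norm (Re (\<phi> g)) \<le> norm g * C" for g
      using bound[of g] abs_Re_le_cmod[of "\<phi> g"] by (simp add: mult.commute)
  qed (simp_all add: add scaleR_fock scale)
  from Riesz_representation[OF this] obtain p where p: "\<And>g. Re (\<phi> g) = inner p g" by blast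
  have "fock_cinner p g = \<phi> g" for g
    using p[of g] p[of "fock_scaleC \<i> g"]
    by (simp add: complex_eq_iff Im_fock_cinner scale inner_fock_def)
  then show ?thesis by blast
qed

lemma bdd_opsD: "A \<in> bdd_ops \<Longrightarrow> blinfun_apply A (fock_scaleC c f) = fock_scaleC c (blinfun_apply A f)"
  by (simp add: bdd_ops_def)

text \<open>Adjoints and Toeplitz operators are both obtained as operators of bounded sesquilinear
  forms.\<close>

lemma fock_form_op:
  fixes B :: "'n::finite fock \<Rightarrow> 'n fock \<Rightarrow> complex"
  assumes add1: "\<And>f f' g. B (f + f') g = B f g + B f' g" and scale1: "\<And>c f g. B (fock_scaleC c f) g = c * B f g"
    and add2: "\<And>f g g'. B f (g + g') = B f g + B f g'" and scale2: "\<And>c f g. B f (fock_scaleC c g) = cnj c * B f g"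
    and bound: "\<And>f g. cmod (B f g) \<le> C * norm f * norm g"
  shows "\<exists>A\<in>bdd_ops. \<forall>f g. fock_cinner (blinfun_apply A f) g = B f g"
proof -
  have "\<exists>p. \<forall>g. fock_cinner p g = B f g" for f
    by (rule fock_Riesz[where C = "C * norm f"]) (auto simp: add2 scale2 bound)
  then obtain T where T: "\<And>f g. fock_cinner (T f) g = B f g" by metis
  have add: "T (f + g) = T f + T g" for f g
    by (rule fock_cinner_eqI) (simp add: T add1 fock_cinner_add_left)
  have scale: "T (fock_scaleC c f) = fock_scaleC c (T f)" for c f
    by (rule fock_cinner_eqI) (simp add: T scale1 fock_cinner_scale_left)
  have "norm (T f) \<le> norm f * C" for f
  proof (cases "T f = 0")
    case True
    \<comment> \<open>No sign of \<open>C\<close> is given, so the bound at (f, f) has to supply 0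
      <= \<open>C\<close> when f is nonzero.\<close>
    have "0 \<le> cmod (B f f)" by simp
    also have "\<dots> \<le> C * norm f * norm f" by (rule bound)
    finally show ?thesis using True by (cases "f = 0") (auto simp: zero_le_mult_iff)
  next
    case False
    have "(norm (T f))\<^sup>2 = cmod (fock_cinner (T f) (T f))"
      unfolding fock_cinner_self norm_of_real by simp
    also have "\<dots> \<le> C * norm f * norm (T f)" unfolding T by (rule bound)
    finally show ?thesis using False by (simp add: power2_eq_square mult.commute)
  qed
  then have bl: "bounded_linear T"
    by (rule bounded_linear_intro[rotated 2]) (simp_all add: add scale scaleR_fock)
  show ?thesis
    by (rule bexI[of _ "Blinfun T"]) (auto simp: bounded_linear_Blinfun_apply[OF bl] T scale bdd_ops_def)
qed

lemma fock_cinner_proj: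
  assumes "g \<in> L2_fun"
  shows "fock_cinner (fock_proj g) h = (\<integral>w. g w * cnj (fock_fun h w) \<partial>gauss 1)"
proof -
  let ?\<phi> = "\<lambda>h. \<integral>w. g w * cnj (fock_fun h w) \<partial>gauss 1"
  note int = L2_fun_inner_integrable[OF assms fock_fun_L2]
  have "\<exists>p. \<forall>h. fock_cinner p h = ?\<phi> h"
  proof (rule fock_Riesz[where C = "sqrt (\<integral>w. (cmod (g w))\<^sup>2 \<partial>gauss 1)"])
    show "?\<phi> (h + k) = ?\<phi> h + ?\<phi> k" for h k
      unfolding plus_fock.rep_eq complex_cnj_add distrib_left
      by (rule Bochner_Integration.integral_add[OF int int])
    show "?\<phi> (fock_scaleC c h) = cnj c * ?\<phi> h" for c h
      unfolding fock_scaleC.rep_eq complex_cnj_mult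
      by (subst integral_mult_right_zero[symmetric]) (simp add: mult_ac)
    show "cmod (?\<phi> h) \<le> sqrt (\<integral>w. (cmod (g w))\<^sup>2 \<partial>gauss 1) * norm h" for h
      unfolding norm_fock_eq by (rule L2_Cauchy_Schwarz[OF assms fock_fun_L2])
  qed
  then obtain p where p: "\<And>h. fock_cinner p h = ?\<phi> h" by blast
  have diff: "(\<integral>w. (g w - fock_fun q w) * cnj (fock_fun h w) \<partial>gauss 1) = ?\<phi> h - fock_cinner q h" for q h
    unfolding left_diff_distrib fock_cinner_def
    by (rule Bochner_Integration.integral_diff) (intro int L2_fun_inner_integrable fock_fun_L2)+
  have "fock_proj g = p"
    unfolding fock_proj_def diff
  proof (rule the_equality)
    show "\<forall>h. ?\<phi> h - fock_cinner p h = 0" by (simp add: p)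
    show "q = p" if "\<forall>h. ?\<phi> h - fock_cinner q h = 0" for q
      by (rule fock_cinner_eqI) (use that p in simp)
  qed
  then show ?thesis by (simp add: p)
qed

lemma op_adj_eqI:
  assumes "\<And>f g. fock_cinner (blinfun_apply A f) g = fock_cinner f (blinfun_apply B g)"
  shows "op_adj A = B"
  unfolding op_adj_def
proof (rule the_equality)
  fix C assume C: "\<forall>f g. fock_cinner (blinfun_apply A f) g = fock_cinner f (blinfun_apply C g)"
  show "C = B"
  proof (rule blinfun_eqI)
    fix g
    show "blinfun_apply C g = blinfun_apply B g"
      by (rule fock_cinner_eqI) (metis C assms fock_cinner_commute)
  qed
qed (use assms in simp)

lemma
  assumes "A \<in> bdd_ops"
  shows op_adj_bdd: "op_adj A \<in> bdd_ops"
    and fock_cinner_adj: "fock_cinner (blinfun_apply A f) g = fock_cinner f (blinfun_apply (op_adj A) g)"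
proof -
  have "\<exists>B\<in>bdd_ops. \<forall>g f. fock_cinner (blinfun_apply B g) f = fock_cinner g (blinfun_apply A f)"
  proof (rule fock_form_op[where C = "norm A"])
    show "cmod (fock_cinner g (blinfun_apply A f)) \<le> norm A * norm g * norm f" for f g
    proof -
      have "cmod (fock_cinner g (blinfun_apply A f)) \<le> norm g * norm (blinfun_apply A f)"
        by (rule cmod_fock_cinner_le)
      also have "\<dots> \<le> norm g * (norm A * norm f)"
        by (intro mult_left_mono norm_blinfun) simp
      finally show ?thesis by (simp add: mult_ac)
    qed
  qed (simp_all add: blinfun.add_right bdd_opsD[OF assms] fock_cinner_add_left fock_cinner_add_right
      fock_cinner_scale_left fock_cinner_scale_right)
  then obtain B where B: "B \<in> bdd_ops" "\<And>g f. fock_cinner (blinfun_apply B g) f = fock_cinner g (blinfun_apply A f)"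
    by blast
  have *: "fock_cinner (blinfun_apply A f) g = fock_cinner f (blinfun_apply B g)" for f g
    by (metis B(2) fock_cinner_commute)
  have "op_adj A = B" by (rule op_adj_eqI[OF *])
  then show "op_adj A \<in> bdd_ops"
    "fock_cinner (blinfun_apply A f) g = fock_cinner f (blinfun_apply (op_adj A) g)"
    using B(1) * by auto
qed

text \<open>The coefficients of A k_z at all k_w determine A k_z. The coefficient of the adjoint
  applied to g, taken at k_z, pairs g with A k_z, so the adjoint is determined, and with it A. This
  replaces density of the span of the kernels.\<close>

lemma bdd_ops_eqI:
  assumes "A \<in> bdd_ops" "B \<in> bdd_ops"
    and "\<And>z w. fock_cinner (blinfun_apply A (nkerf z)) (nkerf w) = fock_cinner (blinfun_apply B (nkerf z)) (nkerf w)"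
  shows "A = B"
proof -
  have inj: "f = g" if "\<And>z. nev f z = nev g z" for f g :: "'a fock"
    using that by (metis ext fock_fun_inject fock_fun_nev)
  have k: "blinfun_apply A (nkerf z) = blinfun_apply B (nkerf z)" for z
    by (rule inj) (simp add: nev_eq_cinner assms(3))
  have "blinfun_apply (op_adj A) g = blinfun_apply (op_adj B) g" for g
    by (rule inj) (metis k nev_eq_cinner fock_cinner_adj assms(1,2) fock_cinner_commute)
  then show ?thesis
    by (metis blinfun_eqI fock_cinner_eqI fock_cinner_adj assms(1,2))
qed

section \<open>Weyl operators acting on coherent states\<close>

lemma weyl_apply: "fock_fun (blinfun_apply (weyl z) f) w = nker z w * fock_fun f (w - z)"
  by (simp add: weyl.rep_eq weyl_fun.rep_eq)

lemma weyl_bdd: "weyl z \<in> bdd_ops"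
  unfolding bdd_ops_def
  by (auto simp: fock_fun_inject[symmetric] fun_eq_iff weyl_apply fock_scaleC.rep_eq)

lemma weyl_inverse: "blinfun_apply (weyl (- z)) (blinfun_apply (weyl z) f) = f"
proof -
  have "nker (- z) w * nker z (w + z) = 1" for w
  proof -
    have "complex_of_real (- (norm z)\<^sup>2 / 2) + - hdot w z + (complex_of_real (- (norm z)\<^sup>2 / 2) + hdot (w + z) z) = 0"
      by (simp add: hdot_simps hdot_self)
    then show ?thesis
      unfolding nker_def ker_def norm_minus_cancel hdot_minus_right exp_of_real[symmetric] exp_add[symmetric] by simp
  qed
  then show ?thesis
    by (auto simp: fock_fun_inject[symmetric] fun_eq_iff weyl_apply mult.assoc[symmetric])
qed

lemma norm_weyl: "norm (blinfun_apply (weyl z) f) = norm f"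
  unfolding norm_fock_eq weyl_apply using weyl_L2(2)[OF entire_fock_fun fock_fun_L2, of z f] by simp

lemma weyl_isometry: "fock_cinner (blinfun_apply (weyl z) f) (blinfun_apply (weyl z) g) = fock_cinner f g"
proof -
  let ?W = "blinfun_apply (weyl z)"
  have inner: "inner (?W f) (?W g) = inner f g" for f g
  proof -
    have "(norm (?W (f + g)))\<^sup>2 = (norm (f + g))\<^sup>2" by (simp only: norm_weyl)
    then show ?thesis
      using norm_weyl[of z f] norm_weyl[of z g]
      unfolding power2_norm_eq_inner blinfun.add_right
      by (simp add: inner_simps inner_commute norm_eq_sqrt_inner)
  qed
  show ?thesis
    using inner[of f g] inner[of f "fock_scaleC \<i> g"]
    by (simp add: complex_eq_iff Im_fock_cinner bdd_opsD[OF weyl_bdd]) (simp add: inner_fock_def)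
qed

lemma weyl_adj: "fock_cinner (blinfun_apply (weyl z) f) g = fock_cinner f (blinfun_apply (weyl (- z)) g)"
  using weyl_isometry[of "- z" "blinfun_apply (weyl z) f" g] by (simp add: weyl_inverse)

lemma op_adj_weyl: "op_adj (weyl z) = weyl (- z)"
  by (rule op_adj_eqI) (rule weyl_adj)

lemma weyl_conj_apply:
  "blinfun_apply (weyl_conj z A) f = blinfun_apply (weyl (- z)) (blinfun_apply A (blinfun_apply (weyl z) f))"
  by (simp add: weyl_conj_def op_adj_weyl)

text \<open>Coherent states are permuted up to a unimodular phase, so moduli of matrix entries are
  translation covariant; the phase itself matters again in \<open>weyl_nkerf_swap\<close>.\<close>

lemma weyl_nkerf:
  "blinfun_apply (weyl z) (nkerf u) = fock_scaleC (exp (- \<i> * of_real (Im (hdot z u)))) (nkerf (z + u))"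
proof -
  have "nker z w * nker u (w - z) = exp (- \<i> * of_real (Im (hdot z u))) * nker (z + u) w" for w
  proof -
    have "(norm (z + u))\<^sup>2 = (norm z)\<^sup>2 + (norm u)\<^sup>2 + 2 * Re (hdot z u)"
      by (simp add: Re_hdot power2_norm_eq_inner inner_simps inner_commute)
    then have "complex_of_real (- (norm z)\<^sup>2 / 2) + hdot w z + (complex_of_real (- (norm u)\<^sup>2 / 2) + hdot (w - z) u)
      = - \<i> * of_real (Im (hdot z u)) + (complex_of_real (- (norm (z + u))\<^sup>2 / 2) + hdot w (z + u))"
      by (simp add: hdot_simps complex_eq_iff field_simps)
    then show ?thesis
      unfolding nker_def ker_def exp_of_real[symmetric] exp_add[symmetric] by simp
  qed
  then show ?thesis
    by (auto simp: fock_fun_inject[symmetric] fun_eq_iff weyl_apply nkerf.rep_eq fock_scaleC.rep_eq)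
qed

lemma cmod_exp_phase: "cmod (exp (- \<i> * of_real x)) = 1"
  by (simp add: norm_exp_eq_Re)

lemma weyl_nkerf_0: "blinfun_apply (weyl z) (nkerf 0) = nkerf z"
  by (simp add: weyl_nkerf)

lemma cmod_nev_weyl: "cmod (nev (blinfun_apply (weyl (- z)) g) u) = cmod (nev g (z + u))"
proof -
  have "nev (blinfun_apply (weyl (- z)) g) u = fock_cinner g (blinfun_apply (weyl z) (nkerf u))"
    using weyl_adj[of "- z" g "nkerf u"] by (simp add: nev_eq_cinner)
  then show ?thesis
    by (simp add: weyl_nkerf fock_cinner_scale_right nev_eq_cinner norm_mult cmod_exp_phase del: exp_cnj)
qed

text \<open>The resolution of the identity inserted between A and f; passing to the adjoint keeps
  all integrals scalar.\<close>

lemma op_nev: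
  fixes A :: "'n::finite fock_op"
  assumes "A \<in> bdd_ops"
  shows "fock_cinner (blinfun_apply A f) g
      = (\<integral>z. nev f z * fock_cinner (blinfun_apply A (nkerf z)) g \<partial>lborel) / of_real (pi ^ CARD('n))"
    and "integrable lborel (\<lambda>z. nev f z * fock_cinner (blinfun_apply A (nkerf z)) g)"
proof -
  have *: "cnj (nev (blinfun_apply (op_adj A) g) z) = fock_cinner (blinfun_apply A (nkerf z)) g" for z
    unfolding nev_eq_cinner fock_cinner_adj[OF assms] by (rule fock_cinner_commute[symmetric])
  show "fock_cinner (blinfun_apply A f) g
      = (\<integral>z. nev f z * fock_cinner (blinfun_apply A (nkerf z)) g \<partial>lborel) / of_real (pi ^ CARD('n))"
    unfolding *[symmetric] unfolding fock_cinner_adj[OF assms] by (rule fock_cinner_nev)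
  show "integrable lborel (\<lambda>z. nev f z * fock_cinner (blinfun_apply A (nkerf z)) g)"
    unfolding *[symmetric] by (rule integrable_nev)
qed

section \<open>Off-diagonal decay characterises \<open>\<F>\<^sup>l\<close>\<close>

lemma cseq_eq: "cseq j = real j / (2 * (real j + 1))"
proof (induction j)
  case (Suc j)
  have eq: "1 - cseq j = (real j + 2) / (2 * (real j + 1))" unfolding Suc by (simp add: field_simps)
  show ?case unfolding cseq.simps eq by (simp add: field_simps)
qed simp

lemma cseq_less: "cseq j < 1/2"
  by (simp add: cseq_eq field_simps)

text \<open>Once a growth rate below 1/2 is reached, this supplies the index j2 >= j1 that
  membership in \<open>Fl\<close> asks for.\<close>

lemma cseq_ge_eventually:
  assumes "c < 1/2" obtains j where "j \<ge> i" "c \<le> cseq j"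
proof -
  have "(\<lambda>j. cseq j) \<longlonglongrightarrow> 1/2"
    unfolding cseq_eq by real_asymp
  then have "\<forall>\<^sub>F j in sequentially. c < cseq j" using assms by (rule order_tendstoD)
  then obtain N where "\<And>j. j \<ge> N \<Longrightarrow> c < cseq j" by (auto simp: eventually_sequentially)
  then show ?thesis using that[of "max i N"] by (simp add: less_imp_le)
qed

lemma Dnorm_leI:
  assumes "entire f" "\<And>z. cmod (f z) \<le> M * exp (c * (norm z)\<^sup>2)"
  shows "Dnorm c f \<le> ennreal M"
  unfolding Dnorm_def
proof (rule esssup_I)
  note [measurable] = entire_measurable[OF assms(1)]
  have "(\<lambda>z. ennreal (cmod (f z * of_real (exp (- c * (norm z)\<^sup>2))))) \<in> borel_measurable borel" by measurable
  then show "(\<lambda>z. ennreal (cmod (f z * of_real (exp (- c * (norm z)\<^sup>2))))) \<in> borel_measurable lebesgue"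
    by (rule borel_measurable_lebesgueI)
  have "cmod (f z) * exp (- (c * (norm z)\<^sup>2)) \<le> M" for z
    using mult_right_mono[OF assms(2)[of z], of "exp (- (c * (norm z)\<^sup>2))"]
    by (simp add: mult.assoc flip: exp_add)
  then show "AE z in lebesgue. ennreal (cmod (f z * of_real (exp (- c * (norm z)\<^sup>2)))) \<le> ennreal M"
    by (intro AE_I2 ennreal_leI) (simp add: norm_mult)
qed

text \<open>The set where the bound fails is open by continuity and null by the essential supremum,
  hence empty.\<close>

lemma Dnorm_leD:
  assumes "entire f" "Dnorm c f \<le> ennreal M" "M \<ge> 0"
  shows "cmod (f z) \<le> M * exp (c * (norm z)\<^sup>2)"
proof -
  let ?h = "\<lambda>z. cmod (f z * of_real (exp (- c * (norm z)\<^sup>2)))"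
  let ?U = "{z. ?h z > M}"
  have "AE z in lebesgue. ennreal (?h z) \<le> Dnorm c f"
    unfolding Dnorm_def by (rule esssup_AE)
  then have AE: "AE z in lebesgue. z \<notin> ?U"
  proof (rule AE_mp[OF _ AE_I2], intro impI)
    fix z assume "ennreal (?h z) \<le> Dnorm c f"
    then have "ennreal (?h z) \<le> ennreal M" using assms(2) by (rule order.trans)
    then show "z \<notin> ?U" using assms(3) by (simp add: not_less del: norm_mult)
  qed
  have "open ?U"
    using entire_continuous[OF assms(1)] by (intro open_Collect_less continuous_intros) auto
  moreover have "?U \<in> null_sets lebesgue"
  proof (subst AE_iff_null_sets)
    show "?U \<in> sets lebesgue"
      using \<open>open ?U\<close> by (intro sets_completionI_sets) simp
  qed (use AE in simp)
  ultimately have "z \<notin> ?U"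
    using open_not_negligible[of ?U] by (auto simp: negligible_iff_null_sets)
  then have "cmod (f z) * exp (- (c * (norm z)\<^sup>2)) \<le> M" by (simp add: norm_mult)
  then show ?thesis by (simp add: exp_minus field_simps)
qed

lemma Dspace_entire_iff: "entire f \<Longrightarrow> f \<in> Dspace c \<longleftrightarrow> Dnorm c f < \<infinity>"
  by (simp add: Dspace_def borel_measurable_lebesgueI entire_measurable)

section \<open>Equivalence of \<open>Fl\<close> with Gaussian off-diagonal decay\<close>

definition localized :: "real \<Rightarrow> real \<Rightarrow> ('n::finite) fock_op \<Rightarrow> bool" where
  "localized \<gamma> d A \<longleftrightarrow> A \<in> bdd_ops \<and> \<gamma> > 0 \<and>
     (\<forall>z w. cmod (nev (blinfun_apply A (nkerf z)) w) \<le> d * exp (- \<gamma> * (norm (w - z))\<^sup>2))"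

lemma localizedD:
  assumes "localized \<gamma> d A"
  shows "A \<in> bdd_ops" "\<gamma> > 0" "d \<ge> 0"
    "cmod (nev (blinfun_apply A (nkerf z)) w) \<le> d * exp (- \<gamma> * (norm (w - z))\<^sup>2)"
proof -
  have "0 \<le> cmod (nev (blinfun_apply A (nkerf 0)) 0)" by simp
  also have "\<dots> \<le> d * exp (- \<gamma> * (norm (0 - 0 :: complex^'a))\<^sup>2)"
    using assms unfolding localized_def by blast
  finally show "d \<ge> 0" by simp
qed (use assms in \<open>auto simp: localized_def\<close>)

lemma nker_0: "nker 0 w = 1"
  by (simp add: nker_def ker_def)

text \<open>Only h = k_0 = 1 is tested, over all z: since W_z k_0 = k_z, the entry of A at (z, w)
  has the modulus of the normalized value of A_z 1 at w - z. The normalization turns growth c_j into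
  decay 1/2 - c_j.\<close>

lemma Fl_imp_localized:
  assumes "A \<in> Fl" shows "\<exists>\<gamma> d. localized \<gamma> d A"
proof -
  have A: "A \<in> bdd_ops" using assms by (simp add: Fl_def)
  have one: "Dnorm (cseq 0) (fock_fun (nkerf (0 :: complex^'a))) \<le> ennreal 1"
    by (rule Dnorm_leI[OF entire_fock_fun]) (simp add: nkerf.rep_eq nker_0)
  then have "nkerf (0 :: complex^'a) \<in> Hspace (cseq 0)"
    using order.strict_trans1[OF one ennreal_less_top]
    by (simp add: Hspace_def Dspace_entire_iff entire_fock_fun)
  moreover obtain j d where "d > 0" and d: "\<forall>h\<in>Hspace (cseq 0). \<forall>z. Dnorm (cseq j) (fock_fun (blinfun_apply (weyl_conj z A) h))
          \<le> ennreal d * Dnorm (cseq 0) (fock_fun h)"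
    using assms unfolding Fl_def by blast
  ultimately have "Dnorm (cseq j) (fock_fun (blinfun_apply (weyl_conj z A) (nkerf 0))) \<le> ennreal d" for z
    using order.trans[OF _ mult_left_mono[OF one, of "ennreal d"]] by (simp only: ennreal_1 mult_1_right zero_le)
  then have b: "cmod (fock_fun (blinfun_apply (weyl_conj z A) (nkerf 0)) u) \<le> d * exp (cseq j * (norm u)\<^sup>2)" for z u
    using \<open>d > 0\<close> by (intro Dnorm_leD entire_fock_fun) auto
  have "cmod (nev (blinfun_apply A (nkerf z)) w) \<le> d * exp (- (1/2 - cseq j) * (norm (w - z))\<^sup>2)" for z w
  proof -
    have "cmod (nev (blinfun_apply A (nkerf z)) w) = cmod (nev (blinfun_apply (weyl_conj z A) (nkerf 0)) (w - z))"
      by (simp add: weyl_conj_apply cmod_nev_weyl weyl_nkerf_0)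
    also have "\<dots> \<le> exp (- (norm (w - z))\<^sup>2 / 2) * (d * exp (cseq j * (norm (w - z))\<^sup>2))"
      unfolding nev_def norm_mult by (intro mult_mono b) auto
    also have "\<dots> = d * exp (- (1/2 - cseq j) * (norm (w - z))\<^sup>2)"
      by (simp add: algebra_simps flip: exp_add)
    finally show ?thesis .
  qed
  then have "localized (1/2 - cseq j) d A"
    using A cseq_less[of j] by (simp add: localized_def)
  then show ?thesis by blast
qed

text \<open>The constants do not change with z, which gives the uniformity in z demanded by
  \<open>Fl\<close>.\<close>

lemma localized_weyl_conj:
  assumes "localized \<gamma> d A" shows "localized \<gamma> d (weyl_conj z A)"
proof -
  note A = localizedD[OF assms]
  have "weyl_conj z A \<in> bdd_ops"
    by (simp add: bdd_ops_def weyl_conj_apply bdd_opsD[OF weyl_bdd] bdd_opsD[OF A(1)])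
  moreover have "cmod (nev (blinfun_apply (weyl_conj z A) (nkerf u)) w) \<le> d * exp (- \<gamma> * (norm (w - u))\<^sup>2)" for u w
    using A(4)[of "z + u" "z + w"]
    by (simp only: weyl_conj_apply cmod_nev_weyl weyl_nkerf bdd_opsD[OF A(1)])
       (simp only: nev_eq_cinner fock_cinner_scale_left norm_mult cmod_exp_phase, simp)
  ultimately show ?thesis using A(2) by (simp add: localized_def)
qed

text \<open>For c > 0 this is 1 / c^n; the type argument carries the dimension n.\<close>

definition Gint :: "'n::finite itself \<Rightarrow> real \<Rightarrow> real" where
  "Gint _ c = (\<integral>(z::complex^'n). exp (- c * (norm z)\<^sup>2) \<partial>lborel) / pi ^ CARD('n)"

lemma Gint_nonneg: "Gint TYPE('n::finite) c \<ge> 0"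
  unfolding Gint_def by (intro divide_nonneg_nonneg integral_nonneg_AE) auto

lemma norm_integral_gaussian_le:
  fixes F :: "complex^'n::finite \<Rightarrow> complex"
  assumes "integrable lborel F" "c > 0" "\<And>u. cmod (F u) \<le> K * exp (- c * (norm (u - z))\<^sup>2)"
  shows "cmod ((\<integral>u. F u \<partial>lborel) / of_real (pi ^ CARD('n))) \<le> K * Gint TYPE('n) c"
proof -
  have sh: "(\<integral>u. exp (- c * (norm (u - z))\<^sup>2) \<partial>lborel) = (\<integral>(u::complex^'n). exp (- c * (norm u)\<^sup>2) \<partial>lborel)"
    "integrable lborel (\<lambda>u. exp (- c * (norm (u - z))\<^sup>2))"
    using integral_lborel_shift[of "\<lambda>u. exp (- c * (norm u)\<^sup>2)" "- z"] integrable_gaussian[OF assms(2), where 'n='n]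
    by simp_all
  have "cmod (\<integral>u. F u \<partial>lborel) \<le> (\<integral>u. K * exp (- c * (norm (u - z))\<^sup>2) \<partial>lborel)"
    by (intro Bochner_Integration.integral_norm_bound_integral assms integrable_mult_right sh)
  also have "\<dots> = K * (\<integral>(u::complex^'n). exp (- c * (norm u)\<^sup>2) \<partial>lborel)"
    unfolding sh(1)[symmetric] by simp
  finally show ?thesis
    by (simp add: Gint_def norm_divide norm_power divide_right_mono)
qed

lemma norm_diff_square_le: "(norm (a - c))\<^sup>2 \<le> 2 * (norm (a - b))\<^sup>2 + 2 * (norm (b - c))\<^sup>2"
  for a b c :: "'a::real_inner"
proof -
  have "(norm (a - c))\<^sup>2 \<le> (norm (a - b) + norm (b - c))\<^sup>2"
    using norm_triangle_ineq[of "a - b" "b - c"] by (intro power_mono) auto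
  also have "\<dots> \<le> 2 * (norm (a - b))\<^sup>2 + 2 * (norm (b - c))\<^sup>2"
    using sum_squares_bound[of "norm (a - b)" "norm (b - c)"] by (simp add: power2_sum)
  finally show ?thesis .
qed

text \<open>A crude bound that spares the exact convolution of two Gaussians.\<close>

lemma gaussian_product_le:
  fixes a b c :: "'a::real_inner"
  assumes "\<alpha> > 0" "\<beta> > 0"
  defines "m \<equiv> min \<alpha> \<beta>"
  shows "exp (- \<alpha> * (norm (b - a))\<^sup>2) * exp (- \<beta> * (norm (c - b))\<^sup>2)
    \<le> exp (- (\<alpha>/2) * (norm (b - a))\<^sup>2) * exp (- (m/4) * (norm (c - a))\<^sup>2)"
proof -
  have "m * (norm (c - a))\<^sup>2 \<le> m * (2 * (norm (c - b))\<^sup>2 + 2 * (norm (b - a))\<^sup>2)"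
    using assms by (intro mult_left_mono norm_diff_square_le) (auto simp: m_def)
  also have "\<dots> = 2 * (m * (norm (c - b))\<^sup>2) + 2 * (m * (norm (b - a))\<^sup>2)" by (simp add: algebra_simps)
  also have "m * (norm (c - b))\<^sup>2 \<le> 2 * (\<beta> * (norm (c - b))\<^sup>2)"
  proof -
    have "m \<le> 2 * \<beta>" using assms by (auto simp: m_def min_def)
    from mult_right_mono[OF this, of "(norm (c - b))\<^sup>2"] show ?thesis by (simp add: mult.assoc)
  qed
  also have "m * (norm (b - a))\<^sup>2 \<le> \<alpha> * (norm (b - a))\<^sup>2"
    by (intro mult_right_mono) (auto simp: m_def)
  finally have "(m/4) * (norm (c - a))\<^sup>2 \<le> \<beta> * (norm (c - b))\<^sup>2 + (\<alpha>/2) * (norm (b - a))\<^sup>2" by simp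
  then show ?thesis by (simp flip: exp_add)
qed

text \<open>In the expansion of A f over k_u, the coefficient of f decays with rate 1/2 - c and the
  matrix of A with rate \<gamma>. \<open>gaussian_product_le\<close> spends half of the first rate
  on integrability in u and keeps rate m/4 in w, so the growth stays strictly below 1/2.\<close>

lemma localized_growth:
  fixes A :: "'n::finite fock_op"
  assumes "localized \<gamma> d A" "c < 1/2" and f: "\<And>z. cmod (fock_fun f z) \<le> M * exp (c * (norm z)\<^sup>2)"
  defines "m \<equiv> min (1/2 - c) \<gamma>"
  shows "cmod (fock_fun (blinfun_apply A f) w) \<le> d * Gint TYPE('n) ((1/2 - c)/2) * M * exp ((1/2 - m/4) * (norm w)\<^sup>2)"
proof -
  note A = localizedD[OF assms(1)]
  have M: "M \<ge> 0" using order.trans[OF norm_ge_zero f[of 0]] by simp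
  have nf: "cmod (nev f z) \<le> M * exp (- (1/2 - c) * (norm z)\<^sup>2)" for z
  proof -
    have "cmod (nev f z) \<le> exp (- (norm z)\<^sup>2 / 2) * (M * exp (c * (norm z)\<^sup>2))"
      unfolding nev_def norm_mult by (intro mult_mono f) auto
    also have "\<dots> = M * exp (- (1/2 - c) * (norm z)\<^sup>2)" by (simp add: algebra_simps flip: exp_add)
    finally show ?thesis .
  qed
  have "cmod (nev (blinfun_apply A f) w) \<le>
      (M * d * exp (- (m/4) * (norm w)\<^sup>2)) * Gint TYPE('n) ((1/2 - c)/2)"
    unfolding nev_eq_cinner[of "blinfun_apply A f"] op_nev(1)[OF A(1), of f "nkerf w"]
  proof (rule norm_integral_gaussian_le[OF op_nev(2)[OF A(1)]])
    fix u
    have "cmod (nev f u * fock_cinner (blinfun_apply A (nkerf u)) (nkerf w))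
      \<le> (M * exp (- (1/2 - c) * (norm u)\<^sup>2)) * (d * exp (- \<gamma> * (norm (w - u))\<^sup>2))"
      unfolding norm_mult nev_eq_cinner[symmetric]
      using M by (intro mult_mono nf A(4)) auto
    also have "\<dots> = M * d * (exp (- (1/2 - c) * (norm (u - 0))\<^sup>2) * exp (- \<gamma> * (norm (w - u))\<^sup>2))" by simp
    also have "\<dots> \<le> M * d * (exp (- ((1/2 - c)/2) * (norm (u - 0))\<^sup>2) * exp (- (m/4) * (norm (w - 0))\<^sup>2))"
      unfolding m_def using assms(2) A(2,3) M by (intro mult_left_mono gaussian_product_le) auto
    finally show "cmod (nev f u * fock_cinner (blinfun_apply A (nkerf u)) (nkerf w))
      \<le> M * d * exp (- (m/4) * (norm w)\<^sup>2) * exp (- ((1/2 - c)/2) * (norm (u - 0))\<^sup>2)" by (simp add: mult_ac)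
  qed (use assms(2) in simp)
  then have "exp ((norm w)\<^sup>2 / 2) * cmod (nev (blinfun_apply A f) w) \<le> exp ((norm w)\<^sup>2 / 2) *
      ((M * d * exp (- (m/4) * (norm w)\<^sup>2)) * Gint TYPE('n) ((1/2 - c)/2))"
    by (rule mult_left_mono) simp
  also have "\<dots> = d * Gint TYPE('n) ((1/2 - c)/2) * M * (exp ((norm w)\<^sup>2 / 2) * exp (- (m/4) * (norm w)\<^sup>2))"
    by (simp only: mult_ac)
  also have "exp ((norm w)\<^sup>2 / 2) * exp (- (m/4) * (norm w)\<^sup>2) = exp ((1/2 - m/4) * (norm w)\<^sup>2)"
    by (simp add: algebra_simps flip: exp_add)
  finally show ?thesis by (simp only: fock_fun_nev norm_mult norm_of_real abs_exp_cancel)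
qed

lemma localized_imp_Fl:
  fixes A :: "'n::finite fock_op"
  assumes "localized \<gamma> d A" shows "A \<in> Fl"
proof -
  note A = localizedD[OF assms]
  \<comment> \<open>Quantifying over all B with the same constants treats A and all its Weyl
    conjugates at once.\<close>
  have *: "\<exists>j2\<ge>j1. \<exists>K>0. \<forall>h\<in>(Hspace (cseq j1) :: 'n fock set). \<forall>B. localized \<gamma> d B \<longrightarrow>
      Dnorm (cseq j2) (fock_fun (blinfun_apply B h)) \<le> ennreal K * Dnorm (cseq j1) (fock_fun h)" for j1
  proof -
    define m where "m = min (1/2 - cseq j1) \<gamma>"
    have "m > 0" using cseq_less[of j1] A(2) by (simp add: m_def)
    then obtain j2 where j2: "j2 \<ge> j1" "1/2 - m/4 \<le> cseq j2"
      using cseq_ge_eventually[of "1/2 - m/4" j1] by auto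
    define K where "K = d * Gint TYPE('n) ((1/2 - cseq j1)/2)"
    have K: "K \<ge> 0" unfolding K_def by (intro mult_nonneg_nonneg A Gint_nonneg)
    \<comment> \<open>\<open>Fl\<close> asks for a strictly positive constant and \<open>K\<close>
      may be 0, hence \<open>K + 1\<close>.\<close>
    have "Dnorm (cseq j2) (fock_fun (blinfun_apply B h)) \<le> ennreal (K + 1) * Dnorm (cseq j1) (fock_fun h)"
      if h: "h \<in> (Hspace (cseq j1) :: 'n fock set)" and B: "localized \<gamma> d B" for h B
    proof -
      define M where "M = enn2real (Dnorm (cseq j1) (fock_fun h))"
      have M: "Dnorm (cseq j1) (fock_fun h) = ennreal M" "M \<ge> 0"
        using h by (auto simp: M_def Hspace_def Dspace_def)
      have hb: "cmod (fock_fun h z) \<le> M * exp (cseq j1 * (norm z)\<^sup>2)" for z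
        by (intro Dnorm_leD entire_fock_fun M(2)) (simp add: M(1))
      have "Dnorm (cseq j2) (fock_fun (blinfun_apply B h)) \<le> ennreal ((K + 1) * M)"
      proof (rule Dnorm_leI[OF entire_fock_fun])
        fix w
        have "cmod (fock_fun (blinfun_apply B h) w) \<le> K * M * exp ((1/2 - m/4) * (norm w)\<^sup>2)"
          unfolding K_def m_def by (rule localized_growth[OF B cseq_less[of j1] hb])
        also have "\<dots> \<le> (K + 1) * M * exp (cseq j2 * (norm w)\<^sup>2)"
          using K M j2(2) by (intro mult_mono) (auto intro!: mult_right_mono)
        finally show "cmod (fock_fun (blinfun_apply B h) w) \<le> (K + 1) * M * exp (cseq j2 * (norm w)\<^sup>2)" .
      qed
      then show ?thesis using M K by (simp add: ennreal_mult)
    qed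
    then show ?thesis using j2(1) K by (intro exI[of _ j2] conjI exI[of _ "K + 1"]) auto
  qed
  have "blinfun_apply A h \<in> Hunion" if h: "h \<in> Hunion" for h
  proof -
    obtain j1 where j1: "h \<in> Hspace (cseq j1)" using h by (auto simp: Hunion_def)
    obtain j2 K where "Dnorm (cseq j2) (fock_fun (blinfun_apply A h)) \<le> ennreal K * Dnorm (cseq j1) (fock_fun h)"
      using *[of j1] j1 assms by blast
    also have "\<dots> < \<infinity>" using j1 by (auto simp: Hspace_def Dspace_def ennreal_mult_less_top)
    finally show ?thesis by (auto simp: Hunion_def Hspace_def Dspace_entire_iff entire_fock_fun)
  qed
  moreover have "\<exists>j2\<ge>j1. \<exists>K>0. \<forall>h\<in>Hspace (cseq j1). \<forall>z.
        Dnorm (cseq j2) (fock_fun (blinfun_apply (weyl_conj z A) h)) \<le> ennreal K * Dnorm (cseq j1) (fock_fun h)" for j1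
  proof -
    obtain j2 K where "j2 \<ge> j1" "K > 0" and b: "\<And>(h :: 'n fock) B. h \<in> Hspace (cseq j1) \<Longrightarrow> localized \<gamma> d B \<Longrightarrow>
      Dnorm (cseq j2) (fock_fun (blinfun_apply B h)) \<le> ennreal K * Dnorm (cseq j1) (fock_fun h)"
      using *[of j1] by blast
    then show ?thesis
      by (intro exI[of _ j2] conjI exI[of _ K] ballI allI b localized_weyl_conj[OF assms])
  qed
  ultimately show ?thesis using A(1) unfolding Fl_def by blast
qed

lemma Fl_iff_localized: "A \<in> Fl \<longleftrightarrow> (\<exists>\<gamma> d. localized \<gamma> d A)"
  using Fl_imp_localized localized_imp_Fl by blast

section \<open>Sums, adjoints, products and norm limits of localized operators\<close>

lemma localized_weaken:
  assumes "localized \<gamma> d A" "0 < \<gamma>'" "\<gamma>' \<le> \<gamma>" shows "localized \<gamma>' d A"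
proof -
  have "d * exp (- \<gamma> * (norm (w - z))\<^sup>2) \<le> d * exp (- \<gamma>' * (norm (w - z))\<^sup>2)" for w z :: "complex^'a"
    using localizedD(3)[OF assms(1)] assms(3) by (intro mult_left_mono) (auto intro!: mult_right_mono)
  then have "cmod (nev (blinfun_apply A (nkerf z)) w) \<le> d * exp (- \<gamma>' * (norm (w - z))\<^sup>2)" for z w
    using localizedD(4)[OF assms(1), of z w] by (rule order.trans[rotated])
  then show ?thesis using localizedD(1)[OF assms(1)] assms(2) unfolding localized_def by blast
qed

lemma bdd_ops_algebra:
  assumes "A \<in> bdd_ops" "B \<in> bdd_ops"
  shows "A + B \<in> bdd_ops" "A o\<^sub>L B \<in> bdd_ops" "op_scaleC c A \<in> bdd_ops"
  using assms by (auto simp: bdd_ops_def blinfun.add_left fock_scaleC_add mult.commute)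

lemma Fl_add:
  assumes "A \<in> Fl" "B \<in> Fl" shows "A + B \<in> Fl"
proof -
  obtain \<gamma> d \<gamma>' d' where A0: "localized \<gamma> d A" and B0: "localized \<gamma>' d' B"
    using assms unfolding Fl_iff_localized by blast
  have A: "localized (min \<gamma> \<gamma>') d A" and B: "localized (min \<gamma> \<gamma>') d' B"
    using localizedD(2)[OF A0] localizedD(2)[OF B0]
    by (auto intro: localized_weaken[OF A0] localized_weaken[OF B0])
  have "localized (min \<gamma> \<gamma>') (d + d') (A + B)"
    unfolding localized_def
  proof (intro conjI allI)
    fix z w
    have "cmod (nev (blinfun_apply (A + B) (nkerf z)) w)
      \<le> cmod (nev (blinfun_apply A (nkerf z)) w) + cmod (nev (blinfun_apply B (nkerf z)) w)"
      by (simp add: blinfun.add_left nev_eq_cinner fock_cinner_add_left norm_triangle_ineq)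
    then show "cmod (nev (blinfun_apply (A + B) (nkerf z)) w) \<le> (d + d') * exp (- min \<gamma> \<gamma>' * (norm (w - z))\<^sup>2)"
      using localizedD(4)[OF A, of z w] localizedD(4)[OF B, of z w] by (simp add: distrib_right)
  qed (use localizedD[OF A] localizedD[OF B] in \<open>auto intro: bdd_ops_algebra\<close>)
  then show ?thesis unfolding Fl_iff_localized by blast
qed

lemma Fl_scale:
  assumes "A \<in> Fl" shows "op_scaleC c A \<in> Fl"
proof -
  obtain \<gamma> d where A: "localized \<gamma> d A" using assms unfolding Fl_iff_localized by blast
  have "localized \<gamma> (cmod c * d) (op_scaleC c A)"
    using localizedD[OF A] unfolding localized_def
    by (auto simp: bdd_ops_algebra nev_eq_cinner fock_cinner_scale_left norm_mult mult.assoc intro!: mult_left_mono)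
  then show ?thesis unfolding Fl_iff_localized by blast
qed

lemma Fl_adj:
  assumes "A \<in> Fl" shows "op_adj A \<in> Fl"
proof -
  obtain \<gamma> d where A: "localized \<gamma> d A" using assms unfolding Fl_iff_localized by blast
  note L = localizedD[OF A]
  have "cmod (nev (blinfun_apply (op_adj A) (nkerf z)) w) = cmod (nev (blinfun_apply A (nkerf w)) z)" for z w
    unfolding nev_eq_cinner fock_cinner_adj[OF L(1)]
    by (subst fock_cinner_commute) simp
  then have "cmod (nev (blinfun_apply (op_adj A) (nkerf z)) w) \<le> d * exp (- \<gamma> * (norm (w - z))\<^sup>2)" for z w
    using L(4)[of w z] by (simp add: norm_minus_commute)
  then have "localized \<gamma> d (op_adj A)"
    using L(2) op_adj_bdd[OF L(1)] unfolding localized_def by blast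
  then show ?thesis unfolding Fl_iff_localized by blast
qed

text \<open>The resolution of the identity writes the matrix of the product as an integral of
  entries of B times entries of A; the product of the two Gaussian bounds still decays in w - z, at
  a smaller rate.\<close>

lemma Fl_compose:
  fixes A B :: "'n::finite fock_op"
  assumes "A \<in> Fl" "B \<in> Fl" shows "A o\<^sub>L B \<in> Fl"
proof -
  obtain \<gamma> d \<gamma>' d' where A: "localized \<gamma> d A" and B: "localized \<gamma>' d' B"
    using assms unfolding Fl_iff_localized by blast
  note a = localizedD[OF A] and b = localizedD[OF B]
  define m where "m = min \<gamma>' \<gamma>"
  have "cmod (nev (blinfun_apply (A o\<^sub>L B) (nkerf z)) w) \<le> d' * d * Gint TYPE('n) (\<gamma>'/2) * exp (- (m/4) * (norm (w - z))\<^sup>2)" for z w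
  proof -
    have "cmod (nev (blinfun_apply (A o\<^sub>L B) (nkerf z)) w)
       \<le> (d' * d * exp (- (m/4) * (norm (w - z))\<^sup>2)) * Gint TYPE('n) (\<gamma>'/2)"
      unfolding nev_eq_cinner[of "blinfun_apply A (blinfun_apply B (nkerf z))"] blinfun_apply_blinfun_compose op_nev(1)[OF a(1), of "blinfun_apply B (nkerf z)"]
    proof (rule norm_integral_gaussian_le[OF op_nev(2)[OF a(1)]])
      fix u
      have "cmod (nev (blinfun_apply B (nkerf z)) u * fock_cinner (blinfun_apply A (nkerf u)) (nkerf w))
        \<le> (d' * exp (- \<gamma>' * (norm (u - z))\<^sup>2)) * (d * exp (- \<gamma> * (norm (w - u))\<^sup>2))"
        unfolding norm_mult nev_eq_cinner[of "blinfun_apply A (nkerf u)", symmetric]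
        using b(3) by (intro mult_mono a(4) b(4)) auto
      also have "\<dots> = d' * d * (exp (- \<gamma>' * (norm (u - z))\<^sup>2) * exp (- \<gamma> * (norm (w - u))\<^sup>2))" by simp
      also have "\<dots> \<le> d' * d * (exp (- (\<gamma>'/2) * (norm (u - z))\<^sup>2) * exp (- (m/4) * (norm (w - z))\<^sup>2))"
        unfolding m_def using a(2,3) b(2,3) by (intro mult_left_mono gaussian_product_le) auto
      finally show "cmod (nev (blinfun_apply B (nkerf z)) u * fock_cinner (blinfun_apply A (nkerf u)) (nkerf w))
        \<le> d' * d * exp (- (m/4) * (norm (w - z))\<^sup>2) * exp (- (\<gamma>'/2) * (norm (u - z))\<^sup>2)" by (simp add: mult_ac)
    qed (use b(2) in simp)
    then show ?thesis by (simp add: mult_ac)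
  qed
  moreover have "m / 4 > 0" using a(2) b(2) by (simp add: m_def)
  ultimately have "localized (m/4) (d' * d * Gint TYPE('n) (\<gamma>'/2)) (A o\<^sub>L B)"
    unfolding localized_def using bdd_ops_algebra(2)[OF a(1) b(1)] by blast
  then show ?thesis unfolding Fl_iff_localized by blast
qed

lemma zero_Fl: "0 \<in> Fl"
proof -
  have "localized 1 0 0" by (simp add: localized_def bdd_ops_def nev_eq_cinner) (transfer, simp)
  then show ?thesis unfolding Fl_iff_localized by blast
qed

text \<open>Gives norm continuity of the adjoint, used to pass to the closure. If h is the
  difference of the adjoints at g, then |h|^2 is the pairing of (A - B) h with g.\<close>

lemma norm_op_adj_diff_le:
  assumes "A \<in> bdd_ops" "B \<in> bdd_ops"
  shows "norm (op_adj A - op_adj B) \<le> norm (A - B)"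
proof (rule norm_blinfun_bound)
  fix g
  let ?h = "blinfun_apply (op_adj A - op_adj B) g"
  have "of_real ((norm ?h)\<^sup>2) = fock_cinner (blinfun_apply (A - B) ?h) g"
    unfolding fock_cinner_self[symmetric]
    by (simp add: blinfun.diff_left fock_cinner_diff_left fock_cinner_diff_right fock_cinner_adj assms)
  then have "(norm ?h)\<^sup>2 = cmod (fock_cinner (blinfun_apply (A - B) ?h) g)"
    by (metis norm_of_real abs_power2 power2_abs)
  also have "\<dots> \<le> norm (blinfun_apply (A - B) ?h) * norm g" by (rule cmod_fock_cinner_le)
  also have "\<dots> \<le> (norm (A - B) * norm ?h) * norm g" by (intro mult_right_mono norm_blinfun) simp
  finally show "norm ?h \<le> norm (A - B) * norm g"
    by (cases "norm ?h = 0") (auto simp: power2_eq_square mult_ac)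
qed simp

lemma closed_bdd_ops: "closed bdd_ops"
  unfolding bdd_ops_def
  by (intro closed_Collect_all closed_Collect_eq continuous_intros
      bounded_linear.continuous_on[OF bounded_linear_fock_scaleC])

lemma Fl_subset_bdd: "Fl \<subseteq> bdd_ops"
  by (auto simp: Fl_def)

lemma cstar_closure_Fl: "cstar_subalgebra (closure (Fl :: ('n::finite) fock_op set))"
proof -
  let ?F = "Fl :: 'n fock_op set"
  have sub: "closure ?F \<subseteq> bdd_ops" by (rule closure_minimal[OF Fl_subset_bdd closed_bdd_ops])
  have cl: "L \<in> closure ?F" if "\<And>k. Z k \<in> ?F" "Z \<longlonglongrightarrow> L" for Z L
    using that unfolding closure_sequential by blast
  have "A + B \<in> closure ?F \<and> A o\<^sub>L B \<in> closure ?F" if A: "A \<in> closure ?F" and B: "B \<in> closure ?F" for A B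
  proof -
    obtain X Y where X: "\<And>k. X k \<in> ?F" "X \<longlonglongrightarrow> A" and Y: "\<And>k. Y k \<in> ?F" "Y \<longlonglongrightarrow> B"
      using A B unfolding closure_sequential by blast
    have "(\<lambda>k. X k + Y k) \<longlonglongrightarrow> A + B" by (intro tendsto_add X Y)
    moreover have "(\<lambda>k. X k o\<^sub>L Y k) \<longlonglongrightarrow> (A o\<^sub>L B)"
      by (rule bounded_bilinear.tendsto[OF bounded_bilinear_blinfun_compose X(2) Y(2)])
    ultimately show ?thesis
      by (intro conjI cl[of "\<lambda>k. X k + Y k"] cl[of "\<lambda>k. X k o\<^sub>L Y k"] Fl_add Fl_compose X(1) Y(1))
  qed
  moreover have "op_scaleC c A \<in> closure ?F \<and> op_adj A \<in> closure ?F" if A: "A \<in> closure ?F" for A c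
  proof -
    obtain X where X: "\<And>k. X k \<in> ?F" "X \<longlonglongrightarrow> A"
      using A unfolding closure_sequential by blast
    have "(\<lambda>k. op_scaleC c (X k)) \<longlonglongrightarrow> op_scaleC c A"
      unfolding op_scaleC_def by (rule bounded_bilinear.tendsto[OF bounded_bilinear_blinfun_compose tendsto_const X(2)])
    moreover have "(\<lambda>k. op_adj (X k)) \<longlonglongrightarrow> op_adj A"
    proof (rule LIM_zero_cancel, rule Lim_null_comparison)
      show "\<forall>\<^sub>F k in sequentially. norm (op_adj (X k) - op_adj A) \<le> norm (X k - A)"
        using X(1) Fl_subset_bdd sub A by (intro always_eventually allI norm_op_adj_diff_le) auto
      show "(\<lambda>k. norm (X k - A)) \<longlonglongrightarrow> 0"
        using tendsto_norm[OF LIM_zero[OF X(2)]] by simp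
    qed
    ultimately show ?thesis
      by (intro conjI cl[of "\<lambda>k. op_scaleC c (X k)"] cl[of "\<lambda>k. op_adj (X k)"] Fl_scale Fl_adj X(1))
  qed
  ultimately show ?thesis
    unfolding cstar_subalgebra_def using sub closure_subset[of ?F] zero_Fl by auto
qed

section \<open>Toeplitz operators with Carleson symbols\<close>

text \<open>Symbols are only Lebesgue measurable, so the substitution behind \<open>heat\<close> and
  \<open>BMO\<close> is made for the completed measure.\<close>

lemma
  fixes z :: "'a::euclidean_space"
  shows lebesgue_reflect_measurable: "(\<lambda>w. z - w) \<in> lebesgue \<rightarrow>\<^sub>M lebesgue"
    and lebesgue_distr_reflect: "distr lebesgue lebesgue (\<lambda>w. z - w) = lebesgue"
proof -
  have T: "(\<lambda>x. z + (\<Sum>j\<in>Basis. (- 1 * (x \<bullet> j)) *\<^sub>R j)) = (\<lambda>w. z - w)"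
    by (simp add: sum_negf euclidean_representation)
  show "(\<lambda>w. z - w) \<in> lebesgue \<rightarrow>\<^sub>M lebesgue"
    using lebesgue_affine_measurable[of "\<lambda>_::'a. - 1" z] unfolding T by simp
  show "distr lebesgue lebesgue (\<lambda>w. z - w) = lebesgue"
    using lebesgue_affine_euclidean[of "\<lambda>_::'a. - 1" z] unfolding T by (simp add: density_1)
qed

lemma integral_gauss_lebesgue:
  fixes h :: "complex^'n::finite \<Rightarrow> 'b::{banach, second_countable_topology}"
  assumes "h \<in> borel_measurable lebesgue"
  shows "integral\<^sup>L (gauss 1) h = integral\<^sup>L lebesgue (\<lambda>z. gdens 1 z *\<^sub>R h z)"
  unfolding gauss_def
  by (rule integral_density; use assms gauss_weight_measurable'[of 1] in simp)

text \<open>The weight is the squared modulus of \<open>nev (nkerf z) u\<close>, so this bounds pi^n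
  times the Berezin transform of |f|: it says that |f| dV is a Carleson measure for the Fock
  space.\<close>

definition carleson :: "real \<Rightarrow> (complex^'n::finite \<Rightarrow> complex) \<Rightarrow> bool" where
  "carleson C f \<longleftrightarrow> f \<in> borel_measurable lebesgue \<and> C \<ge> 0 \<and>
     (\<forall>z. (\<integral>\<^sup>+u. ennreal (cmod (f u) * exp (- (norm (u - z))\<^sup>2)) \<partial>lebesgue) \<le> ennreal C)"

text \<open>The submean inequality for |nev h|^2 is followed by an exchange of integrals, after
  which the inner one is the Carleson quantity. The factor (2 / pi)^n of the submean inequality and
  pi^n from the norm combine to 2^n.\<close>

lemma carleson_embedding:
  fixes f :: "complex^'n::finite \<Rightarrow> complex"
  assumes "carleson C f"
  shows "(\<integral>\<^sup>+u. ennreal (cmod (f u) * (cmod (nev h u))\<^sup>2) \<partial>lebesgue) \<le> ennreal (C * 2 ^ CARD('n) * (norm h)\<^sup>2)"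
proof -
  have C: "C \<ge> 0" and f: "f \<in> borel_measurable lebesgue" using assms by (auto simp: carleson_def)
  \<comment> \<open>The exchange of integrals is made for Borel functions, so |f| is replaced by a
    Borel function that agrees with it almost everywhere.\<close>
  have "(\<lambda>u. ennreal (cmod (f u))) \<in> borel_measurable lebesgue" using f by measurable
  from completion_ex_borel_measurable[OF this] obtain F where
    F': "F \<in> borel_measurable lborel" and AE: "AE u in lborel. ennreal (cmod (f u)) = F u" by blast
  have F[measurable]: "F \<in> borel_measurable borel" using F' by simp
  have conv: "(\<integral>\<^sup>+u. ennreal (cmod (f u) * k u) \<partial>lebesgue) = (\<integral>\<^sup>+u. F u * ennreal (k u) \<partial>lborel)"
    if "\<And>u. k u \<ge> 0" for k
    unfolding nn_integral_completion
    by (rule nn_integral_cong_AE, rule AE_mp[OF AE]) (use that in \<open>auto simp: ennreal_mult\<close>)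
  let ?K = "ennreal ((2 / pi) ^ CARD('n))"
  have "(\<integral>\<^sup>+u. ennreal (cmod (f u) * (cmod (nev h u))\<^sup>2) \<partial>lebesgue) = (\<integral>\<^sup>+u. F u * ennreal ((cmod (nev h u))\<^sup>2) \<partial>lborel)"
    by (rule conv) simp
  also have "\<dots> \<le> (\<integral>\<^sup>+u. F u * (?K * (\<integral>\<^sup>+v. ennreal ((cmod (nev h v))\<^sup>2 * exp (- (norm (v - u))\<^sup>2)) \<partial>lborel)) \<partial>lborel)"
    by (intro nn_integral_mono mult_left_mono nev_square_submean) auto
  also have "\<dots> = (\<integral>\<^sup>+u. (\<integral>\<^sup>+v. ?K * (F u * ennreal ((cmod (nev h v))\<^sup>2 * exp (- (norm (v - u))\<^sup>2))) \<partial>lborel) \<partial>lborel)"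
    by (simp add: nn_integral_cmult mult_ac)
  also have "\<dots> = (\<integral>\<^sup>+v. (\<integral>\<^sup>+u. ?K * (F u * ennreal ((cmod (nev h v))\<^sup>2 * exp (- (norm (v - u))\<^sup>2))) \<partial>lborel) \<partial>lborel)"
    by (rule lborel_pair.Fubini'[symmetric]) measurable
  also have "\<dots> = (\<integral>\<^sup>+v. (?K * ennreal ((cmod (nev h v))\<^sup>2)) * (\<integral>\<^sup>+u. F u * ennreal (exp (- (norm (u - v))\<^sup>2)) \<partial>lborel) \<partial>lborel)"
    by (subst nn_integral_cmult[symmetric]) (auto simp: ennreal_mult mult_ac norm_minus_commute)
  also have "\<dots> \<le> (\<integral>\<^sup>+v. (?K * ennreal ((cmod (nev h v))\<^sup>2)) * ennreal C \<partial>lborel)"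
  proof (intro nn_integral_mono mult_left_mono)
    fix v
    show "(\<integral>\<^sup>+u. F u * ennreal (exp (- (norm (u - v))\<^sup>2)) \<partial>lborel) \<le> ennreal C"
      using conv[of "\<lambda>u. exp (- (norm (u - v))\<^sup>2)"]
        assms[unfolded carleson_def, THEN conjunct2, THEN conjunct2, rule_format, of v] by simp
  qed simp
  also have "\<dots> = ?K * ennreal C * (\<integral>\<^sup>+v. (ennreal (cmod (nev h v)))\<^sup>2 \<partial>lborel)"
    by (subst nn_integral_cmult[symmetric]) (auto simp: ennreal_power mult_ac)
  also have "\<dots> = ennreal ((2 / pi) ^ CARD('n) * C * (sqrt (pi ^ CARD('n)) * norm h)\<^sup>2)"
    unfolding nn_integral_nev_square using C by (simp add: ennreal_mult)
  also have "(2 / pi) ^ CARD('n) * C * (sqrt (pi ^ CARD('n)) * norm h)\<^sup>2 = C * 2 ^ CARD('n) * (norm h)\<^sup>2"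
    by (simp add: power_mult_distrib power_divide)
  finally show ?thesis .
qed

text \<open>The form of the Toeplitz operator with the projection removed. For a Carleson symbol it
  makes sense for all h and g, even where f h is not square integrable.\<close>

definition tform :: "(complex^'n::finite \<Rightarrow> complex) \<Rightarrow> 'n fock \<Rightarrow> 'n fock \<Rightarrow> complex" where
  "tform f h g = (\<integral>u. f u * nev h u * cnj (nev g u) \<partial>lebesgue) / of_real (pi ^ CARD('n))"

text \<open>Half of |f| goes to each side: Cauchy-Schwarz for sqrt |f| times \<open>nev h\<close>
  and sqrt |f| times \<open>nev g\<close> reduces both claims to the embedding.\<close>

lemma carleson_form:
  fixes f :: "complex^'n::finite \<Rightarrow> complex"
  assumes "carleson C f"
  shows "integrable lebesgue (\<lambda>u. f u * nev h u * cnj (nev g u))"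
    and "cmod (tform f h g) \<le> C * 2 ^ CARD('n) / pi ^ CARD('n) * norm h * norm g"
proof -
  have C: "C \<ge> 0" and f[measurable]: "f \<in> borel_measurable lebesgue" using assms by (auto simp: carleson_def)
  have [measurable]: "nev h \<in> borel_measurable lebesgue" for h :: "'n fock"
    by (rule borel_measurable_lebesgueI) measurable
  let ?s = "sqrt (C * 2 ^ CARD('n))"
  have sq: "(\<integral>\<^sup>+u. (ennreal (sqrt (cmod (f u)) * cmod (nev h u)))\<^sup>2 \<partial>lebesgue) \<le> ennreal ((?s * norm h)\<^sup>2)" for h
    using carleson_embedding[OF assms, of h] C by (simp add: ennreal_power power_mult_distrib)
  have "(\<integral>\<^sup>+u. ennreal (norm (f u * nev h u * cnj (nev g u))) \<partial>lebesgue)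
    = (\<integral>\<^sup>+u. ennreal (sqrt (cmod (f u)) * cmod (nev h u)) * ennreal (sqrt (cmod (f u)) * cmod (nev g u)) \<partial>lebesgue)"
    by (intro nn_integral_cong) (simp add: norm_mult mult_ac flip: ennreal_mult)
  also have "\<dots> \<le> ennreal ((?s * norm h) * (?s * norm g))"
    by (rule nn_integral_Cauchy_Schwarz_le[OF _ _ sq sq]) (use C in auto)
  also have "(?s * norm h) * (?s * norm g) = C * 2 ^ CARD('n) * norm h * norm g"
    using C by (simp add: mult_ac)
  finally have b: "(\<integral>\<^sup>+u. ennreal (norm (f u * nev h u * cnj (nev g u))) \<partial>lebesgue)
    \<le> ennreal (C * 2 ^ CARD('n) * norm h * norm g)" .
  then show int: "integrable lebesgue (\<lambda>u. f u * nev h u * cnj (nev g u))"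
    by (intro integrableI_bounded) (auto intro: order.strict_trans1[OF _ ennreal_less_top])
  have "cmod (\<integral>u. f u * nev h u * cnj (nev g u) \<partial>lebesgue) \<le> C * 2 ^ CARD('n) * norm h * norm g"
    using order.trans[OF integral_norm_bound_ennreal[OF int] b] C by simp
  then show "cmod (tform f h g) \<le> C * 2 ^ CARD('n) / pi ^ CARD('n) * norm h * norm g"
    by (simp add: tform_def norm_divide norm_power divide_right_mono)
qed

lemma nev_add: "nev (f + g) z = nev f z + nev g z"
  by (simp add: nev_def plus_fock.rep_eq distrib_left)

lemma nev_scale: "nev (fock_scaleC c f) z = c * nev f z"
  by (simp add: nev_def fock_scaleC.rep_eq)

lemma carleson_op:
  fixes f :: "complex^'n::finite \<Rightarrow> complex"
  assumes "carleson C f"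
  shows "\<exists>A\<in>bdd_ops. \<forall>h g. fock_cinner (blinfun_apply A h) g = tform f h g"
proof (rule fock_form_op)
  note int = carleson_form(1)[OF assms]
  show "cmod (tform f h g) \<le> C * 2 ^ CARD('n) / pi ^ CARD('n) * norm h * norm g" for h g
    by (rule carleson_form(2)[OF assms])
  show "tform f (h + h') g = tform f h g + tform f h' g" for h h' g
    using Bochner_Integration.integral_add[OF int[of h g] int[of h' g]]
    by (simp add: tform_def nev_add distrib_left distrib_right add_divide_distrib)
  show "tform f h (g + g') = tform f h g + tform f h g'" for h g g'
    using Bochner_Integration.integral_add[OF int[of h g] int[of h g']]
    by (simp add: tform_def nev_add distrib_left add_divide_distrib)
  have "(\<integral>u. f u * (c * nev h u) * cnj (nev g u) \<partial>lebesgue) = c * (\<integral>u. f u * nev h u * cnj (nev g u) \<partial>lebesgue)" for c h g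
    by (subst integral_mult_right_zero[symmetric]) (simp add: mult_ac)
  then show "tform f (fock_scaleC c h) g = c * tform f h g" for c h g
    by (simp add: tform_def nev_scale)
  have "(\<integral>u. f u * nev h u * (c * cnj (nev g u)) \<partial>lebesgue) = c * (\<integral>u. f u * nev h u * cnj (nev g u) \<partial>lebesgue)" for c h g
    by (subst integral_mult_right_zero[symmetric]) (simp add: mult_ac)
  then show "tform f h (fock_scaleC c g) = cnj c * tform f h g" for c h g
    by (simp add: tform_def nev_scale)
qed

lemma toeplitz_fun_form:
  assumes "f \<in> borel_measurable lebesgue" "h \<in> toeplitz_dom f"
  shows "fock_cinner (toeplitz_fun f h) g = tform f h g"
proof -
  have L2: "(\<lambda>w. f w * fock_fun h w) \<in> L2_fun" using assms(2) by (simp add: toeplitz_dom_def)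
  have [measurable]: "fock_fun h \<in> borel_measurable lebesgue" "fock_fun g \<in> borel_measurable lebesgue" "f \<in> borel_measurable lebesgue"
    using assms(1) by (auto intro: borel_measurable_lebesgueI)
  have w: "gdens 1 w *\<^sub>R (f w * fock_fun h w * cnj (fock_fun g w)) = (f w * nev h w * cnj (nev g w)) / of_real (pi ^ CARD('a))" for w
  proof -
    have "gdens 1 w *\<^sub>R (f w * fock_fun h w * cnj (fock_fun g w))
      = f w * (gdens 1 w *\<^sub>R (fock_fun h w * cnj (fock_fun g w)))" by (simp add: mult_ac)
    also have "\<dots> = f w * ((1 / pi ^ CARD('a)) *\<^sub>R (nev h w * cnj (nev g w)))" by (simp only: gdens_nev)
    finally show ?thesis by (simp add: scaleR_conv_of_real)
  qed
  show ?thesis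
    unfolding toeplitz_fun_def fock_cinner_proj[OF L2]
    by (subst integral_gauss_lebesgue, measurable) (simp only: w tform_def integral_divide_zero)
qed

lemma nkerf_toeplitz_dom:
  assumes "toeplitz_symbol f" shows "nkerf z \<in> toeplitz_dom f"
proof -
  have "(\<lambda>w. f w * ker z w) \<in> L2_fun" using assms by (simp add: toeplitz_symbol_def)
  from L2_fun_scale[OF this, of "of_real (exp (- (norm z)\<^sup>2 / 2))"]
  show ?thesis by (simp add: toeplitz_dom_def nkerf.rep_eq nker_def mult_ac)
qed

lemma carleson_toeplitz_bounded:
  assumes "carleson C f" shows "toeplitz_bounded f"
proof -
  obtain A where A: "A \<in> bdd_ops" "\<And>h g. fock_cinner (blinfun_apply A h) g = tform f h g"
    using carleson_op[OF assms] by blast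
  have "toeplitz_fun f h = blinfun_apply A h" if "h \<in> toeplitz_dom f" for h
    using assms that by (intro fock_cinner_eqI) (simp add: A(2) toeplitz_fun_form carleson_def)
  then show ?thesis unfolding toeplitz_bounded_def using norm_blinfun[of A] by auto
qed

text \<open>The operator of the form extends \<open>toeplitz_fun\<close>. Any other bounded
  extension agrees with it on the kernels, which lie in the domain by
  \<open>toeplitz_symbol\<close>, and therefore everywhere.\<close>

lemma
  assumes "carleson C f" "toeplitz_symbol f"
  shows toeplitz_bdd_ops: "toeplitz f \<in> bdd_ops"
    and toeplitz_form: "fock_cinner (blinfun_apply (toeplitz f) h) g = tform f h g"
proof -
  obtain A where A: "A \<in> bdd_ops" "\<And>h g. fock_cinner (blinfun_apply A h) g = tform f h g"
    using carleson_op[OF assms(1)] by blast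
  have eq: "toeplitz_fun f h = blinfun_apply A h" if "h \<in> toeplitz_dom f" for h
    using assms that by (intro fock_cinner_eqI) (simp add: A(2) toeplitz_fun_form carleson_def)
  have "toeplitz f = A"
    unfolding toeplitz_def
  proof (rule the_equality)
    fix B assume B: "B \<in> bdd_ops \<and> (\<forall>h\<in>toeplitz_dom f. blinfun_apply B h = toeplitz_fun f h)"
    show "B = A"
      by (rule bdd_ops_eqI) (use A(1) B eq nkerf_toeplitz_dom[OF assms(2)] in auto)
  qed (use A(1) eq in simp)
  then show "toeplitz f \<in> bdd_ops" "fock_cinner (blinfun_apply (toeplitz f) h) g = tform f h g"
    using A by auto
qed

lemma carleson_toeplitz_Fl:
  fixes f :: "complex^'n::finite \<Rightarrow> complex"
  assumes "carleson C f" "toeplitz_symbol f"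
  shows "toeplitz f \<in> Fl"
proof -
  have C: "C \<ge> 0" using assms(1) by (simp add: carleson_def)
  have "cmod (nev (blinfun_apply (toeplitz f) (nkerf z)) w) \<le> C / pi ^ CARD('n) * exp (- (1/4) * (norm (w - z))\<^sup>2)" for z w
  proof -
    \<comment> \<open>The two Gaussian weights combine to one centred at the midpoint, where the
      Carleson bound holds with the same C; the remaining factor fixes the rate 1/4.\<close>
    have e: "norm (f u * nev (nkerf z) u * cnj (nev (nkerf w) u))
      = exp (- (1/4) * (norm (w - z))\<^sup>2) * (cmod (f u) * exp (- (norm (u - (1/2) *\<^sub>R (z + w)))\<^sup>2))" for u
    proof -
      have "- (norm (z - u))\<^sup>2 / 2 + - (norm (w - u))\<^sup>2 / 2 = - (1/4) * (norm (w - z))\<^sup>2 + - (norm (u - (1/2) *\<^sub>R (z + w)))\<^sup>2"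
        unfolding power2_norm_eq_inner by (simp add: inner_simps inner_commute field_simps)
      then have "exp (- (norm (z - u))\<^sup>2 / 2) * exp (- (norm (w - u))\<^sup>2 / 2)
        = exp (- (1/4) * (norm (w - z))\<^sup>2) * exp (- (norm (u - (1/2) *\<^sub>R (z + w)))\<^sup>2)"
        by (simp only: flip: exp_add)
      then show ?thesis by (simp only: norm_mult complex_mod_cnj cmod_nev_nkerf mult_ac)
    qed
    have "ennreal (cmod (\<integral>u. f u * nev (nkerf z) u * cnj (nev (nkerf w) u) \<partial>lebesgue))
      \<le> (\<integral>\<^sup>+u. ennreal (norm (f u * nev (nkerf z) u * cnj (nev (nkerf w) u))) \<partial>lebesgue)"
      by (rule integral_norm_bound_ennreal[OF carleson_form(1)[OF assms(1)]])
    also have "\<dots> = ennreal (exp (- (1/4) * (norm (w - z))\<^sup>2)) *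
       (\<integral>\<^sup>+u. ennreal (cmod (f u) * exp (- (norm (u - (1/2) *\<^sub>R (z + w)))\<^sup>2)) \<partial>lebesgue)"
    proof -
      have [measurable]: "f \<in> borel_measurable lebesgue" "(\<lambda>u::complex^'n. u) \<in> borel_measurable lebesgue"
        using assms(1) by (auto simp: carleson_def intro: borel_measurable_lebesgueI)
      have m: "(\<lambda>u. ennreal (cmod (f u) * exp (- (norm (u - (1/2) *\<^sub>R (z + w)))\<^sup>2))) \<in> borel_measurable lebesgue"
        by measurable
      show ?thesis unfolding e nn_integral_cmult[OF m, symmetric] by (simp add: ennreal_mult)
    qed
    also have "\<dots> \<le> ennreal (exp (- (1/4) * (norm (w - z))\<^sup>2)) * ennreal C"
      using assms(1) by (intro mult_left_mono) (auto simp: carleson_def)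
    also have "\<dots> = ennreal (C * exp (- (1/4) * (norm (w - z))\<^sup>2))" using C by (simp add: mult.commute flip: ennreal_mult)
    finally have "cmod (\<integral>u. f u * nev (nkerf z) u * cnj (nev (nkerf w) u) \<partial>lebesgue) \<le> C * exp (- (1/4) * (norm (w - z))\<^sup>2)"
      using C by (simp add: mult.commute)
    then show ?thesis
      unfolding nev_eq_cinner toeplitz_form[OF assms] tform_def
      by (simp add: nev_eq_cinner norm_divide norm_power divide_right_mono)
  qed
  then have "localized (1/4) (C / pi ^ CARD('n)) (toeplitz f)"
    using toeplitz_bdd_ops[OF assms] by (simp add: localized_def)
  then show ?thesis by (rule localized_imp_Fl)
qed


section \<open>Bounded symbols and symbols of bounded mean oscillation\<close>

lemma Linfty_AE:
  assumes "f \<in> Linfty"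
  obtains M where "M \<ge> 0" "AE z in lebesgue. cmod (f z) \<le> M"
proof -
  let ?e = "esssup lebesgue (\<lambda>z. ennreal (cmod (f z)))"
  have fin: "?e < \<infinity>" using assms by (simp add: Linfty_def)
  have "AE z in lebesgue. cmod (f z) \<le> enn2real ?e"
  proof (rule AE_mp[OF esssup_AE[of "\<lambda>z. ennreal (cmod (f z))"]], intro AE_I2 impI)
    fix z assume "ennreal (cmod (f z)) \<le> ?e"
    then show "cmod (f z) \<le> enn2real ?e"
      using fin enn2real_mono[of "ennreal (cmod (f z))" ?e] by simp
  qed
  then show ?thesis by (rule that[OF enn2real_nonneg])
qed

lemma Linfty_carleson:
  fixes f :: "complex^'n::finite \<Rightarrow> complex"
  assumes "f \<in> borel_measurable lebesgue" "M \<ge> 0" "AE z in lebesgue. cmod (f z) \<le> M"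
  shows "carleson (M * pi ^ CARD('n)) f"
  unfolding carleson_def
proof (intro conjI allI)
  fix z :: "complex^'n"
  have g: "(\<integral>\<^sup>+u. ennreal (exp (- (norm (u - z))\<^sup>2)) \<partial>lborel) = ennreal (pi ^ CARD('n))"
  proof -
    have "(\<integral>\<^sup>+u. ennreal (exp (- (norm (u - z))\<^sup>2)) \<partial>lborel) = (\<integral>\<^sup>+(u::complex^'n). ennreal (exp (- (norm u)\<^sup>2)) \<partial>lborel)"
      using nn_integral_lborel_shift[of "\<lambda>u::complex^'n. ennreal (exp (- (norm u)\<^sup>2))" "- z"] by simp
    also have "\<dots> = ennreal (sqrt pi ^ (2 * CARD('n)))"
      using nn_integral_gaussian[of 1, where 'a="complex^'n"] by (simp add: mult.commute)
    finally show ?thesis by (simp add: power_mult)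
  qed
  have "(\<integral>\<^sup>+u. ennreal (cmod (f u) * exp (- (norm (u - z))\<^sup>2)) \<partial>lebesgue)
    \<le> (\<integral>\<^sup>+u. ennreal M * ennreal (exp (- (norm (u - z))\<^sup>2)) \<partial>lebesgue)"
    by (rule nn_integral_mono_AE, rule AE_mp[OF assms(3)])
       (use assms(2) in \<open>auto intro!: mult_right_mono simp flip: ennreal_mult\<close>)
  also have "\<dots> = ennreal (M * pi ^ CARD('n))"
    unfolding nn_integral_completion
    by (subst nn_integral_cmult) (use assms(2) in \<open>auto simp: g ennreal_mult\<close>)
  finally show "(\<integral>\<^sup>+u. ennreal (cmod (f u) * exp (- (norm (u - z))\<^sup>2)) \<partial>lebesgue) \<le> ennreal (M * pi ^ CARD('n))" .
qed (use assms in auto)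

lemma Linfty_toeplitz_symbol:
  assumes "f \<in> Linfty" shows "toeplitz_symbol f"
  unfolding toeplitz_symbol_def L2_fun_def
proof (intro conjI allI CollectI)
  obtain M where M: "M \<ge> 0" "AE z in lebesgue. cmod (f z) \<le> M" using Linfty_AE[OF assms] .
  show f: "f \<in> borel_measurable lebesgue" using assms by (simp add: Linfty_def)
  fix z
  note k = L2_funD[OF ker_L2[of z]]
  show m: "(\<lambda>w. f w * ker z w) \<in> borel_measurable lebesgue" using f k(1) by (rule borel_measurable_times)
  have AE: "AE w in gauss 1. cmod (f w) \<le> M"
  proof -
    have "(\<lambda>z::(complex, 'a) vec. ennreal (gdens 1 z)) \<in> borel_measurable lebesgue"
      by (rule measurable_compose[OF gauss_weight_measurable' measurable_ennreal])
    then show ?thesis unfolding gauss_def using M(2) by (subst AE_density) auto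
  qed
  show "integrable (gauss 1) (\<lambda>w. (cmod (f w * ker z w))\<^sup>2)"
  proof (rule Bochner_Integration.integrable_bound[OF integrable_mult_right[OF k(2), of "M\<^sup>2"]])
    show "(\<lambda>w. (cmod (f w * ker z w))\<^sup>2) \<in> borel_measurable (gauss 1)" using m by simp
    show "AE w in gauss 1. norm ((cmod (f w * ker z w))\<^sup>2) \<le> norm (M\<^sup>2 * (cmod (ker z w))\<^sup>2)"
      by (rule AE_mp[OF AE]) (auto simp: norm_mult power_mult_distrib intro!: mult_right_mono power_mono)
  qed
qed

text \<open>Places the bounded symbols inside the BMO family, so that both generating sets contain
  the Toeplitz operators used for the approximation.\<close>

lemma Linfty_BMO:
  fixes f :: "complex^'n::finite \<Rightarrow> complex"
  assumes "f \<in> Linfty" shows "f \<in> BMO"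
proof -
  obtain M where M: "M \<ge> 0" "AE z in lebesgue. cmod (f z) \<le> M" using Linfty_AE[OF assms] .
  have f: "f \<in> borel_measurable lebesgue" using assms by (simp add: Linfty_def)
  interpret prob_space "gauss 1 :: (complex^'n) measure" by (rule prob_space_gauss) simp
  have fz: "(\<lambda>w. f (z - w)) \<in> borel_measurable lebesgue" for z
    by (rule measurable_compose[OF lebesgue_reflect_measurable f])
  have AE: "AE w in gauss 1. cmod (f (z - w)) \<le> M" for z
  proof -
    have "{x \<in> space lebesgue. cmod (f x) \<le> M} \<in> sets lebesgue" using f by measurable
    then have "AE w in lebesgue. cmod (f (z - w)) \<le> M"
      using M(2) AE_distr_iff[OF lebesgue_reflect_measurable, of "\<lambda>w. cmod (f w) \<le> M" z] f
      unfolding lebesgue_distr_reflect by simp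
    moreover have "(\<lambda>z::complex^'n. ennreal (gdens 1 z)) \<in> borel_measurable lebesgue"
      by (rule measurable_compose[OF gauss_weight_measurable' measurable_ennreal])
    ultimately show ?thesis unfolding gauss_def by (subst AE_density) auto
  qed
  have int: "integrable (gauss 1) (\<lambda>w. f (z - w))" for z
    by (rule integrable_const_bound[OF AE]) (use fz in simp)
  have heat: "cmod (heat 1 f z) \<le> M" for z
  proof -
    have "cmod (heat 1 f z) \<le> (\<integral>w. cmod (f (z - w)) \<partial>gauss 1)" unfolding heat_def by (rule integral_norm_bound)
    also have "\<dots> \<le> (\<integral>w. M \<partial>(gauss 1 :: (complex^'n) measure))"
      by (rule integral_mono_AE) (use int AE in auto)
    finally show ?thesis using prob_space by simp
  qed
  have "(\<integral>\<^sup>+w. ennreal (cmod (f (z - w) - heat 1 f z)) \<partial>gauss 1) \<le> ennreal (2 * M)" for z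
  proof -
    have "(\<integral>\<^sup>+w. ennreal (cmod (f (z - w) - heat 1 f z)) \<partial>gauss 1) \<le> (\<integral>\<^sup>+w. ennreal (2 * M) \<partial>(gauss 1 :: (complex^'n) measure))"
    proof (rule nn_integral_mono_AE, rule AE_mp[OF AE], intro AE_I2 impI ennreal_leI)
      fix w assume "cmod (f (z - w)) \<le> M"
      then show "cmod (f (z - w) - heat 1 f z) \<le> 2 * M"
        using norm_triangle_ineq4[of "f (z - w)" "heat 1 f z"] heat[of z] by linarith
    qed
    also have "\<dots> = ennreal (2 * M)" using emeasure_space_1 by simp
    finally show ?thesis .
  qed
  then have "(SUP z. \<integral>\<^sup>+w. ennreal (cmod (f (z - w) - heat 1 f z)) \<partial>gauss 1) \<le> ennreal (2 * M)"
    by (intro SUP_least)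
  then have sup: "(SUP z. \<integral>\<^sup>+w. ennreal (cmod (f (z - w) - heat 1 f z)) \<partial>gauss 1) < \<infinity>"
    unfolding infinity_ennreal_def by (rule order.strict_trans1[OF _ ennreal_less_top])
  have si: "set_integrable lebesgue K f" if "compact K" for K
  proof -
    have K: "K \<in> sets lebesgue" "emeasure lebesgue K < \<infinity>"
      using that emeasure_bounded_finite[OF compact_imp_bounded[OF that]] by (auto simp: compact_imp_closed)
    show ?thesis
      unfolding set_integrable_def
    proof (rule Bochner_Integration.integrable_bound[of _ "\<lambda>x. M * indicat_real K x"])
      show "AE x in lebesgue. norm (indicat_real K x *\<^sub>R f x) \<le> norm (M * indicat_real K x)"
        by (rule AE_mp[OF M(2)]) (use M(1) in \<open>auto simp: indicator_def\<close>)
    qed (use K f in auto)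
  qed
  show ?thesis
    unfolding BMO_def mem_Collect_eq by (intro conjI allI impI f int sup si)
qed

text \<open>Boundedness of the operator controls only the mean \<open>heat 1 f z\<close>, in which f
  may cancel. The BMO condition controls the mean of the deviation from it, and the triangle
  inequality then gives the mean of |f|.\<close>

lemma BMO_carleson:
  fixes f :: "complex^'n::finite \<Rightarrow> complex"
  assumes "f \<in> BMO" "toeplitz_symbol f" "toeplitz_bounded f"
  shows "\<exists>C. carleson C f"
proof -
  have f: "f \<in> borel_measurable lebesgue" and int: "\<And>z. integrable (gauss 1) (\<lambda>w. f (z - w))"
    using assms(1) by (auto simp: BMO_def)
  interpret prob_space "gauss 1 :: (complex^'n) measure" by (rule prob_space_gauss) simp
  have fz: "(\<lambda>w. f (z - w)) \<in> borel_measurable lebesgue" for z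
    by (rule measurable_compose[OF lebesgue_reflect_measurable f])
  have [measurable]: "(\<lambda>u::complex^'n. u) \<in> borel_measurable lebesgue" by (simp add: borel_measurable_lebesgueI)
  obtain C where C: "\<And>h. h \<in> toeplitz_dom f \<Longrightarrow> norm (toeplitz_fun f h) \<le> C * norm h"
    using assms(3) unfolding toeplitz_bounded_def by blast
  \<comment> \<open>The mean is the diagonal entry of the operator at the unit vector k_z, which
    lies in the domain.\<close>
  have heat: "cmod (heat 1 f z) \<le> C" for z
  proof -
    have "f u * nev (nkerf z) u * cnj (nev (nkerf z) u) = exp (- (norm (z - u))\<^sup>2) *\<^sub>R f u" for u
    proof -
      have "nev (nkerf z) u * cnj (nev (nkerf z) u) = of_real ((cmod (nev (nkerf z) u))\<^sup>2)"
        by (simp only: complex_norm_square)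
      also have "\<dots> = of_real (exp (- (norm (z - u))\<^sup>2))"
        by (simp add: cmod_nev_nkerf flip: exp_double)
      finally show ?thesis by (simp add: mult.assoc scaleR_conv_of_real mult.commute)
    qed
    then have "tform f (nkerf z) (nkerf z) = (\<integral>u. exp (- (norm (z - u))\<^sup>2) *\<^sub>R f u \<partial>lebesgue) / of_real (pi ^ CARD('n))"
      by (simp add: tform_def)
    also have "(\<integral>u. exp (- (norm (z - u))\<^sup>2) *\<^sub>R f u \<partial>lebesgue)
       = (\<integral>u. exp (- (norm (z - u))\<^sup>2) *\<^sub>R f u \<partial>distr lebesgue lebesgue (\<lambda>w. z - w))"
      by (simp only: lebesgue_distr_reflect)
    also have "\<dots> = (\<integral>w. exp (- (norm w)\<^sup>2) *\<^sub>R f (z - w) \<partial>lebesgue)"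
    proof -
      have "(\<lambda>u. exp (- (norm (z - u))\<^sup>2) *\<^sub>R f u) \<in> borel_measurable lebesgue"
        by (intro borel_measurable_scaleR f borel_measurable_lebesgueI) measurable
      then show ?thesis by (subst integral_distr[OF lebesgue_reflect_measurable]) simp_all
    qed
    also have "\<dots> / of_real (pi ^ CARD('n)) = heat 1 f z"
      unfolding heat_def integral_gauss_lebesgue[OF fz] integral_divide_zero[symmetric]
      by (simp add: scaleR_conv_of_real)
    finally have "heat 1 f z = fock_cinner (toeplitz_fun f (nkerf z)) (nkerf z)"
      by (simp add: toeplitz_fun_form[OF f nkerf_toeplitz_dom[OF assms(2)]])
    then have "cmod (heat 1 f z) \<le> norm (toeplitz_fun f (nkerf z)) * norm (nkerf z)"
      by (simp only: cmod_fock_cinner_le)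
    then show ?thesis using C[OF nkerf_toeplitz_dom[OF assms(2)], of z] by simp
  qed
  then have C0: "C \<ge> 0" using norm_ge_zero order.trans by blast
  define S where "S = enn2real (SUP z. \<integral>\<^sup>+w. ennreal (cmod (f (z - w) - heat 1 f z)) \<partial>gauss 1)"
  have S: "(\<integral>\<^sup>+w. ennreal (cmod (f (z - w) - heat 1 f z)) \<partial>gauss 1) \<le> ennreal S" for z
  proof -
    have "(SUP z. \<integral>\<^sup>+w. ennreal (cmod (f (z - w) - heat 1 f z)) \<partial>gauss 1) = ennreal S"
      using assms(1) by (simp add: S_def BMO_def)
    moreover have "(\<integral>\<^sup>+w. ennreal (cmod (f (z - w) - heat 1 f z)) \<partial>gauss 1)
       \<le> (SUP z. \<integral>\<^sup>+w. ennreal (cmod (f (z - w) - heat 1 f z)) \<partial>gauss 1)"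
      by (rule SUP_upper) simp
    ultimately show ?thesis by (simp only:)
  qed
  have S0: "S \<ge> 0" by (simp add: S_def)
  have "(\<integral>\<^sup>+u. ennreal (cmod (f u) * exp (- (norm (u - z))\<^sup>2)) \<partial>lebesgue) \<le> ennreal (pi ^ CARD('n) * (S + C))" for z
  proof -
    have "(\<integral>\<^sup>+u. ennreal (cmod (f u) * exp (- (norm (u - z))\<^sup>2)) \<partial>lebesgue)
      = (\<integral>\<^sup>+u. ennreal (cmod (f u) * exp (- (norm (u - z))\<^sup>2)) \<partial>distr lebesgue lebesgue (\<lambda>w. z - w))"
      by (simp only: lebesgue_distr_reflect)
    also have "\<dots> = (\<integral>\<^sup>+w. ennreal (cmod (f (z - w)) * exp (- (norm w)\<^sup>2)) \<partial>lebesgue)"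
    proof -
      have "(\<lambda>u. cmod (f u) * exp (- (norm (u - z))\<^sup>2)) \<in> borel_measurable lebesgue"
        by (rule borel_measurable_times[OF measurable_compose[OF f borel_measurable_norm] borel_measurable_lebesgueI]) measurable
      from measurable_compose[OF this measurable_ennreal]
      show ?thesis by (subst nn_integral_distr[OF lebesgue_reflect_measurable]) simp_all
    qed
    also have "\<dots> = (\<integral>\<^sup>+w. ennreal (pi ^ CARD('n)) * (ennreal (gdens 1 w) * ennreal (cmod (f (z - w)))) \<partial>lebesgue)"
      by (intro nn_integral_cong) (simp add: mult.commute flip: ennreal_mult)
    also have "\<dots> = ennreal (pi ^ CARD('n)) * (\<integral>\<^sup>+w. ennreal (cmod (f (z - w))) \<partial>gauss 1)"
      using fz[of z] by (subst nn_integral_gauss, simp) (subst nn_integral_cmult, auto)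
    also have "\<dots> \<le> ennreal (pi ^ CARD('n)) * ennreal (S + C)"
    proof (rule mult_left_mono)
      have "(\<integral>\<^sup>+w. ennreal (cmod (f (z - w))) \<partial>gauss 1)
        \<le> (\<integral>\<^sup>+w. ennreal (cmod (f (z - w) - heat 1 f z)) + ennreal C \<partial>gauss 1)"
      proof (rule nn_integral_mono)
        fix w
        have "cmod (f (z - w)) \<le> cmod (f (z - w) - heat 1 f z) + C"
          using norm_triangle_ineq2[of "f (z - w)" "heat 1 f z"] heat[of z] by linarith
        then show "ennreal (cmod (f (z - w))) \<le> ennreal (cmod (f (z - w) - heat 1 f z)) + ennreal C"
          using C0 by (simp flip: ennreal_plus)
      qed
      also have "\<dots> = (\<integral>\<^sup>+w. ennreal (cmod (f (z - w) - heat 1 f z)) \<partial>gauss 1) + ennreal C"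
        using fz[of z] emeasure_space_1 by (subst nn_integral_add) auto
      also have "\<dots> \<le> ennreal (S + C)" using S[of z] C0 S0 by (simp add: ennreal_plus add_right_mono)
      finally show "(\<integral>\<^sup>+w. ennreal (cmod (f (z - w))) \<partial>gauss 1) \<le> ennreal (S + C)" .
    qed simp
    finally show ?thesis using C0 S0 by (simp add: ennreal_mult)
  qed
  then have "carleson (pi ^ CARD('n) * (S + C)) f" using f C0 S0 by (simp add: carleson_def)
  then show ?thesis by blast
qed

lemma toeplitz_BMO_Fl: "f \<in> BMO \<Longrightarrow> toeplitz_symbol f \<Longrightarrow> toeplitz_bounded f \<Longrightarrow> toeplitz f \<in> Fl"
  using BMO_carleson carleson_toeplitz_Fl by blast

lemma Linfty_toeplitz:
  assumes "f \<in> Linfty"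
  shows "toeplitz_bounded f" "toeplitz f \<in> Fl" "fock_cinner (blinfun_apply (toeplitz f) h) g = tform f h g"
proof -
  obtain M where M: "M \<ge> 0" "AE z in lebesgue. cmod (f z) \<le> M" using Linfty_AE[OF assms] .
  have "f \<in> borel_measurable lebesgue" using assms by (simp add: Linfty_def)
  note C = Linfty_carleson[OF this M] and s = Linfty_toeplitz_symbol[OF assms]
  show "toeplitz_bounded f" "toeplitz f \<in> Fl" "fock_cinner (blinfun_apply (toeplitz f) h) g = tform f h g"
    using carleson_toeplitz_bounded[OF C] carleson_toeplitz_Fl[OF C s] toeplitz_form[OF C s] by auto
qed

section \<open>Approximation by Toeplitz operators\<close>

lemma nev_diff: "nev (f - g) z = nev f z - nev g z"
  by (simp add: nev_eq_cinner fock_cinner_diff_left)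

text \<open>With squared norms written as \<open>hdot z z\<close>, exponents can be compared by pure
  algebra in \<open>hdot\<close>.\<close>

lemma nev_nkerf_hdot: "nev (nkerf z) w = exp (- (hdot z z + hdot w w) / 2 + hdot w z)"
  unfolding nev_nkerf hdot_self by simp

lemma bounded_Linfty:
  assumes "f \<in> borel_measurable borel" "\<And>z. cmod (f z) \<le> M"
  shows "f \<in> Linfty"
proof -
  have "esssup lebesgue (\<lambda>z. ennreal (cmod (f z))) \<le> ennreal M"
  proof (rule esssup_I)
    have "(\<lambda>z. ennreal (cmod (f z))) \<in> borel_measurable borel" using assms(1) by measurable
    then show "(\<lambda>z. ennreal (cmod (f z))) \<in> borel_measurable lebesgue" by (rule borel_measurable_lebesgueI)
  qed (use assms(2) in \<open>auto intro!: ennreal_leI\<close>)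
  from order.strict_trans1[OF this ennreal_less_top] show ?thesis
    using borel_measurable_lebesgueI[OF assms(1)] by (simp add: Linfty_def)
qed

lemma nev_weyl_nkerf:
  "nev (blinfun_apply (weyl \<xi>) (nkerf z)) w
    = exp (- (hdot w w + hdot \<xi> \<xi> + hdot z z) / 2 + hdot w \<xi> + hdot (w - \<xi>) z)"
proof -
  have "exp (complex_of_real (- (norm w)\<^sup>2 / 2)) * ((exp (complex_of_real (- (norm \<xi>)\<^sup>2 / 2)) * exp (hdot w \<xi>)) *
     (exp (complex_of_real (- (norm z)\<^sup>2 / 2)) * exp (hdot (w - \<xi>) z)))
    = exp (- (hdot w w + hdot \<xi> \<xi> + hdot z z) / 2 + hdot w \<xi> + hdot (w - \<xi>) z)"
    unfolding exp_add[symmetric] by (rule arg_cong[of _ _ exp]) (simp add: hdot_self add_divide_distrib diff_divide_distrib)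
  then show ?thesis
    by (simp only: nev_def weyl_apply nkerf.rep_eq nker_def ker_def exp_of_real)
qed

text \<open>The symbol is the character exp (2 i Im (hdot u \<xi>)) times exp (|\<xi>|^2 / 2): the
  Toeplitz operator of the character alone is exp (- |\<xi>|^2 / 2) W_\<xi>, and the constant
  compensates.\<close>

lemma weyl_eq_toeplitz:
  fixes \<xi> :: "complex^'n::finite"
  obtains g where "g \<in> Linfty" "weyl \<xi> = toeplitz g"
proof -
  define g where "g u = exp (hdot \<xi> \<xi> / 2 + hdot u \<xi> - hdot \<xi> u)" for u
  have [measurable]: "g \<in> borel_measurable borel" unfolding g_def by measurable
  have "cmod (g u) \<le> exp ((norm \<xi>)\<^sup>2 / 2)" for u
    by (simp add: g_def norm_exp_eq_Re hdot_self Re_hdot inner_commute)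
  then have g: "g \<in> Linfty" by (intro bounded_Linfty) auto
  have "weyl \<xi> = toeplitz g"
  proof (rule bdd_ops_eqI)
    show "weyl \<xi> \<in> bdd_ops" by (rule weyl_bdd)
    show "toeplitz g \<in> bdd_ops" using Linfty_toeplitz(2)[OF g] Fl_subset_bdd by blast
    fix z w
    \<comment> \<open>Multiplication by \<open>g\<close> moves z to z + \<xi> in one kernel and w to
      w - \<xi> in the conjugate one; \<open>c\<close> collects the changes of normalization and the
      constant factor of \<open>g\<close>.\<close>
    define c where "c = exp ((hdot \<xi> \<xi> - (hdot z z + hdot w w) + (hdot (z + \<xi>) (z + \<xi>) + hdot (w - \<xi>) (w - \<xi>))) / 2)"
    have "g u * nev (nkerf z) u * cnj (nev (nkerf w) u) = c * (nev (nkerf (z + \<xi>)) u * cnj (nev (nkerf (w - \<xi>)) u))" for u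
      unfolding g_def c_def nev_nkerf_hdot exp_cnj exp_add[symmetric]
      by (rule arg_cong[of _ _ exp]) (simp add: cnj_hdot hdot_simps field_simps)
    then have "tform g (nkerf z) (nkerf w) = c * fock_cinner (nkerf (z + \<xi>)) (nkerf (w - \<xi>))"
      unfolding tform_def fock_cinner_nev by (simp add: integral_completion)
    also have "\<dots> = nev (blinfun_apply (weyl \<xi>) (nkerf z)) w"
      unfolding nev_eq_cinner[symmetric] c_def nev_nkerf_hdot nev_weyl_nkerf exp_add[symmetric]
      by (rule arg_cong[of _ _ exp]) (simp add: hdot_simps field_simps)
    finally show "fock_cinner (blinfun_apply (weyl \<xi>) (nkerf z)) (nkerf w)
       = fock_cinner (blinfun_apply (toeplitz g) (nkerf z)) (nkerf w)"
      by (simp add: Linfty_toeplitz(3)[OF g] nev_eq_cinner)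
  qed
  then show ?thesis using that g by blast
qed

section \<open>Coherent-state expansion of an operator\<close>

lemma continuous_on_fock_cinner:
  assumes "continuous_on S f" "continuous_on S g"
  shows "continuous_on S (\<lambda>x. fock_cinner (f x) (g x))"
proof -
  have eq: "fock_cinner a b = of_real (inner a b) + \<i> * of_real (inner a (fock_scaleC \<i> b))" for a b :: "'b fock"
    by (simp add: complex_eq_iff inner_fock_def Im_fock_cinner)
  show ?thesis
    unfolding eq by (intro continuous_intros assms bounded_linear.continuous_on[OF bounded_linear_fock_scaleC])
qed

lemma norm_nkerf_diff: "(norm (nkerf w - nkerf z))\<^sup>2 = 2 - 2 * Re (nev (nkerf z) w)"
proof -
  have s: "fock_cinner (nkerf z) (nkerf z) = 1" for z :: "complex^'a"
    by (simp add: fock_cinner_self)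
  have "complex_of_real ((norm (nkerf w - nkerf z))\<^sup>2) = 2 - (nev (nkerf z) w + cnj (nev (nkerf z) w))"
    unfolding fock_cinner_self[symmetric] nev_eq_cinner
    by (simp add: fock_cinner_diff_left fock_cinner_diff_right s fock_cinner_commute[of "nkerf w" "nkerf z"])
  then show ?thesis by (simp add: complex_eq_iff)
qed

text \<open>The squared distance is 2 minus twice the real part of an overlap, which is continuous.
  This serves the joint measurability of \<open>cker\<close>.\<close>

lemma continuous_on_nkerf: "continuous_on UNIV nkerf"
proof (rule continuous_at_imp_continuous_on, rule ballI)
  fix z :: "complex^'a"
  have one: "nev (nkerf z) z = 1" by (simp add: nev_nkerf hdot_self)
  have "((\<lambda>w. nev (nkerf z) w) \<longlongrightarrow> nev (nkerf z) z) (at z)"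
    using continuous_on_nev[of "nkerf z"] by (simp add: continuous_on_def)
  then have "((\<lambda>w. sqrt (2 - 2 * Re (nev (nkerf z) w))) \<longlongrightarrow> sqrt (2 - 2 * Re 1)) (at z)"
    unfolding one by (intro tendsto_intros)
  moreover have "norm (nkerf w - nkerf z) = sqrt (2 - 2 * Re (nev (nkerf z) w))" for w
    by (rule real_sqrt_unique[symmetric]) (simp_all add: norm_nkerf_diff)
  ultimately have "((\<lambda>w. norm (nkerf w - nkerf z)) \<longlongrightarrow> 0) (at z)" by simp
  then show "isCont nkerf z"
    unfolding isCont_def by (simp add: tendsto_norm_zero_iff LIM_zero_iff)
qed

text \<open>Coefficients of A k_z in the frame W_z k_\<xi>, which is k_(z + \<xi>) up to a phase:
  \<xi> is the displacement from the diagonal, and localization becomes decay in \<xi>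
  alone.\<close>

definition cker :: "('n::finite) fock_op \<Rightarrow> complex^'n \<Rightarrow> complex^'n \<Rightarrow> complex" where
  "cker A z \<xi> = fock_cinner (blinfun_apply A (nkerf z)) (blinfun_apply (weyl z) (nkerf \<xi>))"

lemma cker_eq_nev: "cker A z \<xi> = nev (blinfun_apply (weyl (- z)) (blinfun_apply A (nkerf z))) \<xi>"
  using weyl_adj[of "- z"] by (simp add: cker_def nev_eq_cinner)

lemma cker_measurable: "(\<lambda>p. cker A (fst p) (snd p)) \<in> borel_measurable (borel \<Otimes>\<^sub>M lborel)"
proof -
  have n: "continuous_on UNIV (\<lambda>p. nkerf (h p))" if "continuous_on UNIV h" for h :: "((complex^'a) \<times> (complex^'a)) \<Rightarrow> complex^'a"
    by (rule continuous_on_compose2[OF continuous_on_nkerf that]) simp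
  have eq: "cker A z \<xi> = cnj (exp (- \<i> * of_real (Im (hdot z \<xi>)))) * fock_cinner (blinfun_apply A (nkerf z)) (nkerf (z + \<xi>))" for z \<xi>
    by (simp only: cker_def weyl_nkerf fock_cinner_scale_right)
  have "continuous_on UNIV (\<lambda>p. cker A (fst p) (snd p))"
    unfolding eq by (intro continuous_intros continuous_on_fock_cinner n)
  then have "(\<lambda>p. cker A (fst p) (snd p)) \<in> borel_measurable borel" by (rule borel_measurable_continuous_onI)
  moreover have "sets (borel \<Otimes>\<^sub>M lborel) = sets (borel :: ((complex^'a) \<times> (complex^'a)) measure)"
    unfolding borel_prod[symmetric] by (rule sets_pair_measure_cong) simp_all
  ultimately show ?thesis using measurable_cong_sets by blast
qed

lemma cnj_nev_weyl: "cnj (nev (blinfun_apply (weyl (- z)) g) \<xi>) = fock_cinner (blinfun_apply (weyl z) (nkerf \<xi>)) g"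
  unfolding nev_eq_cinner weyl_adj[of z "nkerf \<xi>"] by (rule fock_cinner_commute[symmetric])

text \<open>The resolution of the identity, conjugated by W_z and applied to A k_z.\<close>

lemma cker_expansion:
  fixes A :: "'n::finite fock_op"
  shows "fock_cinner (blinfun_apply A (nkerf z)) g
      = (\<integral>\<xi>. cker A z \<xi> * fock_cinner (blinfun_apply (weyl z) (nkerf \<xi>)) g \<partial>lborel) / of_real (pi ^ CARD('n))"
    and "integrable lborel (\<lambda>\<xi>. cker A z \<xi> * fock_cinner (blinfun_apply (weyl z) (nkerf \<xi>)) g)"
  unfolding cker_eq_nev cnj_nev_weyl[symmetric]
  using fock_cinner_nev[of "blinfun_apply (weyl (- z)) (blinfun_apply A (nkerf z))" "blinfun_apply (weyl (- z)) g"]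
  by (simp_all add: weyl_isometry integrable_nev)

lemma cmod_cker_le:
  assumes "localized \<gamma> d A"
  shows "cmod (cker A z \<xi>) \<le> d * exp (- \<gamma> * (norm \<xi>)\<^sup>2)"
  using localizedD(4)[OF assms, of z "z + \<xi>"] by (simp add: cker_eq_nev cmod_nev_weyl)

text \<open>Bounds the pairing by a correlation of |nev h| with a translate of |nev g|, which is the
  shape that \<open>Schur_nn_integral\<close> accepts.\<close>

lemma cinner_weyl_le:
  fixes h g :: "'n::finite fock"
  shows "ennreal (cmod (fock_cinner (blinfun_apply (weyl z) h) g))
    \<le> ennreal (1 / pi ^ CARD('n)) * (\<integral>\<^sup>+v. ennreal (cmod (nev h v)) * ennreal (cmod (nev g (z + v))) \<partial>lborel)"
proof -
  let ?I = "\<integral>v. nev h v * cnj (nev (blinfun_apply (weyl (- z)) g) v) \<partial>lborel"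
  have "ennreal (cmod (fock_cinner (blinfun_apply (weyl z) h) g)) = ennreal (1 / pi ^ CARD('n)) * ennreal (cmod ?I)"
    unfolding weyl_adj unfolding fock_cinner_nev by (simp add: norm_divide norm_power flip: ennreal_mult)
  also have "ennreal (cmod ?I) \<le> (\<integral>\<^sup>+v. ennreal (norm (nev h v * cnj (nev (blinfun_apply (weyl (- z)) g) v))) \<partial>lborel)"
    by (rule integral_norm_bound_ennreal[OF integrable_nev])
  finally show ?thesis
    by (simp add: norm_mult cmod_nev_weyl ennreal_mult mult_left_mono)
qed

lemma norm_op_le_cinner:
  assumes "K \<ge> 0" "\<And>f g. cmod (fock_cinner (blinfun_apply X f) g) \<le> K * (norm f * norm g)"
  shows "norm X \<le> K"
proof (rule norm_blinfun_bound[OF assms(1)])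
  fix f
  have "(norm (blinfun_apply X f))\<^sup>2 = cmod (fock_cinner (blinfun_apply X f) (blinfun_apply X f))"
    unfolding fock_cinner_self norm_of_real by simp
  also have "\<dots> \<le> K * (norm f * norm (blinfun_apply X f))" by (rule assms(2))
  finally show "norm (blinfun_apply X f) \<le> K * norm f"
    using assms(1) by (cases "norm (blinfun_apply X f) = 0") (auto simp: power2_eq_square)
qed

lemma cstar_sum:
  assumes "cstar_subalgebra S" "finite R" "\<And>x. x \<in> R \<Longrightarrow> F x \<in> S"
  shows "sum F R \<in> S"
  using assms(2,3) by (induction R rule: finite_induct) (use assms(1) in \<open>auto simp: cstar_subalgebra_def\<close>)

text \<open>An L1 distance of the overlap functions in place of the norm distance of the vectors,
  because Schur's test sees a kernel through its L1 norm.\<close>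

definition kerdist :: "complex^'n::finite \<Rightarrow> complex^'n \<Rightarrow> ennreal" where
  "kerdist \<xi> \<eta> = (\<integral>\<^sup>+v. ennreal (cmod (nev (nkerf \<xi> - nkerf \<eta>) v)) \<partial>lborel)"

lemma exp_phase_split: "exp (- \<i> * of_real x) = exp (- 2 * \<i> * of_real x) * exp (- \<i> * of_real (- x))"
  by (simp flip: exp_add)

text \<open>Exchanges the roles of z and \<eta>: when \<eta> runs through a finite set, the variable
  z leaves the Weyl operator and the phase joins the symbol.\<close>

lemma weyl_nkerf_swap:
  "blinfun_apply (weyl z) (nkerf \<eta>) = fock_scaleC (exp (- 2 * \<i> * of_real (Im (hdot z \<eta>)))) (blinfun_apply (weyl \<eta>) (nkerf z))"
proof -
  have "Im (hdot \<eta> z) = - Im (hdot z \<eta>)" unfolding cnj_hdot[of z \<eta>, symmetric] by simp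
  then show ?thesis
    unfolding weyl_nkerf fock_scaleC_scaleC by (simp only: exp_phase_split[of "Im (hdot z \<eta>)"] add.commute)
qed


text \<open>With k_\<xi> frozen to k_(s \<xi>) in the expansion of A k_z, the integral over each
  fibre of s only produces a scalar depending on z. Inserted into the expansion of f over k_z, and
  after \<open>weyl_nkerf_swap\<close>, this is a finite sum of Weyl operators composed with
  Toeplitz operators; \<open>E\<close> is the L1 norm of the Schur kernel of the error.\<close>

lemma localized_approx:
  fixes A :: "'n::finite fock_op" and s :: "complex^'n \<Rightarrow> complex^'n"
  assumes S: "cstar_subalgebra S" "\<And>f. f \<in> Linfty \<Longrightarrow> toeplitz f \<in> S"
    and A: "localized \<gamma> d A" and s: "simple_function lborel s"
  defines "E \<equiv> (\<integral>\<^sup>+\<xi>. ennreal (exp (- \<gamma> * (norm \<xi>)\<^sup>2)) * kerdist \<xi> (s \<xi>) \<partial>lborel)"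
  assumes fin: "E < \<infinity>"
  shows "\<exists>B\<in>S. norm (A - B) \<le> d / (pi ^ CARD('n))\<^sup>2 * enn2real E"
proof -
  let ?N = "pi ^ CARD('n)"
  note L = localizedD[OF A]
  have [measurable]: "s \<in> borel_measurable borel" using borel_measurable_simple_function[OF s] by simp
  define R where "R = range s"
  have R: "finite R" using simple_functionD(1)[OF s] by (simp add: R_def)
  \<comment> \<open>Indicator of the fibre of s over \<eta>; the fibres split the \<xi> integral
    into finitely many pieces.\<close>
  define u where "u \<eta> \<xi> = indicat_real {\<eta>} (s \<xi>)" for \<eta> \<xi>
  have [measurable]: "u \<eta> \<in> borel_measurable borel" for \<eta>
    unfolding u_def by (rule measurable_compose[where N = borel]) (auto intro!: borel_measurable_indicator)
  have u_le: "cmod (of_real (u \<eta> \<xi>)) \<le> 1" for \<eta> \<xi> by (simp add: u_def indicator_def)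
  have [measurable]: "cker A z \<in> borel_measurable borel" for z
    unfolding cker_eq_nev[abs_def] by measurable
  define \<psi> where "\<psi> \<eta> z = (\<integral>\<xi>. of_real (u \<eta> \<xi>) * cker A z \<xi> \<partial>lborel) / of_real ?N" for \<eta> z
  have int_g: "integrable lborel (\<lambda>\<xi>::complex^'n. K * exp (- \<gamma> * (norm \<xi>)\<^sup>2))" for K :: real
    by (intro integrable_mult_right integrable_gaussian L(2))
  have int_u: "integrable lborel (\<lambda>\<xi>. of_real (u \<eta> \<xi>) * cker A z \<xi>)" for \<eta> z
  proof (rule Bochner_Integration.integrable_bound[OF int_g[of d]])
    have "norm (of_real (u \<eta> \<xi>) * cker A z \<xi>) \<le> 1 * (d * exp (- \<gamma> * (norm \<xi>)\<^sup>2))" for \<xi>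
      unfolding norm_mult by (intro mult_mono u_le cmod_cker_le[OF A]) auto
    then show "AE \<xi> in lborel. norm (of_real (u \<eta> \<xi>) * cker A z \<xi>) \<le> norm (d * exp (- \<gamma> * (norm \<xi>)\<^sup>2))"
      using L(3) by (intro AE_I2) simp
  qed measurable
  have \<psi>_bound: "cmod (\<psi> \<eta> z) \<le> d * Gint TYPE('n) \<gamma>" for \<eta> z
    unfolding \<psi>_def
  proof (rule norm_integral_gaussian_le[OF int_u L(2), where z = 0])
    fix \<xi> :: "complex^'n"
    have "norm (of_real (u \<eta> \<xi>) * cker A z \<xi>) \<le> 1 * (d * exp (- \<gamma> * (norm \<xi>)\<^sup>2))"
      unfolding norm_mult by (intro mult_mono u_le cmod_cker_le[OF A]) auto
    then show "norm (of_real (u \<eta> \<xi>) * cker A z \<xi>) \<le> d * exp (- \<gamma> * (norm (\<xi> - 0))\<^sup>2)" by simp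
  qed
  have \<psi>_meas[measurable]: "\<psi> \<eta> \<in> borel_measurable borel" for \<eta>
  proof -
    note [measurable] = cker_measurable[of A]
    have "(\<lambda>(z, \<xi>). of_real (u \<eta> \<xi>) * cker A z \<xi>) \<in> borel_measurable (borel \<Otimes>\<^sub>M lborel)"
      unfolding split_beta' by measurable
    from lborel.borel_measurable_lebesgue_integral[OF this]
    show ?thesis unfolding \<psi>_def by measurable
  qed
  \<comment> \<open>The phase of \<open>weyl_nkerf_swap\<close>; it has modulus 1, so the symbol
    \<phi> is as bounded as \<psi>.\<close>
  define p where "p \<eta> z = exp (- 2 * \<i> * of_real (Im (hdot z \<eta>)))" for \<eta> z :: "complex^'n"
  have [measurable]: "p \<eta> \<in> borel_measurable borel" for \<eta>
    unfolding p_def by (intro borel_measurable_continuous_onI continuous_intros)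
  define \<phi> where "\<phi> \<eta> z = \<psi> \<eta> z * p \<eta> z" for \<eta> z
  have \<phi>_meas[measurable]: "\<phi> \<eta> \<in> borel_measurable borel" for \<eta>
    unfolding \<phi>_def by measurable
  have "cmod (\<phi> \<eta> z) \<le> d * Gint TYPE('n) \<gamma>" for \<eta> z
    using \<psi>_bound[of \<eta> z] by (simp add: \<phi>_def p_def norm_mult norm_exp_eq_Re)
  then have \<phi>: "\<phi> \<eta> \<in> Linfty" for \<eta> by (rule bounded_Linfty[OF \<phi>_meas])
  define B where "B = (\<Sum>\<eta>\<in>R. weyl \<eta> o\<^sub>L toeplitz (\<phi> \<eta>))"
  have "weyl \<eta> \<in> S" for \<eta> using weyl_eq_toeplitz[of \<eta>] S(2) by metis
  then have BS: "B \<in> S"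
    unfolding B_def using S \<phi> R by (intro cstar_sum[OF S(1)]) (auto simp: cstar_subalgebra_def)
  let ?c = "\<lambda>z \<eta> g. fock_cinner (blinfun_apply (weyl z) (nkerf \<eta>)) g"
  \<comment> \<open>Here the Weyl operator with the variable index z is traded for the one with the
    fixed index \<eta>.\<close>
  have integrand: "\<phi> \<eta> z * nev f z * cnj (nev (blinfun_apply (weyl (- \<eta>)) g) z) = nev f z * (\<psi> \<eta> z * ?c z \<eta> g)" for \<eta> z f g
  proof -
    have "p \<eta> z * ?c \<eta> z g = ?c z \<eta> g"
      unfolding weyl_nkerf_swap[of z \<eta>] fock_cinner_scale_left p_def ..
    then show ?thesis unfolding cnj_nev_weyl \<phi>_def by (metis mult.commute mult.left_commute)
  qed
  have part: "fock_cinner (blinfun_apply (weyl \<eta> o\<^sub>L toeplitz (\<phi> \<eta>)) f) g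
      = (\<integral>z. nev f z * (\<psi> \<eta> z * ?c z \<eta> g) \<partial>lborel) / of_real ?N"
    and part_int: "integrable lborel (\<lambda>z. nev f z * (\<psi> \<eta> z * ?c z \<eta> g))" for \<eta> f g
  proof -
    have "(\<lambda>z. \<phi> \<eta> z * nev f z * cnj (nev (blinfun_apply (weyl (- \<eta>)) g) z)) \<in> borel_measurable lborel"
      by measurable
    then have m: "(\<lambda>z. nev f z * (\<psi> \<eta> z * ?c z \<eta> g)) \<in> borel_measurable lborel"
      by (simp only: integrand)
    have "fock_cinner (blinfun_apply (weyl \<eta> o\<^sub>L toeplitz (\<phi> \<eta>)) f) g = tform (\<phi> \<eta>) f (blinfun_apply (weyl (- \<eta>)) g)"
      by (simp only: blinfun_apply_blinfun_compose weyl_adj Linfty_toeplitz(3)[OF \<phi>])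
    also have "\<dots> = (\<integral>z. nev f z * (\<psi> \<eta> z * ?c z \<eta> g) \<partial>lborel) / of_real ?N"
      unfolding tform_def integrand integral_completion[OF m] ..
    finally show "fock_cinner (blinfun_apply (weyl \<eta> o\<^sub>L toeplitz (\<phi> \<eta>)) f) g
      = (\<integral>z. nev f z * (\<psi> \<eta> z * ?c z \<eta> g) \<partial>lborel) / of_real ?N" .
    \<comment> \<open>A Carleson constant for the bounded symbol is obtained through BMO; it yields
      integrability of the form.\<close>
    obtain C where "carleson C (\<phi> \<eta>)"
      using BMO_carleson[OF Linfty_BMO[OF \<phi>] Linfty_toeplitz_symbol[OF \<phi>] Linfty_toeplitz(1)[OF \<phi>]] by blast
    from carleson_form(1)[OF this, of f "blinfun_apply (weyl (- \<eta>)) g"]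
    show "integrable lborel (\<lambda>z. nev f z * (\<psi> \<eta> z * ?c z \<eta> g))"
      by (simp only: integrand integrable_completion[OF m])
  qed
  have int_s: "integrable lborel (\<lambda>\<xi>. cker A z \<xi> * ?c z (s \<xi>) g)" for z g
  proof (rule Bochner_Integration.integrable_bound[OF int_g[of "d * norm g"]])
    show "(\<lambda>\<xi>. cker A z \<xi> * ?c z (s \<xi>) g) \<in> borel_measurable lborel"
      unfolding cnj_nev_weyl[symmetric] by measurable
    have "norm (cker A z \<xi> * ?c z (s \<xi>) g) \<le> (d * exp (- \<gamma> * (norm \<xi>)\<^sup>2)) * norm g" for \<xi>
      unfolding norm_mult
      using cmod_fock_cinner_le[of "blinfun_apply (weyl z) (nkerf (s \<xi>))" g] L(3)
      by (intro mult_mono cmod_cker_le[OF A]) (auto simp: norm_weyl)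
    then show "AE \<xi> in lborel. norm (cker A z \<xi> * ?c z (s \<xi>) g) \<le> norm (d * norm g * exp (- \<gamma> * (norm \<xi>)\<^sup>2))"
      using L(3) by (intro AE_I2) (simp add: abs_mult mult_ac)
  qed
  have sum_\<psi>: "(\<Sum>\<eta>\<in>R. \<psi> \<eta> z * ?c z \<eta> g) = (\<integral>\<xi>. cker A z \<xi> * ?c z (s \<xi>) g \<partial>lborel) / of_real ?N" for z g
  proof -
    have "(\<Sum>\<eta>\<in>R. \<psi> \<eta> z * ?c z \<eta> g) = (\<Sum>\<eta>\<in>R. (\<integral>\<xi>. of_real (u \<eta> \<xi>) * cker A z \<xi> * ?c z \<eta> g \<partial>lborel)) / of_real ?N"
      by (simp add: \<psi>_def sum_divide_distrib)
    also have "(\<Sum>\<eta>\<in>R. (\<integral>\<xi>. of_real (u \<eta> \<xi>) * cker A z \<xi> * ?c z \<eta> g \<partial>lborel))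
      = (\<integral>\<xi>. (\<Sum>\<eta>\<in>R. of_real (u \<eta> \<xi>) * cker A z \<xi> * ?c z \<eta> g) \<partial>lborel)"
      by (rule Bochner_Integration.integral_sum[symmetric]) (intro integrable_mult_left int_u)
    also have "(\<lambda>\<xi>. \<Sum>\<eta>\<in>R. of_real (u \<eta> \<xi>) * cker A z \<xi> * ?c z \<eta> g) = (\<lambda>\<xi>. cker A z \<xi> * ?c z (s \<xi>) g)"
    proof
      fix \<xi>
      have "(\<Sum>\<eta>\<in>R. of_real (u \<eta> \<xi>) * cker A z \<xi> * ?c z \<eta> g) = (\<Sum>\<eta>\<in>R. if \<eta> = s \<xi> then cker A z \<xi> * ?c z \<eta> g else 0)"
        by (intro sum.cong) (auto simp: u_def indicator_def)
      then show "(\<Sum>\<eta>\<in>R. of_real (u \<eta> \<xi>) * cker A z \<xi> * ?c z \<eta> g) = cker A z \<xi> * ?c z (s \<xi>) g"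
        using R by (simp add: R_def)
    qed
    finally show ?thesis .
  qed
  \<comment> \<open>The error at k_z, paired with g: in the expansion of A k_z each k_\<xi> is
    replaced by its difference from k_(s \<xi>).\<close>
  define D where "D g z = (\<integral>\<xi>. cker A z \<xi> * fock_cinner (blinfun_apply (weyl z) (nkerf \<xi> - nkerf (s \<xi>))) g \<partial>lborel) / of_real ?N" for g z
  have D: "fock_cinner (blinfun_apply A (nkerf z)) g - (\<Sum>\<eta>\<in>R. \<psi> \<eta> z * ?c z \<eta> g) = D g z" for z g
    unfolding sum_\<psi> D_def cker_expansion(1)[of A z g] blinfun.diff_right fock_cinner_diff_left right_diff_distrib
      Bochner_Integration.integral_diff[OF cker_expansion(2) int_s] diff_divide_distrib ..
  have diff: "fock_cinner (blinfun_apply (A - B) f) g = (\<integral>z. nev f z * D g z \<partial>lborel) / of_real ?N" 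
    and int_D: "integrable lborel (\<lambda>z. nev f z * D g z)" for f g
  proof -
    have 1: "fock_cinner (blinfun_apply B f) g = (\<integral>z. (\<Sum>\<eta>\<in>R. nev f z * (\<psi> \<eta> z * ?c z \<eta> g)) \<partial>lborel) / of_real ?N"
    proof -
      have "fock_cinner (sum F R') g = (\<Sum>\<eta>\<in>R'. fock_cinner (F \<eta>) g)" if "finite R'" for F :: "complex^'n \<Rightarrow> 'n fock" and R'
        using that by (induction R' rule: finite_induct) (simp_all add: fock_cinner_add_left)
      then have "fock_cinner (blinfun_apply B f) g = (\<Sum>\<eta>\<in>R. fock_cinner (blinfun_apply (weyl \<eta> o\<^sub>L toeplitz (\<phi> \<eta>)) f) g)"
        using R by (simp only: B_def blinfun.sum_left)
      also have "\<dots> = (\<Sum>\<eta>\<in>R. (\<integral>z. nev f z * (\<psi> \<eta> z * ?c z \<eta> g) \<partial>lborel)) / of_real ?N"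
        by (simp only: part sum_divide_distrib)
      also have "(\<Sum>\<eta>\<in>R. (\<integral>z. nev f z * (\<psi> \<eta> z * ?c z \<eta> g) \<partial>lborel)) = (\<integral>z. (\<Sum>\<eta>\<in>R. nev f z * (\<psi> \<eta> z * ?c z \<eta> g)) \<partial>lborel)"
        by (rule Bochner_Integration.integral_sum[symmetric]) (rule part_int)
      finally show ?thesis .
    qed
    have 2: "integrable lborel (\<lambda>z. \<Sum>\<eta>\<in>R. nev f z * (\<psi> \<eta> z * ?c z \<eta> g))"
      by (rule Bochner_Integration.integrable_sum) (rule part_int)
    note 3 = op_nev(2)[OF L(1), of f g]
    have 4: "nev f z * fock_cinner (blinfun_apply A (nkerf z)) g - (\<Sum>\<eta>\<in>R. nev f z * (\<psi> \<eta> z * ?c z \<eta> g)) = nev f z * D g z" for z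
      unfolding D[symmetric] by (simp only: sum_distrib_left right_diff_distrib)
    show "integrable lborel (\<lambda>z. nev f z * D g z)"
      using Bochner_Integration.integrable_diff[OF 3 2] by (simp only: 4)
    have "fock_cinner (blinfun_apply (A - B) f) g = fock_cinner (blinfun_apply A f) g - fock_cinner (blinfun_apply B f) g"
      by (simp only: blinfun.diff_left fock_cinner_diff_left)
    also have "\<dots> = (\<integral>z. nev f z * D g z \<partial>lborel) / of_real ?N"
      unfolding 1 op_nev(1)[OF L(1), of f g] diff_divide_distrib[symmetric]
        Bochner_Integration.integral_diff[OF 3 2, symmetric] 4 ..
    finally show "fock_cinner (blinfun_apply (A - B) f) g = (\<integral>z. nev f z * D g z \<partial>lborel) / of_real ?N" .
  qed
  \<comment> \<open>The Schur kernel: it dominates the error for all z at once, because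
    \<open>cmod_cker_le\<close> is independent of z.\<close>
  define \<Phi> where "\<Phi> v = (\<integral>\<^sup>+\<xi>. ennreal (exp (- \<gamma> * (norm \<xi>)\<^sup>2)) * ennreal (cmod (nev (nkerf \<xi> - nkerf (s \<xi>)) v)) \<partial>lborel)" for v
  let ?F = "\<lambda>\<xi> v. ennreal (exp (- \<gamma> * (norm \<xi>)\<^sup>2)) * ennreal (cmod (nev (nkerf \<xi> - nkerf (s \<xi>)) v))"
  have F_meas: "(\<lambda>(\<xi>, v). ?F \<xi> v) \<in> borel_measurable (lborel \<Otimes>\<^sub>M lborel)"
    unfolding nev_diff nev_nkerf_hdot by measurable
  then have F_meas': "(\<lambda>(v, \<xi>). ?F \<xi> v) \<in> borel_measurable (lborel \<Otimes>\<^sub>M lborel)"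
    unfolding nev_diff nev_nkerf_hdot by measurable
  have \<Phi>_meas[measurable]: "\<Phi> \<in> borel_measurable borel"
    unfolding \<Phi>_def using lborel.borel_measurable_nn_integral[OF F_meas'] by simp
  have \<Phi>_E: "(\<integral>\<^sup>+v. \<Phi> v \<partial>lborel) = E"
  proof -
    have "(\<integral>\<^sup>+v. \<Phi> v \<partial>lborel) = (\<integral>\<^sup>+\<xi>. (\<integral>\<^sup>+v. ?F \<xi> v \<partial>lborel) \<partial>lborel)"
      unfolding \<Phi>_def by (rule lborel_pair.Fubini'[OF F_meas])
    also have "\<dots> = E"
      unfolding E_def kerdist_def by (intro nn_integral_cong nn_integral_cmult) measurable
    finally show ?thesis .
  qed
  \<comment> \<open>Of the two factors 1 / N, one is from the expansion of A k_z and the other from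
    \<open>cinner_weyl_le\<close>.\<close>
  have D_le: "ennreal (cmod (D g z)) \<le> ennreal (d / ?N\<^sup>2) * (\<integral>\<^sup>+v. \<Phi> v * ennreal (cmod (nev g (z + v))) \<partial>lborel)" for g z
  proof -
    let ?h = "\<lambda>\<xi>. nkerf \<xi> - nkerf (s \<xi>)"
    have int: "integrable lborel (\<lambda>\<xi>. cker A z \<xi> * fock_cinner (blinfun_apply (weyl z) (?h \<xi>)) g)"
      unfolding blinfun.diff_right fock_cinner_diff_left right_diff_distrib
      by (intro Bochner_Integration.integrable_diff cker_expansion(2) int_s)
    have "ennreal (cmod (D g z)) = ennreal (1 / ?N) * ennreal (cmod (\<integral>\<xi>. cker A z \<xi> * fock_cinner (blinfun_apply (weyl z) (?h \<xi>)) g \<partial>lborel))"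
      by (simp add: D_def norm_divide norm_power flip: ennreal_mult)
    also have "\<dots> \<le> ennreal (1 / ?N) * (\<integral>\<^sup>+\<xi>. ennreal (norm (cker A z \<xi> * fock_cinner (blinfun_apply (weyl z) (?h \<xi>)) g)) \<partial>lborel)"
      by (intro mult_left_mono integral_norm_bound_ennreal[OF int]) simp
    also have "\<dots> \<le> ennreal (1 / ?N) * (\<integral>\<^sup>+\<xi>. ennreal (d / ?N) * (\<integral>\<^sup>+v. ?F \<xi> v * ennreal (cmod (nev g (z + v))) \<partial>lborel) \<partial>lborel)"
    proof (intro mult_left_mono nn_integral_mono)
      fix \<xi>
      have "ennreal (norm (cker A z \<xi> * fock_cinner (blinfun_apply (weyl z) (?h \<xi>)) g))
        = ennreal (cmod (cker A z \<xi>)) * ennreal (cmod (fock_cinner (blinfun_apply (weyl z) (?h \<xi>)) g))"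
        by (simp add: norm_mult ennreal_mult)
      also have "\<dots> \<le> ennreal (d * exp (- \<gamma> * (norm \<xi>)\<^sup>2)) *
         (ennreal (1 / ?N) * (\<integral>\<^sup>+v. ennreal (cmod (nev (?h \<xi>) v)) * ennreal (cmod (nev g (z + v))) \<partial>lborel))"
        by (intro mult_mono ennreal_leI cmod_cker_le[OF A] cinner_weyl_le) auto
      also have "\<dots> = ennreal (d / ?N) * (ennreal (exp (- \<gamma> * (norm \<xi>)\<^sup>2)) *
          (\<integral>\<^sup>+v. ennreal (cmod (nev (?h \<xi>) v)) * ennreal (cmod (nev g (z + v))) \<partial>lborel))"
        using L(3) by (simp add: ennreal_mult mult_ac divide_ennreal[symmetric] ennreal_divide_times divide_ennreal_def)
      also have "ennreal (exp (- \<gamma> * (norm \<xi>)\<^sup>2)) * (\<integral>\<^sup>+v. ennreal (cmod (nev (?h \<xi>) v)) * ennreal (cmod (nev g (z + v))) \<partial>lborel)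
         = (\<integral>\<^sup>+v. ?F \<xi> v * ennreal (cmod (nev g (z + v))) \<partial>lborel)"
        by (subst nn_integral_cmult[symmetric]) (auto simp: mult.assoc)
      finally show "ennreal (norm (cker A z \<xi> * fock_cinner (blinfun_apply (weyl z) (?h \<xi>)) g))
         \<le> ennreal (d / ?N) * (\<integral>\<^sup>+v. ?F \<xi> v * ennreal (cmod (nev g (z + v))) \<partial>lborel)" .
    qed simp
    also have "(\<integral>\<^sup>+\<xi>. ennreal (d / ?N) * (\<integral>\<^sup>+v. ?F \<xi> v * ennreal (cmod (nev g (z + v))) \<partial>lborel) \<partial>lborel)
      = ennreal (d / ?N) * (\<integral>\<^sup>+\<xi>. (\<integral>\<^sup>+v. ?F \<xi> v * ennreal (cmod (nev g (z + v))) \<partial>lborel) \<partial>lborel)"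
      unfolding nev_diff nev_nkerf_hdot by (rule nn_integral_cmult) measurable
    also have "(\<integral>\<^sup>+\<xi>. (\<integral>\<^sup>+v. ?F \<xi> v * ennreal (cmod (nev g (z + v))) \<partial>lborel) \<partial>lborel)
      = (\<integral>\<^sup>+v. (\<integral>\<^sup>+\<xi>. ?F \<xi> v * ennreal (cmod (nev g (z + v))) \<partial>lborel) \<partial>lborel)"
      unfolding nev_diff nev_nkerf_hdot[of "_ :: complex^'n"] by (rule lborel_pair.Fubini'[symmetric]) measurable
    also have "\<dots> = (\<integral>\<^sup>+v. \<Phi> v * ennreal (cmod (nev g (z + v))) \<partial>lborel)"
    proof (rule nn_integral_cong)
      fix v
      have "(\<lambda>\<xi>. ?F \<xi> v) \<in> borel_measurable lborel" unfolding nev_diff nev_nkerf_hdot by measurable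
      then show "(\<integral>\<^sup>+\<xi>. ?F \<xi> v * ennreal (cmod (nev g (z + v))) \<partial>lborel) = \<Phi> v * ennreal (cmod (nev g (z + v)))"
        unfolding \<Phi>_def by (rule nn_integral_multc)
    qed
    also have "ennreal (1 / ?N) * (ennreal (d / ?N) * (\<integral>\<^sup>+v. \<Phi> v * ennreal (cmod (nev g (z + v))) \<partial>lborel))
       = ennreal (d / ?N\<^sup>2) * (\<integral>\<^sup>+v. \<Phi> v * ennreal (cmod (nev g (z + v))) \<partial>lborel)"
      using L(3) by (simp add: mult.assoc[symmetric] power2_eq_square flip: ennreal_mult)
    finally show ?thesis .
  qed
  have E: "E = ennreal (enn2real E)" using fin by simp
  have "norm (A - B) \<le> d / ?N\<^sup>2 * enn2real E"
  proof (rule norm_op_le_cinner)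
    show K: "0 \<le> d / ?N\<^sup>2 * enn2real E" using L(3) by simp
    fix f g
    have "ennreal (cmod (fock_cinner (blinfun_apply (A - B) f) g)) = ennreal (1 / ?N) * ennreal (cmod (\<integral>z. nev f z * D g z \<partial>lborel))"
      by (simp add: diff norm_divide norm_power flip: ennreal_mult)
    also have "\<dots> \<le> ennreal (1 / ?N) * (\<integral>\<^sup>+z. ennreal (norm (nev f z * D g z)) \<partial>lborel)"
      by (intro mult_left_mono integral_norm_bound_ennreal[OF int_D]) simp
    also have "\<dots> \<le> ennreal (1 / ?N) * (\<integral>\<^sup>+z. ennreal (d / ?N\<^sup>2) *
        (ennreal (cmod (nev f z)) * (\<integral>\<^sup>+v. \<Phi> v * ennreal (cmod (nev g (z + v))) \<partial>lborel)) \<partial>lborel)"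
    proof (intro mult_left_mono nn_integral_mono)
      fix z
      have "ennreal (norm (nev f z * D g z)) = ennreal (cmod (nev f z)) * ennreal (cmod (D g z))"
        by (simp add: norm_mult ennreal_mult)
      also have "\<dots> \<le> ennreal (cmod (nev f z)) * (ennreal (d / ?N\<^sup>2) * (\<integral>\<^sup>+v. \<Phi> v * ennreal (cmod (nev g (z + v))) \<partial>lborel))"
        by (intro mult_left_mono D_le) simp
      finally show "ennreal (norm (nev f z * D g z)) \<le> ennreal (d / ?N\<^sup>2) *
        (ennreal (cmod (nev f z)) * (\<integral>\<^sup>+v. \<Phi> v * ennreal (cmod (nev g (z + v))) \<partial>lborel))" by (simp only: mult_ac)
    qed simp
    also have "\<dots> = ennreal (1 / ?N) * (ennreal (d / ?N\<^sup>2) *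
        (\<integral>\<^sup>+z. ennreal (cmod (nev f z)) * (\<integral>\<^sup>+v. \<Phi> v * ennreal (cmod (nev g (z + v))) \<partial>lborel) \<partial>lborel))"
      by (subst nn_integral_cmult) auto
    also have "\<dots> \<le> ennreal (1 / ?N) * (ennreal (d / ?N\<^sup>2) *
        ((\<integral>\<^sup>+v. \<Phi> v \<partial>lborel) * ennreal ((sqrt ?N * norm f) * (sqrt ?N * norm g))))"
      by (intro mult_left_mono Schur_nn_integral) (auto simp: nn_integral_nev_square)
    also have "\<dots> = ennreal (1 / ?N * (d / ?N\<^sup>2 * (enn2real E * ((sqrt ?N * norm f) * (sqrt ?N * norm g)))))"
    proof -
      have "ennreal a * (ennreal b * (ennreal c * ennreal e)) = ennreal (a * (b * (c * e)))"
        if "a \<ge> 0" "b \<ge> 0" "c \<ge> 0" "e \<ge> 0" for a b c e using that by (simp add: ennreal_mult)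
      then show ?thesis unfolding \<Phi>_E by (subst E) (use L(3) in simp)
    qed
    \<comment> \<open>Each sqrt N comes from the L2 norm of a \<open>nev\<close> function; together
      they cancel the 1 / N of the expansion of f.\<close>
    also have "1 / ?N * (d / ?N\<^sup>2 * (enn2real E * ((sqrt ?N * norm f) * (sqrt ?N * norm g)))) = d / ?N\<^sup>2 * enn2real E * (norm f * norm g)"
    proof -
      have "1 / ?N * (d / ?N\<^sup>2 * (enn2real E * ((sqrt ?N * norm f) * (sqrt ?N * norm g))))
         = (sqrt ?N * sqrt ?N / ?N) * (d / ?N\<^sup>2 * enn2real E * (norm f * norm g))"
      proof -
        have "1 / n * (c / m * (e * ((a * x) * (a * y)))) = (a * a / n) * (c / m * e * (x * y))" for n c m e a x y :: real
          by (simp add: mult_ac)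
        then show ?thesis .
      qed
      also have "sqrt ?N * sqrt ?N / ?N = 1" by (simp flip: power2_eq_square)
      finally show ?thesis by simp
    qed
    finally show "cmod (fock_cinner (blinfun_apply (A - B) f) g) \<le> d / ?N\<^sup>2 * enn2real E * (norm f * norm g)"
      by (simp only: ennreal_le_iff[OF mult_nonneg_nonneg[OF K mult_nonneg_nonneg[OF norm_ge_zero norm_ge_zero]]])
  qed
  then show ?thesis using BS by blast
qed


section \<open>Convergence of the approximations\<close>

lemma nn_integral_gaussian_shift:
  fixes \<xi> :: "'a::euclidean_space"
  assumes "t > 0"
  shows "(\<integral>\<^sup>+v. ennreal (exp (- (norm (v - \<xi>))\<^sup>2 / t)) \<partial>lborel) = ennreal (sqrt (pi * t) ^ DIM('a))"
  using nn_integral_lborel_shift[of "\<lambda>v. ennreal (exp (- (norm v)\<^sup>2 / t))" "- \<xi>"] nn_integral_gaussian[OF assms, where 'a='a]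
  by simp

lemma kerdist_measurable [measurable]:
  assumes [measurable]: "s \<in> borel_measurable borel"
  shows "(\<lambda>\<xi>. kerdist \<xi> (s \<xi>)) \<in> borel_measurable borel"
proof -
  have "(\<lambda>(\<xi>, v). ennreal (cmod (nev (nkerf \<xi> - nkerf (s \<xi>)) v))) \<in> borel_measurable (borel \<Otimes>\<^sub>M lborel)"
    unfolding nev_diff nev_nkerf_hdot by measurable
  from lborel.borel_measurable_nn_integral[OF this] show ?thesis unfolding kerdist_def by simp
qed

lemma cmod_nev_nkerf_diff_le:
  "cmod (nev (nkerf \<xi> - nkerf \<eta>) v) \<le> exp (- (norm (v - \<xi>))\<^sup>2 / 2) + exp (- (norm (v - \<eta>))\<^sup>2 / 2)"
  unfolding nev_diff using norm_triangle_ineq4[of "nev (nkerf \<xi>) v" "nev (nkerf \<eta>) v"]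
  by (simp add: cmod_nev_nkerf norm_minus_commute)

text \<open>Uniform in both arguments, so it makes \<open>E\<close> finite and provides the majorant
  for dominated convergence in \<xi>.\<close>

lemma kerdist_le: "kerdist \<xi> \<eta> \<le> ennreal (2 * sqrt (pi * 2) ^ DIM(complex^'n))"
  for \<xi> :: "complex^'n::finite"
proof -
  have "kerdist \<xi> \<eta> \<le> (\<integral>\<^sup>+v. ennreal (exp (- (norm (v - \<xi>))\<^sup>2 / 2)) + ennreal (exp (- (norm (v - \<eta>))\<^sup>2 / 2)) \<partial>lborel)"
    unfolding kerdist_def
  proof (rule nn_integral_mono)
    fix v
    show "ennreal (cmod (nev (nkerf \<xi> - nkerf \<eta>) v))
      \<le> ennreal (exp (- (norm (v - \<xi>))\<^sup>2 / 2)) + ennreal (exp (- (norm (v - \<eta>))\<^sup>2 / 2))"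
      using ennreal_leI[OF cmod_nev_nkerf_diff_le[of \<xi> \<eta> v]] by (simp only: ennreal_plus exp_ge_zero)
  qed
  also have "\<dots> = (\<integral>\<^sup>+v. ennreal (exp (- (norm (v - \<xi>))\<^sup>2 / 2)) \<partial>lborel) + (\<integral>\<^sup>+v. ennreal (exp (- (norm (v - \<eta>))\<^sup>2 / 2)) \<partial>lborel)"
    by (rule nn_integral_add) measurable
  also have "\<dots> = ennreal (2 * sqrt (pi * 2) ^ DIM(complex^'n))"
    unfolding nn_integral_gaussian_shift[OF zero_less_numeral] by (simp only: mult_2 ennreal_plus[symmetric] zero_le_power real_sqrt_ge_zero pi_ge_zero mult_nonneg_nonneg zero_le_numeral)
  finally show ?thesis .
qed

text \<open>The overlap functions converge pointwise, and boundedness of X gives them a common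
  Gaussian majorant.\<close>

lemma kerdist_tendsto_0:
  fixes \<xi> :: "complex^'n::finite"
  assumes "X \<longlonglongrightarrow> \<xi>"
  shows "(\<lambda>i. kerdist \<xi> (X i)) \<longlonglongrightarrow> 0"
proof -
  have "(\<lambda>i. norm (X i - \<xi>)) \<longlonglongrightarrow> 0" using assms by (simp add: tendsto_norm_zero_iff LIM_zero_iff)
  then have "Bseq (\<lambda>i. norm (X i - \<xi>))" using convergentI convergent_imp_Bseq by blast
  then obtain R where R: "\<And>i. norm (X i - \<xi>) \<le> R" unfolding Bseq_def by auto
  \<comment> \<open>From |v - \<xi>|^2 <= 2 |v - X i|^2 + 2 R^2 come both the 4 in the exponent and
    the constant exp (R^2 / 2).\<close>
  let ?w = "\<lambda>v. ennreal ((1 + exp (R\<^sup>2 / 2)) * exp (- (norm (v - \<xi>))\<^sup>2 / 4))"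
  have "(\<lambda>i. (\<integral>\<^sup>+v. ennreal (cmod (nev (nkerf \<xi> - nkerf (X i)) v)) \<partial>lborel)) \<longlonglongrightarrow> (\<integral>\<^sup>+(v::complex^'n). 0 \<partial>lborel)"
  proof (rule nn_integral_dominated_convergence[where w = ?w])
    show "AE v in lborel. ennreal (cmod (nev (nkerf \<xi> - nkerf (X i)) v)) \<le> ?w v" for i
    proof (intro AE_I2 ennreal_leI)
      fix v
      have "exp (- (norm (v - \<xi>))\<^sup>2 / 2) \<le> exp (- (norm (v - \<xi>))\<^sup>2 / 4)" by simp
      moreover have "exp (- (norm (v - X i))\<^sup>2 / 2) \<le> exp (R\<^sup>2 / 2) * exp (- (norm (v - \<xi>))\<^sup>2 / 4)"
      proof -
        have "(norm (v - \<xi>))\<^sup>2 \<le> 2 * (norm (v - X i))\<^sup>2 + 2 * (norm (X i - \<xi>))\<^sup>2" by (rule norm_diff_square_le)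
        moreover have "(norm (X i - \<xi>))\<^sup>2 \<le> R\<^sup>2" by (intro power_mono R) simp
        ultimately show ?thesis by (simp flip: exp_add)
      qed
      ultimately show "cmod (nev (nkerf \<xi> - nkerf (X i)) v) \<le> (1 + exp (R\<^sup>2 / 2)) * exp (- (norm (v - \<xi>))\<^sup>2 / 4)"
        unfolding distrib_right mult_1 using cmod_nev_nkerf_diff_le[of \<xi> "X i" v] by linarith
    qed
    have "(\<integral>\<^sup>+v. ?w v \<partial>lborel) = ennreal (1 + exp (R\<^sup>2 / 2)) * (\<integral>\<^sup>+v. ennreal (exp (- (norm (v - \<xi>))\<^sup>2 / 4)) \<partial>lborel)"
      by (subst nn_integral_cmult[symmetric]) (auto simp: ennreal_mult)
    also have "\<dots> < \<infinity>"
      unfolding nn_integral_gaussian_shift[OF zero_less_numeral] by (simp add: ennreal_mult_less_top)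
    finally show "(\<integral>\<^sup>+v. ?w v \<partial>lborel) < \<infinity>" .
    show "AE v in lborel. (\<lambda>i. ennreal (cmod (nev (nkerf \<xi> - nkerf (X i)) v))) \<longlonglongrightarrow> 0"
    proof (rule AE_I2)
      fix v :: "complex^'n"
      \<comment> \<open>Hermitian symmetry moves the varying index into the argument of a fixed
        continuous function.\<close>
      have swap: "nev (nkerf \<eta>) v = cnj (nev (nkerf v) \<eta>)" for \<eta>
        unfolding nev_eq_cinner by (rule fock_cinner_commute)
      have "(\<lambda>i. nev (nkerf v) (X i)) \<longlonglongrightarrow> nev (nkerf v) \<xi>"
        using continuous_on_tendsto_compose[OF continuous_on_nev assms] by simp
      then have "(\<lambda>i. nev (nkerf \<xi>) v - cnj (nev (nkerf v) (X i))) \<longlonglongrightarrow> nev (nkerf \<xi>) v - cnj (nev (nkerf v) \<xi>)"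
        by (intro tendsto_intros)
      then have "(\<lambda>i. nev (nkerf \<xi> - nkerf (X i)) v) \<longlonglongrightarrow> 0"
        unfolding nev_diff swap[symmetric] by simp
      then have "(\<lambda>i. ennreal (cmod (nev (nkerf \<xi> - nkerf (X i)) v))) \<longlonglongrightarrow> ennreal 0"
        by (intro tendsto_ennrealI tendsto_norm_zero)
      then show "(\<lambda>i. ennreal (cmod (nev (nkerf \<xi> - nkerf (X i)) v))) \<longlonglongrightarrow> 0" by simp
    qed
  qed measurable
  then show ?thesis by (simp add: kerdist_def)
qed

text \<open>Simple functions converge to the identity only pointwise; this suffices because the
  Gaussian weight and \<open>kerdist_le\<close> allow dominated convergence of
  \<open>E\<close>.\<close>

lemma Fl_subset_cstar:
  fixes S :: "('n::finite) fock_op set"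
  assumes S: "cstar_subalgebra S" "\<And>f. f \<in> Linfty \<Longrightarrow> toeplitz f \<in> S"
  shows "Fl \<subseteq> S"
proof
  fix A :: "'n fock_op" assume "A \<in> Fl"
  then obtain \<gamma> d where A: "localized \<gamma> d A" unfolding Fl_iff_localized by blast
  obtain s :: "nat \<Rightarrow> complex^'n \<Rightarrow> complex^'n" where
    s: "\<And>i. simple_function lborel (s i)" and lim: "\<And>\<xi>. (\<lambda>i. s i \<xi>) \<longlonglongrightarrow> \<xi>"
    using borel_measurable_implies_sequence_metric[of "\<lambda>\<xi>::complex^'n. \<xi>" lborel 0] by auto
  have [measurable]: "s i \<in> borel_measurable borel" for i using borel_measurable_simple_function[OF s] by simp
  define E where "E i = (\<integral>\<^sup>+\<xi>. ennreal (exp (- \<gamma> * (norm \<xi>)\<^sup>2)) * kerdist \<xi> (s i \<xi>) \<partial>lborel)" for i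
  let ?C = "ennreal (2 * sqrt (pi * 2) ^ DIM(complex^'n))"
  let ?w = "\<lambda>\<xi>::complex^'n. ennreal (exp (- \<gamma> * (norm \<xi>)\<^sup>2)) * ?C"
  have w: "(\<integral>\<^sup>+\<xi>. ?w \<xi> \<partial>lborel) < \<infinity>"
  proof -
    have "(\<integral>\<^sup>+\<xi>. ennreal (exp (- \<gamma> * (norm (\<xi>::complex^'n))\<^sup>2)) \<partial>lborel) < \<infinity>"
      using nn_integral_eq_integral[OF integrable_gaussian[OF localizedD(2)[OF A], where 'n='n]] by simp
    then show ?thesis by (subst nn_integral_multc) (auto simp: ennreal_mult_less_top)
  qed
  have le: "ennreal (exp (- \<gamma> * (norm \<xi>)\<^sup>2)) * kerdist \<xi> (s i \<xi>) \<le> ?w \<xi>" for i \<xi>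
    by (intro mult_left_mono kerdist_le) simp
  have E_fin: "E i < \<infinity>" for i
    unfolding E_def by (rule order.strict_trans1[OF nn_integral_mono w]) (rule le)
  have "E \<longlonglongrightarrow> (\<integral>\<^sup>+(\<xi>::complex^'n). 0 \<partial>lborel)"
    unfolding E_def
  proof (rule nn_integral_dominated_convergence[where w = ?w])
    show "AE \<xi> in lborel. (\<lambda>i. ennreal (exp (- \<gamma> * (norm \<xi>)\<^sup>2)) * kerdist \<xi> (s i \<xi>)) \<longlonglongrightarrow> 0"
    proof (rule AE_I2)
      fix \<xi> :: "complex^'n"
      show "(\<lambda>i. ennreal (exp (- \<gamma> * (norm \<xi>)\<^sup>2)) * kerdist \<xi> (s i \<xi>)) \<longlonglongrightarrow> 0"
        using ennreal_tendsto_cmult[OF _ kerdist_tendsto_0[OF lim, of \<xi>], of "ennreal (exp (- \<gamma> * (norm \<xi>)\<^sup>2))"] by simp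
    qed
  qed (use w le in auto)
  then have "E \<longlonglongrightarrow> ennreal 0" by simp
  then have E0: "(\<lambda>i. enn2real (E i)) \<longlonglongrightarrow> 0" by (rule tendsto_enn2real) simp
  have "\<exists>B\<in>S. norm (A - B) \<le> d / (pi ^ CARD('n))\<^sup>2 * enn2real (E i)" for i
    unfolding E_def by (rule localized_approx[OF S A s]) (use E_fin[of i] in \<open>simp_all add: E_def\<close>)
  then obtain B where B: "\<And>i. B i \<in> S" "\<And>i. norm (A - B i) \<le> d / (pi ^ CARD('n))\<^sup>2 * enn2real (E i)" by metis
  have "(\<lambda>i. B i - A) \<longlonglongrightarrow> 0"
  proof (rule Lim_null_comparison)
    show "\<forall>\<^sub>F i in sequentially. norm (B i - A) \<le> d / (pi ^ CARD('n))\<^sup>2 * enn2real (E i)"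
      using B(2) by (simp add: norm_minus_commute)
    show "(\<lambda>i. d / (pi ^ CARD('n))\<^sup>2 * enn2real (E i)) \<longlonglongrightarrow> 0"
      using tendsto_mult_right_zero[OF E0] by blast
  qed
  then have "B \<longlonglongrightarrow> A" by (rule LIM_zero_cancel)
  moreover have "closed S" using S(1) by (simp add: cstar_subalgebra_def)
  ultimately show "A \<in> S" using B(1) by (meson closed_sequentially)
qed

theorem theorem4p16:
  shows "cstar_subalgebra (closure (Fl :: ('n::finite) fock_op set)) \<and>
    (toeplitz_algebra :: 'n fock_op set) = closure Fl \<and>
    closure (Fl :: 'n fock_op set) =
      cstar_generated {toeplitz f | f. f \<in> BMO \<and> toeplitz_symbol f \<and> toeplitz_bounded f}"
proof -
  \<comment> \<open>Both generating sets lie between the Toeplitz operators with bounded symbols and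
    \<open>Fl\<close>. For any such set one inclusion holds because the closure of \<open>Fl\<close>
    is a C*-algebra, the other by \<open>Fl_subset_cstar\<close>.\<close>
  have generated: "cstar_generated M = closure (Fl :: 'n fock_op set)"
    if M: "M \<subseteq> Fl" "{toeplitz f | f. f \<in> Linfty} \<subseteq> M" for M :: "'n fock_op set"
  proof
    show "cstar_generated M \<subseteq> closure Fl"
      unfolding cstar_generated_def using cstar_closure_Fl M(1) closure_subset[of Fl] by blast
    show "closure Fl \<subseteq> cstar_generated M"
      unfolding cstar_generated_def
    proof (rule Inter_greatest)
      fix S assume "S \<in> {S. cstar_subalgebra S \<and> M \<subseteq> S}"
      then have S: "cstar_subalgebra S" "\<And>f. f \<in> Linfty \<Longrightarrow> toeplitz f \<in> S" using M(2) by auto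
      then show "closure Fl \<subseteq> S"
        by (intro closure_minimal Fl_subset_cstar) (auto simp: cstar_subalgebra_def)
    qed
  qed
  have 1: "(toeplitz_algebra :: 'n fock_op set) = closure Fl"
    unfolding toeplitz_algebra_def by (rule generated) (auto intro: Linfty_toeplitz)
  have 2: "cstar_generated {toeplitz f | f. f \<in> BMO \<and> toeplitz_symbol f \<and> toeplitz_bounded f}
      = closure (Fl :: 'n fock_op set)"
    by (rule generated) (auto intro: toeplitz_BMO_Fl Linfty_BMO Linfty_toeplitz_symbol Linfty_toeplitz)
  show ?thesis by (intro conjI cstar_closure_Fl 1 2[symmetric])
qed

end
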